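(* If $X$ and $Y$ are two bimeromorphically equivalent compact complex manifolds of complex dimension $n$, then for every $0\leq p\leq n$ we have $$h_{BC}^{p,0}(X)=h_{BC}^{p,0}(Y).$$
   Context: For a compact complex manifold $M$, let $\mathcal{A}^{p,q}(M;\mathbb{C})$ be the space of smooth complex-valued $(p,q)$-forms, $d=\partial+\bar\partial$. The Bott-Chern cohomology is $$H^{p,q}_{BC}(M)=\frac{\ker\partial\cap\ker\bar\partial\cap\mathcal{A}^{p,q}(M;\mathbb{C})}{\partial\bar\partial\,\mathcal{A}^{p-1,q-1}(M;\mathbb{C})},$$ and $h^{p,q}_{BC}(M)=\dim_{\mathbb{C}}H^{p,q}_{BC}(M)$. A modification of a compact complex space $V$ of dimension $n$ is a proper holomorphic map $g:\tilde V\to V$ with $\tilde V$ a compact complex space of dimension $n$, such that there is an analytic subset $S\subset V$ of codimension $\geq 2$ for which $g:\tilde V\setminus g^{-1}(S)\to V\setminus S$ is a biholomorphism. A meromorphic map $f:V\dashrightarrow W$ of compact complex spaces is a map from $V$ to the set of subsets of $W$ whose graph $G_f=\{(x,y)\in V\times W\mid y\in f(x)\}$ is an analytic subset of $V\times W$ and such that the projection $G_f\to V$ is a modification; it is bimeromorphic if the projection $G_f\to W$ is also a modification. $V$ and $W$ are bimeromorphically equivalent if there is a bimeromorphic map $V\dashrightarrow W$.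
   Formalization: In a modification g, the complement of g^{-1}(S) is also required to be dense in the source space (automatic if it is irreducible); otherwise X×{y} ∪ {x}×Y would make any two compact manifolds of equal dimension at least 2 bimeromorphically equivalent. *)

theory Defs
  imports "HOL-Analysis.Analysis" "HOL-Algebra.AbelCoset" "Jordan_Normal_Form.VS_Connect"
begin

section \<open>Functions of several complex variables\<close>

text \<open>
  The space \<open>\<complex>\<^sup>n\<close> is the set of sequences supported in \<open>{..<n}\<close>, with the topology inherited from
  the product topology on \<^typ>\<open>nat \<Rightarrow> complex\<close>. Thus \<open>n\<close> is a term, and \<open>n = 0\<close> is allowed.
\<close>

type_synonym cvec = "nat \<Rightarrow> complex"

definition cspace :: "nat \<Rightarrow> cvec set" where
  "cspace n = {z. \<forall>i\<ge>n. z i = 0}"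

definition hol_fun :: "nat \<Rightarrow> cvec set \<Rightarrow> (cvec \<Rightarrow> complex) \<Rightarrow> bool" where
  "hol_fun n W f \<longleftrightarrow> continuous_on W f \<and>
     (\<forall>z\<in>W. \<forall>j<n. (\<lambda>w. f (z(j := w))) field_differentiable at (z j))"

text \<open>
  Real partial derivative in the \<open>j\<close>-th coordinate in the direction \<open>u\<close>: writing
  \<open>z j = x j + \<i> * y j\<close>, the choice \<open>u = 1\<close> gives \<open>\<partial>/\<partial>x\<^sub>j\<close> and \<open>u = \<i>\<close> gives \<open>\<partial>/\<partial>y\<^sub>j\<close>.
\<close>

definition dir_path :: "nat \<Rightarrow> complex \<Rightarrow> cvec \<Rightarrow> real \<Rightarrow> cvec" where
  "dir_path j u z t = z(j := z j + of_real t * u)"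

definition rpartial :: "nat \<Rightarrow> complex \<Rightarrow> (cvec \<Rightarrow> complex) \<Rightarrow> cvec \<Rightarrow> complex" where
  "rpartial j u f z = vector_derivative (\<lambda>t. f (dir_path j u z t)) (at 0)"

primrec Ck_on :: "nat \<Rightarrow> nat \<Rightarrow> cvec set \<Rightarrow> (cvec \<Rightarrow> complex) \<Rightarrow> bool" where
  "Ck_on 0 n W f = continuous_on W f"
| "Ck_on (Suc k) n W f = (continuous_on W f \<and>
     (\<forall>j<n. \<forall>u\<in>{1, \<i>}.
        (\<forall>z\<in>W. (\<lambda>t. f (dir_path j u z t)) differentiable (at 0)) \<and>
        Ck_on k n W (rpartial j u f)))"

definition smooth_on :: "nat \<Rightarrow> cvec set \<Rightarrow> (cvec \<Rightarrow> complex) \<Rightarrow> bool" where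
  "smooth_on n W f \<longleftrightarrow> (\<forall>k. Ck_on k n W f)"

definition wirtinger :: "nat \<Rightarrow> (cvec \<Rightarrow> complex) \<Rightarrow> cvec \<Rightarrow> complex" where
  "wirtinger j f z = (rpartial j 1 f z - \<i> * rpartial j \<i> f z) / 2"

definition wirtinger_bar :: "nat \<Rightarrow> (cvec \<Rightarrow> complex) \<Rightarrow> cvec \<Rightarrow> complex" where
  "wirtinger_bar j f z = (rpartial j 1 f z + \<i> * rpartial j \<i> f z) / 2"


section \<open>Complex manifolds\<close>

text \<open>A chart is a pair of its domain and its coordinate map (arbitrary outside the domain).\<close>

type_synonym 'a chart = "'a set \<times> ('a \<Rightarrow> cvec)"

record 'a cmanifold =
  cm_dim :: nat
  cm_top :: "'a topology"
  cm_atlas :: "'a chart set"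

abbreviation points :: "'a cmanifold \<Rightarrow> 'a set" where
  "points M \<equiv> topspace (cm_top M)"

abbreviation chart_image :: "'a chart \<Rightarrow> cvec set" where
  "chart_image c \<equiv> snd c ` fst c"

abbreviation chart_inv :: "'a chart \<Rightarrow> cvec \<Rightarrow> 'a" where
  "chart_inv c \<equiv> inv_into (fst c) (snd c)"

definition is_chart :: "nat \<Rightarrow> 'a topology \<Rightarrow> 'a chart \<Rightarrow> bool" where
  "is_chart n T c \<longleftrightarrow> openin T (fst c) \<and>
     openin (top_of_set (cspace n)) (chart_image c) \<and>
     homeomorphic_map (subtopology T (fst c)) (top_of_set (chart_image c)) (snd c)"

definition transition :: "'a chart \<Rightarrow> 'a chart \<Rightarrow> cvec \<Rightarrow> cvec" where
  "transition c c' z = snd c' (chart_inv c z)"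

definition hol_transition :: "nat \<Rightarrow> 'a chart \<Rightarrow> 'a chart \<Rightarrow> bool" where
  "hol_transition n c c' \<longleftrightarrow>
     (\<forall>i<n. hol_fun n (snd c ` (fst c \<inter> fst c')) (\<lambda>z. transition c c' z i))"

definition complex_manifold :: "'a cmanifold \<Rightarrow> bool" where
  "complex_manifold M \<longleftrightarrow>
     Hausdorff_space (cm_top M) \<and> second_countable (cm_top M) \<and>
     (\<forall>c\<in>cm_atlas M. is_chart (cm_dim M) (cm_top M) c) \<and>
     points M = \<Union> (fst ` cm_atlas M) \<and>
     (\<forall>c\<in>cm_atlas M. \<forall>c'\<in>cm_atlas M. hol_transition (cm_dim M) c c')"

definition compact_complex_manifold :: "'a cmanifold \<Rightarrow> bool" where
  "compact_complex_manifold M \<longleftrightarrow> complex_manifold M \<and> compact_space (cm_top M)"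

text \<open>The atlas need not be maximal; this describes the charts of the maximal one.\<close>

definition holomorphic_chart :: "'a cmanifold \<Rightarrow> 'a chart \<Rightarrow> bool" where
  "holomorphic_chart M c \<longleftrightarrow> is_chart (cm_dim M) (cm_top M) c \<and>
     (\<forall>c'\<in>cm_atlas M. hol_transition (cm_dim M) c c' \<and> hol_transition (cm_dim M) c' c)"

definition prod_chart :: "nat \<Rightarrow> 'a chart \<Rightarrow> 'b chart \<Rightarrow> ('a \<times> 'b) chart" where
  "prod_chart m c d = (fst c \<times> fst d,
     \<lambda>(x, y) i. if i < m then snd c x i else snd d y (i - m))"

definition prod_cmanifold :: "'a cmanifold \<Rightarrow> 'b cmanifold \<Rightarrow> ('a \<times> 'b) cmanifold" where
  "prod_cmanifold M N =
     \<lparr>cm_dim = cm_dim M + cm_dim N,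
      cm_top = prod_topology (cm_top M) (cm_top N),
      cm_atlas = {prod_chart (cm_dim M) c d | c d. c \<in> cm_atlas M \<and> d \<in> cm_atlas N}\<rparr>"


section \<open>Differential forms and Bott--Chern cohomology\<close>

text \<open>
  A \<open>(p,q)\<close>-form is given by its coefficients in all charts of the atlas: \<open>\<omega> c z I J\<close> is the
  coefficient of \<open>dz\<^sub>I \<and> d\<bar>z\<^sub>J\<close> at the point with \<open>c\<close>-coordinates \<open>z\<close>, where the multi-indices
  are sets \<open>I, J \<subseteq> {..<n}\<close> of sizes \<open>p, q\<close>, enumerated increasingly. The coefficients in different
  charts are related by pullback along the transition map. All values outside the range of
  meaningful arguments are \<open>0\<close>, so that equality of forms is equality of functions.
\<close>

type_synonym 'a cform = "'a chart \<Rightarrow> cvec \<Rightarrow> nat set \<Rightarrow> nat set \<Rightarrow> complex"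

definition multi_index :: "nat \<Rightarrow> nat \<Rightarrow> nat set set" where
  "multi_index n p = {I. I \<subseteq> {..<n} \<and> card I = p}"

text \<open>The minor \<open>det (\<partial>\<tau>\<^sub>K / \<partial>z\<^sub>I)\<close> of the holomorphic Jacobian matrix.\<close>

definition jacobian_minor :: "(cvec \<Rightarrow> cvec) \<Rightarrow> cvec \<Rightarrow> nat set \<Rightarrow> nat set \<Rightarrow> complex" where
  "jacobian_minor \<tau> z K I = Determinant.det (Matrix.mat (card K) (card I)
     (\<lambda>(a, b). let k = sorted_list_of_set K ! a; i = sorted_list_of_set I ! b
               in deriv (\<lambda>w. \<tau> (z(i := w)) k) (z i)))"

definition forms :: "'a cmanifold \<Rightarrow> nat \<Rightarrow> nat \<Rightarrow> 'a cform set" where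
  "forms M p q = {\<omega>.
     (\<forall>c z I J. \<not> (c \<in> cm_atlas M \<and> z \<in> chart_image c \<and>
                    I \<in> multi_index (cm_dim M) p \<and> J \<in> multi_index (cm_dim M) q)
        \<longrightarrow> \<omega> c z I J = 0) \<and>
     (\<forall>c\<in>cm_atlas M. \<forall>I J. smooth_on (cm_dim M) (chart_image c) (\<lambda>z. \<omega> c z I J)) \<and>
     (\<forall>c\<in>cm_atlas M. \<forall>c'\<in>cm_atlas M. \<forall>z\<in>snd c ` (fst c \<inter> fst c').
        \<forall>I\<in>multi_index (cm_dim M) p. \<forall>J\<in>multi_index (cm_dim M) q.
          \<omega> c z I J =
            (\<Sum>K\<in>multi_index (cm_dim M) p. \<Sum>L\<in>multi_index (cm_dim M) q.
               jacobian_minor (transition c c') z K I *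
               cnj (jacobian_minor (transition c c') z L J) *
               \<omega> c' (transition c c' z) K L))}"

text \<open>
  The sign of \<open>dz\<^sub>k \<and> dz\<^bsub>K - {k}\<^esub> = \<plusminus> dz\<^sub>K\<close>. In \<open>\<bar>\<partial>\<close> the factor \<open>(-1)\<close> to the power \<open>card I\<close> comes from
  moving \<open>d\<bar>z\<^sub>k\<close> past \<open>dz\<^sub>I\<close>.
\<close>

definition index_sign :: "nat set \<Rightarrow> nat \<Rightarrow> complex" where
  "index_sign K k = (-1) ^ card {i\<in>K. i < k}"

definition del :: "'a cmanifold \<Rightarrow> 'a cform \<Rightarrow> 'a cform" where
  "del M \<omega> c z I J =
     (if c \<in> cm_atlas M \<and> z \<in> chart_image c \<and> I \<subseteq> {..<cm_dim M} \<and> J \<subseteq> {..<cm_dim M}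
      then \<Sum>k\<in>I. index_sign I k * wirtinger k (\<lambda>w. \<omega> c w (I - {k}) J) z
      else 0)"

definition del_bar :: "'a cmanifold \<Rightarrow> 'a cform \<Rightarrow> 'a cform" where
  "del_bar M \<omega> c z I J =
     (if c \<in> cm_atlas M \<and> z \<in> chart_image c \<and> I \<subseteq> {..<cm_dim M} \<and> J \<subseteq> {..<cm_dim M}
      then (-1) ^ card I *
           (\<Sum>k\<in>J. index_sign J k * wirtinger_bar k (\<lambda>w. \<omega> c w I (J - {k})) z)
      else 0)"

definition zero_form :: "'a cform" where
  "zero_form = (\<lambda>c z I J. 0)"

text \<open>
  The fields \<open>mult\<close> and \<open>one\<close>, which the record type \<^typ>\<open>('k, 'v) module\<close> inherits from rings, play
  no role for modules.
\<close>

definition form_space :: "'a cform set \<Rightarrow> (complex, 'a cform) module" where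
  "form_space S =
     \<lparr>carrier = S, mult = undefined, one = undefined, zero = zero_form,
      add = (\<lambda>\<omega> \<eta> c z I J. \<omega> c z I J + \<eta> c z I J),
      smult = (\<lambda>a \<omega> c z I J. a * \<omega> c z I J)\<rparr>"

text \<open>In the quotient, adding \<open>B\<close> to \<open>a \<odot> C\<close> matters only for \<open>a = 0\<close>.\<close>

definition quotient_module :: "('k, 'v) module \<Rightarrow> 'v set \<Rightarrow> ('k, 'v set) module" where
  "quotient_module V B =
     \<lparr>carrier = A_RCOSETS V B, mult = undefined, one = undefined, zero = B,
      add = set_add V,
      smult = (\<lambda>a C. set_add V B ((\<lambda>v. a \<odot>\<^bsub>V\<^esub> v) ` C))\<rparr>"

definition BC_cocycles :: "'a cmanifold \<Rightarrow> nat \<Rightarrow> nat \<Rightarrow> 'a cform set" where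
  "BC_cocycles M p q = {\<omega>\<in>forms M p q. del M \<omega> = zero_form \<and> del_bar M \<omega> = zero_form}"

text \<open>Forms of negative degree vanish; this is the first case.\<close>

definition BC_coboundaries :: "'a cmanifold \<Rightarrow> nat \<Rightarrow> nat \<Rightarrow> 'a cform set" where
  "BC_coboundaries M p q =
     (if p = 0 \<or> q = 0 then {zero_form}
      else (\<lambda>\<eta>. del M (del_bar M \<eta>)) ` forms M (p - 1) (q - 1))"

definition H_BC :: "'a cmanifold \<Rightarrow> nat \<Rightarrow> nat \<Rightarrow> (complex, 'a cform set) module" where
  "H_BC M p q = quotient_module (form_space (BC_cocycles M p q)) (BC_coboundaries M p q)"

definition h_BC :: "'a cmanifold \<Rightarrow> nat \<Rightarrow> nat \<Rightarrow> nat" where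
  "h_BC M p q = vectorspace.dim class_ring (H_BC M p q)"


section \<open>Analytic subsets and holomorphic maps\<close>

definition holomorphic_fun_on :: "'a cmanifold \<Rightarrow> 'a set \<Rightarrow> ('a \<Rightarrow> complex) \<Rightarrow> bool" where
  "holomorphic_fun_on M U f \<longleftrightarrow>
     (\<forall>c\<in>cm_atlas M. hol_fun (cm_dim M) (snd c ` (fst c \<inter> U)) (\<lambda>z. f (chart_inv c z)))"

definition analytic_subset :: "'a cmanifold \<Rightarrow> 'a set \<Rightarrow> bool" where
  "analytic_subset M A \<longleftrightarrow> A \<subseteq> points M \<and>
     (\<forall>x\<in>points M. \<exists>U F. openin (cm_top M) U \<and> x \<in> U \<and> finite F \<and>
        (\<forall>f\<in>F. holomorphic_fun_on M U f) \<and> A \<inter> U = {y\<in>U. \<forall>f\<in>F. f y = 0})"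

definition regular_point :: "'a cmanifold \<Rightarrow> 'a set \<Rightarrow> nat \<Rightarrow> 'a \<Rightarrow> bool" where
  "regular_point M A d x \<longleftrightarrow> x \<in> A \<and> d \<le> cm_dim M \<and>
     (\<exists>c. holomorphic_chart M c \<and> x \<in> fst c \<and>
        A \<inter> fst c = {y\<in>fst c. \<forall>i. d \<le> i \<and> i < cm_dim M \<longrightarrow> snd c y i = 0})"

text \<open>
  The dimension of an analytic set is the largest dimension of its regular locus. All complex
  manifolds here are pure-dimensional, so codimension in a manifold is a difference of dimensions;
  the empty set has codimension at least \<open>k\<close> for every \<open>k\<close>.
\<close>

definition has_dimension :: "'a cmanifold \<Rightarrow> 'a set \<Rightarrow> nat \<Rightarrow> bool" where
  "has_dimension M A d \<longleftrightarrow> (\<exists>x. regular_point M A d x) \<and>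
     (\<forall>e x. regular_point M A e x \<longrightarrow> e \<le> d)"

definition codim_at_least :: "'a cmanifold \<Rightarrow> 'a set \<Rightarrow> nat \<Rightarrow> bool" where
  "codim_at_least M A k \<longleftrightarrow> (\<forall>d x. regular_point M A d x \<longrightarrow> d + k \<le> cm_dim M)"

text \<open>
  Holomorphic maps from a locally analytic subset \<open>A\<close> of \<open>M\<close>, with its reduced structure, into \<open>N\<close>:
  in coordinates of \<open>N\<close> they are locally restrictions of holomorphic functions on \<open>M\<close>. A holomorphic
  map into an analytic subset \<open>B\<close> of \<open>N\<close> is one into \<open>N\<close> with values in \<open>B\<close>.
\<close>

definition holomorphic_map :: "'a cmanifold \<Rightarrow> 'a set \<Rightarrow> 'b cmanifold \<Rightarrow> 'b set \<Rightarrow> ('a \<Rightarrow> 'b) \<Rightarrow> bool"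
  where "holomorphic_map M A N B g \<longleftrightarrow> A \<subseteq> points M \<and> B \<subseteq> points N \<and> g ` A \<subseteq> B \<and>
     (\<forall>a\<in>A. \<forall>c\<in>cm_atlas N. g a \<in> fst c \<longrightarrow>
        (\<exists>U F. openin (cm_top M) U \<and> a \<in> U \<and> g ` (A \<inter> U) \<subseteq> fst c \<and>
           (\<forall>i<cm_dim N. holomorphic_fun_on M U (F i) \<and>
              (\<forall>y\<in>A \<inter> U. snd c (g y) i = F i y))))"

definition biholomorphism :: "'a cmanifold \<Rightarrow> 'a set \<Rightarrow> 'b cmanifold \<Rightarrow> 'b set \<Rightarrow> ('a \<Rightarrow> 'b) \<Rightarrow> bool"
  where "biholomorphism M A N B g \<longleftrightarrow> holomorphic_map M A N B g \<and>
     (\<exists>h. holomorphic_map N B M A h \<and> (\<forall>x\<in>A. h (g x) = x) \<and> (\<forall>y\<in>B. g (h y) = y))"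


section \<open>Modifications and bimeromorphic maps\<close>

text \<open>
  Modifications \<open>g : A \<rightarrow> N\<close>, where the complex space \<open>A\<close> is an analytic subset of a manifold \<open>M\<close> and
  \<open>N\<close> is a compact complex manifold; this covers the projections from the graph of a map between
  manifolds. Following the usual convention, the part \<open>A - g -` S\<close> on which \<open>g\<close> is biholomorphic is
  required to be dense in \<open>A\<close>, which is automatic when \<open>A\<close> is irreducible (and nonempty). Without it,
  for any compact manifolds \<open>X\<close>, \<open>Y\<close> of equal dimension at least 2, the reducible set
  \<open>X \<times> {y} \<union> {x} \<times> Y\<close> would be the graph of a bimeromorphic map.
\<close>

definition modification :: "'a cmanifold \<Rightarrow> 'a set \<Rightarrow> 'b cmanifold \<Rightarrow> ('a \<Rightarrow> 'b) \<Rightarrow> bool" where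
  "modification M A N g \<longleftrightarrow>
     analytic_subset M A \<and> compactin (cm_top M) A \<and> has_dimension M A (cm_dim N) \<and>
     holomorphic_map M A N (points N) g \<and>
     proper_map (subtopology (cm_top M) A) (cm_top N) g \<and>
     (\<exists>S. analytic_subset N S \<and> codim_at_least N S 2 \<and>
        A \<subseteq> (cm_top M) closure_of (A - g -` S) \<and>
        biholomorphism M (A - g -` S) N (points N - S) g)"

definition mero_graph :: "'a cmanifold \<Rightarrow> 'b cmanifold \<Rightarrow> ('a \<Rightarrow> 'b set) \<Rightarrow> ('a \<times> 'b) set" where
  "mero_graph X Y f = {(x, y). x \<in> points X \<and> y \<in> points Y \<and> y \<in> f x}"

definition meromorphic_map :: "'a cmanifold \<Rightarrow> 'b cmanifold \<Rightarrow> ('a \<Rightarrow> 'b set) \<Rightarrow> bool" where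
  "meromorphic_map X Y f \<longleftrightarrow>
     (\<forall>x\<in>points X. f x \<subseteq> points Y) \<and>
     analytic_subset (prod_cmanifold X Y) (mero_graph X Y f) \<and>
     modification (prod_cmanifold X Y) (mero_graph X Y f) X fst"

definition bimeromorphic_map :: "'a cmanifold \<Rightarrow> 'b cmanifold \<Rightarrow> ('a \<Rightarrow> 'b set) \<Rightarrow> bool" where
  "bimeromorphic_map X Y f \<longleftrightarrow> meromorphic_map X Y f \<and>
     modification (prod_cmanifold X Y) (mero_graph X Y f) Y snd"

definition bimeromorphically_equivalent :: "'a cmanifold \<Rightarrow> 'b cmanifold \<Rightarrow> bool" where
  "bimeromorphically_equivalent X Y \<longleftrightarrow> (\<exists>f. bimeromorphic_map X Y f)"

end

theory Submission
  imports Defs "HOL-Complex_Analysis.Complex_Analysis"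
begin

text \<open>
  A class in \<open>H\<^sub>B\<^sub>C\<^bsup>p,0\<^esup>\<close> is a closed holomorphic \<open>p\<close>-form. A bimeromorphic map gives holomorphic maps
  \<open>\<phi> : X - S \<rightarrow> Y\<close> and \<open>\<psi> : Y - T \<rightarrow> X\<close>, mutually inverse on dense open sets, where \<open>S\<close> and \<open>T\<close> are
  analytic of codimension at least 2. The pullback of a closed holomorphic form along \<open>\<phi>\<close> is closed
  and holomorphic on \<open>X - S\<close> and extends across \<open>S\<close>. Being a pullback along \<open>\<phi>\<close> is, by density,
  the inverse relation of being a pullback along \<open>\<psi>\<close>, which makes it a linear bijection.

  The extension theorem avoids the structure theory of analytic sets. Let \<open>E \<subseteq> S\<close> be the
  set of points across which the function does not extend. If \<open>E\<close> is nonempty, some holomorphic \<open>g\<close>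
  vanishes on \<open>E\<close> near a point \<open>b \<in> E\<close> with a nonzero partial derivative there, so that \<open>E\<close> lies in
  a graph \<open>z\<^sub>j = h(z)\<close> near \<open>b\<close>. If \<open>E\<close> misses a point of the graph, then a Cauchy integral in \<open>z\<^sub>j\<close>
  extends the function to \<open>b\<close>; so \<open>E\<close>, and hence \<open>S\<close>, contains the graph. Dividing a defining function of
  \<open>S\<close> by the largest possible power of \<open>z\<^sub>j - h(z)\<close> shows that \<open>S\<close> equals the graph near some
  point, which is then a regular point of codimension 1.
\<close>

section \<open>Holomorphic functions of several variables\<close>

text \<open>Codimension is accessible only through regular points. The bound 2 forbids two
  configurations: an open piece of \<open>S\<close> (a regular point of codimension 0) and a piece
  that some holomorphic chart carries to a coordinate hyperplane (codimension 1). Every use of the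
  bound produces one of these. A suitable \<open>g\<close> exists because otherwise the functions
  vanishing on \<open>E\<close> near a point would be closed under partial derivatives. Each would
  then have a zero Taylor series there and vanish identically, while a defining function of
  \<open>S\<close> does not. The Cauchy integral can be trusted because one graph point outside
  \<open>E\<close> yields an open set of discs on which it reproduces the function; the identity
  theorem carries the equality to the other discs. For closedness of pullbacks the obstacle is the
  bookkeeping of signs of sorted multi-indices. Coefficients are therefore extended to alternating
  functions on all tuples, where permutations act by composition and the identities become
  reindexings of sums.\<close>

abbreviation open_cspace :: "nat \<Rightarrow> cvec set \<Rightarrow> bool" where
  "open_cspace n W \<equiv> openin (top_of_set (cspace n)) W"

text \<open>Each coordinate has its own radius: the implicit function theorem uses a long direction
  \<open>j\<close> and short transverse directions.\<close>

definition polydisc :: "nat \<Rightarrow> cvec \<Rightarrow> (nat \<Rightarrow> real) \<Rightarrow> cvec set" where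
  "polydisc n a r = {z \<in> cspace n. \<forall>i<n. cmod (z i - a i) < r i}"

definition partial_deriv :: "nat \<Rightarrow> (cvec \<Rightarrow> complex) \<Rightarrow> cvec \<Rightarrow> complex" where
  "partial_deriv j f z = deriv (\<lambda>w. f (z(j := w))) (z j)"

lemma cspace_upd: "z \<in> cspace n \<Longrightarrow> j < n \<Longrightarrow> z(j := w) \<in> cspace n"
  by (auto simp: cspace_def)

lemma open_cspace_subset: "open_cspace n W \<Longrightarrow> W \<subseteq> cspace n"
  by (rule openin_imp_subset)

lemma continuous_on_fun_upd:
  fixes f :: "'a::topological_space \<Rightarrow> cvec"
  assumes "continuous_on S f" "continuous_on S g"
  shows "continuous_on S (\<lambda>x. (f x)(j := g x))"
proof (rule continuous_on_coordinatewise_then_product)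
  fix i
  have "continuous_on S (\<lambda>x. f x i)"
    using continuous_on_compose2[OF continuous_on_product_coordinates assms(1), of i] by auto
  then show "continuous_on S (\<lambda>x. ((f x)(j := g x)) i)"
    using assms(2) by (cases "i = j") auto
qed

lemma continuous_on_coord:
  fixes f :: "'a::topological_space \<Rightarrow> cvec"
  assumes "continuous_on S f"
  shows "continuous_on S (\<lambda>x. f x i)"
  using continuous_on_compose2[OF continuous_on_product_coordinates assms, of i] by auto

lemma polydisc_open_cspace: "open_cspace n (polydisc n a r)"
proof -
  have "open {z::cvec. \<forall>i\<in>{..<n}. cmod (z i - a i) < r i}"
  proof -
    have "{z::cvec. \<forall>i\<in>{..<n}. cmod (z i - a i) < r i} = (\<Inter>i\<in>{..<n}. {z. cmod (z i - a i) < r i})"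
      by auto
    moreover have "open {z::cvec. cmod (z i - a i) < r i}" for i
      by (intro open_Collect_less continuous_intros continuous_on_product_coordinates)
    ultimately show ?thesis by (metis (no_types, lifting) open_INT finite_lessThan)
  qed
  moreover have "polydisc n a r = cspace n \<inter> {z::cvec. \<forall>i\<in>{..<n}. cmod (z i - a i) < r i}"
    by (auto simp: polydisc_def)
  ultimately show ?thesis by (auto simp: openin_open)
qed

lemma polydisc_centre: "a \<in> cspace n \<Longrightarrow> (\<And>i. i < n \<Longrightarrow> 0 < r i) \<Longrightarrow> a \<in> polydisc n a r"
  by (simp add: polydisc_def)

lemma polydisc_upd:
  "z \<in> polydisc n a r \<Longrightarrow> j < n \<Longrightarrow> cmod (w - a j) < r j \<Longrightarrow> z(j := w) \<in> polydisc n a r"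
  by (auto simp: polydisc_def cspace_upd)

lemma open_cspace_polydisc:
  assumes "open_cspace n W" "a \<in> W"
  obtains e where "e > 0" "polydisc n a (\<lambda>_. e) \<subseteq> W"
proof -
  obtain T where T: "open T" "W = cspace n \<inter> T"
    using assms(1) by (auto simp: openin_open)
  \<comment> \<open>A basic open set of the product topology restricts only finitely many
    coordinates, so a single positive radius can serve all of them.\<close>
  have "openin (product_topology (\<lambda>i::nat. euclidean :: complex topology) UNIV) T"
    using T(1) by (simp add: open_fun_def)
  then obtain X where X: "a \<in> (\<Pi>\<^sub>E i\<in>UNIV. X i)" "\<And>i. open (X i)" "finite {i. X i \<noteq> UNIV}"
      "(\<Pi>\<^sub>E i\<in>UNIV. X i) \<subseteq> T"
    using product_topology_open_contains_basis[of "\<lambda>i::nat. euclidean :: complex topology" UNIV T a] T assms(2)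
    by auto
  have "\<forall>i. \<exists>e>0. ball (a i) e \<subseteq> X i"
    using X(1,2) open_contains_ball by (metis PiE_mem UNIV_I)
  then obtain e where e: "\<And>i. e i > 0" "\<And>i. ball (a i) (e i) \<subseteq> X i" by metis
  let ?I = "{i. X i \<noteq> UNIV}"
  \<comment> \<open>\<open>insert 1\<close> keeps the minimum meaningful when no coordinate is
    restricted.\<close>
  define d where "d = Min (insert 1 (e ` ?I))"
  have d: "d > 0" "\<And>i. i \<in> ?I \<Longrightarrow> d \<le> e i"
    using e X(3) by (auto simp: d_def Min_gr_iff)
  have "polydisc n a (\<lambda>_. d) \<subseteq> W"
  proof
    fix z assume z: "z \<in> polydisc n a (\<lambda>_. d)"
    have "z i \<in> X i" for i
    proof (cases "i \<in> ?I")
      case True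
      have "cmod (z i - a i) < e i"
      proof (cases "i < n")
        case True
        then show ?thesis using z d(2)[OF \<open>i \<in> ?I\<close>] by (auto simp: polydisc_def intro: less_le_trans)
      next
        \<comment> \<open>From index \<open>n\<close> on both points have entry 0, so a restriction
          there is satisfied.\<close>
        case False
        then have "z i = 0" "a i = 0" using z assms(2) open_cspace_subset[OF assms(1)] by (auto simp: polydisc_def cspace_def)
        then show ?thesis using e by simp
      qed
      then show ?thesis using e(2)[of i] by (auto simp: dist_norm norm_minus_commute)
    qed auto
    then have "z \<in> T" using X(4) by auto
    then show "z \<in> W" using T z by (auto simp: polydisc_def)
  qed
  then show ?thesis using that d by blast
qed

lemma open_cspace_vimage:
  fixes f :: "'a::topological_space \<Rightarrow> cvec"
  assumes "open_cspace n W" "continuous_on S f" "open S" "f ` S \<subseteq> cspace n"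
  shows "open {x\<in>S. f x \<in> W}"
proof -
  obtain T where T: "open T" "W = cspace n \<inter> T"
    using assms(1) by (auto simp: openin_open)
  have "{x\<in>S. f x \<in> W} = f -` T \<inter> S" using T assms(4) by auto
  then show ?thesis using assms(2,3) T continuous_on_open_vimage by metis
qed

lemma open_cspace_vimage':
  fixes f :: "cvec \<Rightarrow> cvec"
  assumes "open_cspace n W" "continuous_on S f" "open_cspace k S" "f ` S \<subseteq> cspace n"
  shows "open_cspace k {x\<in>S. f x \<in> W}"
proof -
  obtain T where T: "open T" "W = cspace n \<inter> T"
    using assms(1) by (auto simp: openin_open)
  have "{x\<in>S. f x \<in> W} = S \<inter> f -` T" using T assms(4) by auto
  moreover have "openin (top_of_set S) (S \<inter> f -` T)"
    using assms(2) T(1) continuous_on_open_gen by (simp add: continuous_openin_preimage_gen)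
  ultimately show ?thesis using assms(3) openin_trans by metis
qed

lemma open_cspace_slice:
  assumes "open_cspace n W" "z \<in> cspace n" "j < n"
  shows "open {w. z(j := w) \<in> W}"
proof -
  have "continuous_on UNIV (\<lambda>w. z(j := w))"
    by (rule continuous_on_fun_upd) (auto intro: continuous_on_const continuous_on_id)
  then show ?thesis
    using open_cspace_vimage[OF assms(1), of UNIV "\<lambda>w. z(j := w)"] assms cspace_upd by (simp add: image_subset_iff)
qed

section \<open>Separately holomorphic functions: slices, congruence, locality\<close>

lemma hol_fun_subset: "hol_fun n W f \<Longrightarrow> V \<subseteq> W \<Longrightarrow> hol_fun n V f"
  unfolding hol_fun_def using continuous_on_subset by blast

lemma hol_fun_has_partial_deriv:
  assumes "hol_fun n W f" "z \<in> W" "j < n"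
  shows "((\<lambda>w. f (z(j := w))) has_field_derivative partial_deriv j f z) (at (z j))"
  using assms unfolding hol_fun_def partial_deriv_def by (simp add: field_differentiable_derivI)

lemma hol_fun_has_partial_deriv':
  assumes "hol_fun n W f" "z(j := w) \<in> W" "j < n"
  shows "((\<lambda>w. f (z(j := w))) has_field_derivative partial_deriv j f (z(j := w))) (at w)"
  using hol_fun_has_partial_deriv[OF assms] by simp

lemma hol_fun_slice:
  assumes "hol_fun n W f" "j < n"
  shows "(\<lambda>w. f (z(j := w))) holomorphic_on {w. z(j := w) \<in> W}"
proof -
  have "(\<lambda>w. f (z(j := w))) field_differentiable at w" if "z(j := w) \<in> W" for w
    using assms that unfolding hol_fun_def by fastforce
  then show ?thesis by (simp add: holomorphic_on_def field_differentiable_at_within)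
qed

lemma hol_funI:
  assumes "continuous_on W f"
    "\<And>z j. z \<in> W \<Longrightarrow> j < n \<Longrightarrow> \<exists>D. ((\<lambda>w. f (z(j := w))) has_field_derivative D) (at (z j))"
  shows "hol_fun n W f"
  using assms unfolding hol_fun_def field_differentiable_def by blast

lemma hol_fun_cong:
  assumes "open_cspace n W" "\<And>z. z \<in> W \<Longrightarrow> f z = g z" "hol_fun n W f"
  shows "hol_fun n W g"
proof (rule hol_funI)
  show "continuous_on W g"
    using assms(2,3) continuous_on_cong unfolding hol_fun_def by metis
  fix z j assume z: "z \<in> W" "j < n"
  have "((\<lambda>w. g (z(j := w))) has_field_derivative partial_deriv j f z) (at (z j))"
  proof (rule has_field_derivative_transform_within_open[OF hol_fun_has_partial_deriv[OF assms(3) z]])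
    show "open {w. z(j := w) \<in> W}" using open_cspace_slice assms(1) z open_cspace_subset by blast
  qed (use z assms(2) in auto)
  then show "\<exists>D. ((\<lambda>w. g (z(j := w))) has_field_derivative D) (at (z j))" by blast
qed

lemma partial_deriv_cong:
  assumes "open_cspace n W" "z \<in> W" "j < n" "\<And>z. z \<in> W \<Longrightarrow> f z = g z"
  shows "partial_deriv j f z = partial_deriv j g z"
  unfolding partial_deriv_def
proof (rule deriv_cong_ev)
  have "open {w. z(j := w) \<in> W}" "z j \<in> {w. z(j := w) \<in> W}"
    using open_cspace_slice[OF assms(1) _ assms(3)] assms(2) open_cspace_subset[OF assms(1)] by auto
  then show "\<forall>\<^sub>F x in nhds (z j). f (z(j := x)) = g (z(j := x))"
    unfolding eventually_nhds by (intro exI[of _ "{w. z(j := w) \<in> W}"]) (simp add: assms(4))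
qed simp

lemma continuous_on_local_open_cspace:
  fixes f :: "cvec \<Rightarrow> 'b::topological_space"
  assumes "\<And>z. z \<in> W \<Longrightarrow> \<exists>V. open_cspace n V \<and> z \<in> V \<and> continuous_on V f" "open_cspace n W"
  shows "continuous_on W f"
  unfolding continuous_on_eq_continuous_within
proof
  fix z assume z: "z \<in> W"
  then obtain V where V: "open_cspace n V" "z \<in> V" "continuous_on V f" using assms by blast
  then obtain T where T: "open T" "V = cspace n \<inter> T" by (auto simp: openin_open)
  have "continuous (at z within V) f"
    using V by (auto simp: continuous_on_eq_continuous_within)
  moreover have "W \<inter> T \<subseteq> V" using T open_cspace_subset[OF assms(2)] by auto
  ultimately have "continuous (at z within W \<inter> T) f" using continuous_within_subset by blast
  moreover have "at z within W = at z within W \<inter> T"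
    using at_within_nhd[of z T W "W \<inter> T"] T V(2) by auto
  ultimately show "continuous (at z within W) f" by simp
qed

lemma hol_fun_local:
  assumes "\<And>z. z \<in> W \<Longrightarrow> \<exists>V. open_cspace n V \<and> z \<in> V \<and> hol_fun n V f"  "open_cspace n W"
  shows "hol_fun n W f"
proof (rule hol_funI)
  show "continuous_on W f"
  proof (rule continuous_on_local_open_cspace[OF _ assms(2)])
    show "\<exists>V. open_cspace n V \<and> z \<in> V \<and> continuous_on V f" if "z \<in> W" for z
      using assms(1)[OF that] unfolding hol_fun_def by blast
  qed
  fix z j assume z: "z \<in> W" "j < n"
  then obtain V where "open_cspace n V" "z \<in> V" "hol_fun n V f" using assms(1) by blast
  from hol_fun_has_partial_deriv[OF this(3,2) z(2)]
  show "\<exists>D. ((\<lambda>w. f (z(j := w))) has_field_derivative D) (at (z j))" by (rule exI)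
qed

text \<open>Cauchy's estimate turns closeness of \<open>f u\<close> and \<open>f u0\<close> on a
  compact disc into closeness of their derivatives on a smaller disc. The parameter space is an
  arbitrary topological space, so that a point of \<open>cspace n\<close> or a real number can serve
  as parameter.\<close>

lemma continuous_on_deriv_param:
  fixes f :: "'a::topological_space \<Rightarrow> complex \<Rightarrow> complex"
  assumes cont: "continuous_on (U \<times> D) (\<lambda>(u, x). f u x)"
    and hol: "\<And>u. u \<in> U \<Longrightarrow> f u holomorphic_on D" and D: "open D"
  shows "continuous_on (U \<times> D) (\<lambda>(u, x). deriv (f u) x)"
  unfolding continuous_on_def
proof (intro ballI)
  fix p assume "p \<in> U \<times> D"
  then obtain u0 x0 where p: "p = (u0, x0)" "u0 \<in> U" "x0 \<in> D" by auto
  \<comment> \<open>The radius is doubled so that a disc of radius \<open>r\<close> about any point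
    of \<open>ball x0 r\<close> stays inside.\<close>
  obtain r where r: "r > 0" "cball x0 (2*r) \<subseteq> D"
    using open_contains_cball[of D] D p(3) by (metis field_sum_of_halves half_gt_zero mult_2)
  have "continuous_on D (deriv (f u0))"
    using holomorphic_deriv[OF hol[OF p(2)] D] holomorphic_on_imp_continuous_on by blast
  then have dc: "(deriv (f u0) \<longlongrightarrow> deriv (f u0) x0) (at x0 within D)"
    using p(3) by (simp add: continuous_on_def)
  show "((\<lambda>(u, x). deriv (f u) x) \<longlongrightarrow> (case p of (u, x) \<Rightarrow> deriv (f u) x)) (at p within U \<times> D)"
    unfolding p prod.case
  proof (rule tendstoI)
    fix e :: real assume e: "e > 0"
    \<comment> \<open>Compactness makes the closeness uniform over the disc. The bound
      \<open>e * r / 4\<close> leaves room for the strict bound \<open>e * r / 2\<close>, from which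
      Cauchy's estimate with radius \<open>r\<close> gives \<open>e / 2\<close>.\<close>
    obtain X0 where X0: "u0 \<in> X0" "open X0"
      "\<forall>u\<in>X0 \<inter> U. \<forall>t\<in>cball x0 (2*r). dist (f u t) (f u0 t) \<le> e * r / 4"
    proof (rule continuous_on_prod_compactE[of U "cball x0 (2*r)" "\<lambda>(u, x). f u x" u0 "e * r / 4"])
      show "continuous_on (U \<times> cball x0 (2 * r)) (\<lambda>(u, x). f u x)"
        by (rule continuous_on_subset[OF cont]) (use r in auto)
    qed (use p r e in auto)
    have est: "cmod (deriv (f u) x - deriv (f u0) x) \<le> e / 2" if u: "u \<in> X0 \<inter> U" and x: "x \<in> ball x0 r" for u x
    proof -
      have sub: "cball x r \<subseteq> cball x0 (2*r)"
      proof
        fix w assume "w \<in> cball x r"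
        then show "w \<in> cball x0 (2*r)" using x dist_triangle[of x0 w x] by simp
      qed
      then have subD: "cball x r \<subseteq> D" using r by blast
      have h1: "(\<lambda>t. f u t - f u0 t) holomorphic_on D"
        using hol u p by (intro holomorphic_intros) auto
      have "cmod ((deriv ^^ 1) (\<lambda>t. f u t - f u0 t) x) \<le> fact 1 * (e * r / 2) / r ^ 1"
      proof (rule Cauchy_higher_deriv_bound[where y=0])
        show "(\<lambda>t. f u t - f u0 t) holomorphic_on ball x r"
          using h1 subD ball_subset_cball holomorphic_on_subset by blast
        show "continuous_on (cball x r) (\<lambda>t. f u t - f u0 t)"
          using h1 subD holomorphic_on_subset holomorphic_on_imp_continuous_on by blast
        show "f u w - f u0 w \<in> ball 0 (e * r / 2)" if "w \<in> ball x r" for w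
        proof -
          have "w \<in> cball x0 (2*r)" using subsetD[OF sub, of w] that by simp
          then have "dist (f u w) (f u0 w) \<le> e * r / 4" using X0 u by blast
          moreover have "e * r / 4 < e * r / 2" using e r by (simp add: field_simps)
          ultimately show ?thesis by (simp add: dist_norm norm_minus_commute)
        qed
      qed (use r in auto)
      moreover have "deriv (\<lambda>t. f u t - f u0 t) x = deriv (f u) x - deriv (f u0) x"
      proof (rule deriv_diff)
        have "x \<in> D" using subD r by auto
        then show "f u field_differentiable at x" "f u0 field_differentiable at x"
          using hol D u p holomorphic_on_imp_differentiable_at by blast+
      qed
      ultimately show ?thesis using r by simp
    qed
    have ev1: "\<forall>\<^sub>F q in at (u0, x0) within U \<times> D. snd q \<in> ball x0 r \<and> dist (deriv (f u0) (snd q)) (deriv (f u0) x0) < e / 2"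
    proof -
      have "\<forall>\<^sub>F x in at x0 within D. dist (deriv (f u0) x) (deriv (f u0) x0) < e / 2"
        using tendstoD[OF dc, of "e/2"] e by simp
      moreover have "x0 \<in> ball x0 r" using r by simp
      then have "\<forall>\<^sub>F x in at x0 within D. x \<in> ball x0 r"
        unfolding eventually_at_topological by (intro exI[of _ "ball x0 r"]) simp
      ultimately have "\<forall>\<^sub>F x in at x0 within D. x \<in> ball x0 r \<and> dist (deriv (f u0) x) (deriv (f u0) x0) < e / 2"
        by eventually_elim simp
      then obtain T where T: "open T" "x0 \<in> T" "\<forall>x\<in>T. x \<noteq> x0 \<longrightarrow> x \<in> D \<longrightarrow> x \<in> ball x0 r \<and> dist (deriv (f u0) x) (deriv (f u0) x0) < e / 2"
        unfolding eventually_at_topological by blast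
      have "x \<in> ball x0 r \<and> dist (deriv (f u0) x) (deriv (f u0) x0) < e / 2" if "x \<in> T" "x \<in> D" for x
        using T(3) that r e by (cases "x = x0") auto
      then show ?thesis unfolding eventually_at_topological
        using T(1,2) by (intro exI[of _ "UNIV \<times> T"]) (auto simp: open_Times)
    qed
    have ev2: "\<forall>\<^sub>F q in at (u0, x0) within U \<times> D. fst q \<in> X0 \<inter> U"
      unfolding eventually_at_topological
      using X0(1,2) by (intro exI[of _ "X0 \<times> UNIV"]) (auto simp: open_Times)
    show "\<forall>\<^sub>F q in at (u0, x0) within U \<times> D. dist (case q of (u, x) \<Rightarrow> deriv (f u) x) (deriv (f u0) x0) < e"
      using ev1 ev2
    proof eventually_elim
      case (elim q)
      have "cmod (deriv (f (fst q)) (snd q) - deriv (f u0) (snd q)) \<le> e / 2"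
        using est elim by blast
      moreover have "cmod (deriv (f u0) (snd q) - deriv (f u0) x0) < e / 2"
        using elim by (simp add: dist_norm)
      ultimately show ?case
        by (simp add: case_prod_beta dist_norm) norm
    qed
  qed
qed

lemma open_cspace_Collect:
  assumes "open_cspace n W" "continuous_on W f" "open T"
  shows "open_cspace n {z\<in>W. f z \<in> T}"
proof -
  have "openin (top_of_set W) (W \<inter> f -` T)"
    using assms(2,3) by (rule continuous_openin_preimage_gen)
  moreover have "W \<inter> f -` T = {z\<in>W. f z \<in> T}" by auto
  ultimately show ?thesis using assms(1) openin_trans by metis
qed

lemma polydisc_mono: "(\<And>i. i < n \<Longrightarrow> r i \<le> s i) \<Longrightarrow> polydisc n a r \<subseteq> polydisc n a s"
  by (force simp: polydisc_def)

lemma partial_deriv_continuous: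
  assumes f: "hol_fun n W f" and W: "open_cspace n W" and j: "j < n"
  shows "continuous_on W (partial_deriv j f)"
proof (rule continuous_on_local_open_cspace[OF _ W])
  fix a assume a: "a \<in> W"
  obtain e where e: "e > 0" "polydisc n a (\<lambda>_. e) \<subseteq> W" using open_cspace_polydisc[OF W a] by blast
  let ?P = "polydisc n a (\<lambda>_. e)" and ?D = "ball (a j) e"
  have upd: "z(j := w) \<in> ?P" if "z \<in> ?P" "w \<in> ?D" for z w
    using that polydisc_upd[of z n a _ j w] j by (auto simp: dist_norm norm_minus_commute)
  have "continuous_on (?P \<times> ?D) (\<lambda>(u, x). deriv (\<lambda>x. f (u(j := x))) x)"
  proof (rule continuous_on_deriv_param)
    have "continuous_on (?P \<times> ?D) (\<lambda>q. (fst q)(j := snd q))"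
      by (intro continuous_on_fun_upd continuous_on_fst continuous_on_snd continuous_on_id)
    then have "continuous_on (?P \<times> ?D) (\<lambda>q. f ((fst q)(j := snd q)))"
    proof (rule continuous_on_compose2[rotated])
      show "continuous_on W f" using f by (simp add: hol_fun_def)
      show "(\<lambda>q. (fst q)(j := snd q)) ` (?P \<times> ?D) \<subseteq> W" using upd e(2) by auto
    qed
    then show "continuous_on (?P \<times> ?D) (\<lambda>(u, x). f (u(j := x)))" by (simp add: case_prod_beta)
    show "(\<lambda>x. f (u(j := x))) holomorphic_on ?D" if "u \<in> ?P" for u
      using hol_fun_slice[OF f j, of u] by (rule holomorphic_on_subset) (use upd e that in auto)
  qed auto
  \<comment> \<open>On the diagonal \<open>x = z j\<close> the derivative with parameter
    \<open>z\<close> is the partial derivative at \<open>z\<close>, because \<open>z(j := x)\<close>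
    forgets the \<open>j\<close>-th entry of the parameter.\<close>
  then have "continuous_on ?P (\<lambda>z. (\<lambda>(u, x). deriv (\<lambda>x. f (u(j := x))) x) (z, z j))"
  proof (rule continuous_on_compose2)
    show "continuous_on ?P (\<lambda>z. (z, z j))"
      by (intro continuous_on_Pair continuous_on_id continuous_on_coord)
    show "(\<lambda>z. (z, z j)) ` ?P \<subseteq> ?P \<times> ?D"
      using j by (auto simp: polydisc_def dist_norm norm_minus_commute)
  qed
  then have "continuous_on ?P (partial_deriv j f)" by (simp add: partial_deriv_def[abs_def])
  moreover have "a \<in> ?P" using a open_cspace_subset[OF W] e(1) by (auto intro: polydisc_centre)
  ultimately show "\<exists>V. open_cspace n V \<and> a \<in> V \<and> continuous_on V (partial_deriv j f)"
    using polydisc_open_cspace by blast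
qed

text \<open>Coordinates are moved one at a time and the increments telescope. Holomorphy is given
  coordinatewise, so differentiability along a curve has to come from continuity of the partial
  derivatives and the mean value inequality in one variable.\<close>

lemma hol_fun_chain:
  fixes \<gamma> :: "complex \<Rightarrow> cvec"
  assumes f: "hol_fun n W f" and W: "open_cspace n W" and in_W: "\<gamma> t0 \<in> W"
    and \<gamma>: "\<And>i. i < n \<Longrightarrow> ((\<lambda>t. \<gamma> t i) has_field_derivative \<gamma>' i) (at t0)"
    and cs: "\<And>t. \<gamma> t \<in> cspace n"
  shows "((\<lambda>t. f (\<gamma> t)) has_field_derivative (\<Sum>j<n. partial_deriv j f (\<gamma> t0) * \<gamma>' j)) (at t0)"
proof -
  let ?a = "\<gamma> t0"
  \<comment> \<open>The first \<open>m\<close> coordinates follow the curve, the others rest at the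
    base point; \<open>mix 0\<close> is constant and \<open>mix n\<close> is the curve.\<close>
  define mix where "mix m t = (\<lambda>i. if i < m then \<gamma> t i else ?a i)" for m t
  have mix_cs: "mix m t \<in> cspace n" for m t
    using cs by (auto simp: mix_def cspace_def)
  have contg: "isCont (\<lambda>t. \<gamma> t i) t0" if "i < n" for i
    using \<gamma>[OF that] DERIV_isCont by blast
  have ev_partial_deriv: "\<forall>\<^sub>F t in nhds t0. \<forall>i<n. cmod (\<gamma> t i - ?a i) < d" if "d > 0" for d
  proof -
    have "\<forall>\<^sub>F t in nhds t0. \<forall>i\<in>{..<n}. dist (\<gamma> t i) (?a i) < d"
    proof (rule eventually_ball_finite, simp, rule ballI)
      fix i assume "i \<in> {..<n}"
      then have "isCont (\<lambda>t. \<gamma> t i) t0" using contg by simp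
      then have "filterlim (\<lambda>t. \<gamma> t i) (nhds (?a i)) (nhds t0)"
        using tendsto_at_iff_tendsto_nhds[of "\<lambda>t. \<gamma> t i" t0] by (simp add: isCont_def)
      then show "\<forall>\<^sub>F t in nhds t0. dist (\<gamma> t i) (?a i) < d" using that tendstoD by blast
    qed
    then show ?thesis by (simp add: dist_norm lessThan_def)
  qed
  have "((\<lambda>t. f (mix m t)) has_field_derivative (\<Sum>j<m. partial_deriv j f ?a * \<gamma>' j)) (at t0)" if "m \<le> n" for m
    using that
  proof (induction m)
    case 0
    then show ?case by (simp add: mix_def)
  next
    case (Suc m)
    then have m: "m < n" by simp
    have mixSuc: "mix (Suc m) t = (mix m t)(m := \<gamma> t m)" for t
      by (auto simp: mix_def less_Suc_eq)
    have mixm: "mix m t = (mix m t)(m := ?a m)" for t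
      by (auto simp: mix_def)
    let ?Dt = "partial_deriv m f ?a"
    obtain g where g: "\<And>t. \<gamma> t m - ?a m = g t * (t - t0)" "isCont g t0" "g t0 = \<gamma>' m"
      using \<gamma>[OF m] unfolding CARAT_DERIV by blast
    define \<Delta> where "\<Delta> t = f (mix (Suc m) t) - f (mix m t)" for t
    \<comment> \<open>The partial derivative is the default when the increment vanishes: the
      factorisation of \<Delta> stays valid there and \<open>Q\<close> becomes continuous at
      \<open>t0\<close>.\<close>
    define Q where "Q t = (if \<gamma> t m = ?a m then ?Dt else \<Delta> t / (\<gamma> t m - ?a m))" for t
    have \<Delta>Q: "\<Delta> t = Q t * (\<gamma> t m - ?a m)" for t
      using mixSuc[of t] mixm[of t] by (auto simp: Q_def \<Delta>_def)
    have "isCont Q t0"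
      unfolding isCont_def
    proof (rule tendstoI)
      fix e :: real assume e: "e > 0"
      have "continuous_on W (partial_deriv m f)" by (rule partial_deriv_continuous[OF f W m])
      then have "open_cspace n {z\<in>W. partial_deriv m f z \<in> ball ?Dt (e/2)}" using open_cspace_Collect[OF W] by blast
      moreover have "?a \<in> {z\<in>W. partial_deriv m f z \<in> ball ?Dt (e/2)}" using in_W e by simp
      ultimately obtain d where d: "d > 0" "polydisc n ?a (\<lambda>_. d) \<subseteq> {z\<in>W. partial_deriv m f z \<in> ball ?Dt (e/2)}"
        using open_cspace_polydisc by blast
      have "dist (Q t) ?Dt < e" if t: "\<forall>i<n. cmod (\<gamma> t i - ?a i) < d" for t
      proof (cases "\<gamma> t m = ?a m")
        case True
        then show ?thesis using e by (simp add: Q_def)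
      next
        case False
        let ?B = "ball (?a m) d"
        have inP: "(mix m t)(m := x) \<in> polydisc n ?a (\<lambda>_. d)" if "x \<in> ?B" for x
          using that t mix_cs[of m t] m d(1)
          by (auto simp: polydisc_def cspace_upd mix_def dist_norm norm_minus_commute)
        \<comment> \<open>Subtracting the linear part leaves a function whose derivative has norm at
          most \<open>e / 2\<close> on the disc; the mean value inequality then bounds the error of
          the difference quotient.\<close>
        have deriv: "((\<lambda>x. f ((mix m t)(m := x)) - ?Dt * x) has_field_derivative
            (partial_deriv m f ((mix m t)(m := x)) - ?Dt)) (at x within ?B)" if "x \<in> ?B" for x
        proof -
          have "((\<lambda>x. f ((mix m t)(m := x))) has_field_derivative partial_deriv m f ((mix m t)(m := x))) (at x)"
            using hol_fun_has_partial_deriv'[OF f _ m, of "mix m t" x] inP[OF that] d(2) by blast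
          then have "((\<lambda>x. f ((mix m t)(m := x)) - ?Dt * x) has_field_derivative
            (partial_deriv m f ((mix m t)(m := x)) - ?Dt)) (at x)"
            by (auto intro!: derivative_eq_intros)
          then show ?thesis using has_field_derivative_at_within by blast
        qed
        have "cmod ((f ((mix m t)(m := \<gamma> t m)) - ?Dt * \<gamma> t m) - (f ((mix m t)(m := ?a m)) - ?Dt * ?a m))
            \<le> (e/2) * cmod (\<gamma> t m - ?a m)"
        proof (rule field_differentiable_bound[OF _ deriv])
          show "cmod (partial_deriv m f ((mix m t)(m := x)) - ?Dt) \<le> e / 2" if "x \<in> ?B" for x
            using inP[OF that] d(2) by (auto simp: dist_norm norm_minus_commute less_imp_le)
        qed (use t m d(1) in \<open>auto simp: dist_norm norm_minus_commute\<close>)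
        then have "cmod (\<Delta> t - ?Dt * (\<gamma> t m - ?a m)) \<le> (e/2) * cmod (\<gamma> t m - ?a m)"
          unfolding \<Delta>_def mixSuc using mixm[of t] by (simp add: algebra_simps)
        moreover have "\<Delta> t - ?Dt * (\<gamma> t m - ?a m) = (Q t - ?Dt) * (\<gamma> t m - ?a m)"
          unfolding \<Delta>Q by (simp add: algebra_simps)
        ultimately have "cmod (Q t - ?Dt) \<le> e / 2" using False by (simp add: norm_mult)
        then show ?thesis using e by (simp add: dist_norm)
      qed
      then have "\<forall>\<^sub>F t in nhds t0. dist (Q t) ?Dt < e"
        using ev_partial_deriv[OF d(1)] by (auto elim: eventually_mono)
      moreover have "Q t0 = ?Dt" by (simp add: Q_def)
      ultimately show "\<forall>\<^sub>F t in at t0. dist (Q t) (Q t0) < e"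
        by (simp add: eventually_nhds_conv_at)
    qed
    then have "(\<Delta> has_field_derivative ?Dt * \<gamma>' m) (at t0)"
      unfolding CARAT_DERIV
    proof (intro exI conjI allI)
      show "\<Delta> z - \<Delta> t0 = (Q z * g z) * (z - t0)" for z
      proof -
        have "\<Delta> t0 = 0" by (simp add: \<Delta>Q)
        then show ?thesis using \<Delta>Q[of z] g(1)[of z] by simp
      qed
      show "isCont (\<lambda>z. Q z * g z) t0" using \<open>isCont Q t0\<close> g(2) by simp
      show "Q t0 * g t0 = ?Dt * \<gamma>' m" using g(3) by (simp add: Q_def)
    qed
    then have "((\<lambda>t. f (mix m t) + \<Delta> t) has_field_derivative (\<Sum>j<m. partial_deriv j f ?a * \<gamma>' j) + ?Dt * \<gamma>' m) (at t0)"
      using Suc by (intro DERIV_add) auto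
    then show ?case by (simp add: \<Delta>_def)
  qed
  from this[of n] have "((\<lambda>t. f (mix n t)) has_field_derivative (\<Sum>j<n. partial_deriv j f ?a * \<gamma>' j)) (at t0)" by simp
  moreover have "mix n t = \<gamma> t" for t
    using cs[of t] cs[of t0] by (auto simp: mix_def cspace_def)
  ultimately show ?thesis by simp
qed

lemma continuous_on_cvecI:
  fixes F :: "'a::topological_space \<Rightarrow> cvec"
  assumes "\<And>i. i < n \<Longrightarrow> continuous_on V (\<lambda>z. F z i)" "\<And>z. z \<in> V \<Longrightarrow> F z \<in> cspace n"
  shows "continuous_on V F"
proof (rule continuous_on_coordinatewise_then_product)
  fix i show "continuous_on V (\<lambda>z. F z i)"
  proof (cases "i < n")
    case False
    then have "continuous_on V (\<lambda>z. F z i) \<longleftrightarrow> continuous_on V (\<lambda>z. 0::complex)"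
      using assms(2) by (intro continuous_on_cong) (auto simp: cspace_def)
    then show ?thesis by simp
  qed (use assms in auto)
qed

lemma hol_fun_compose_partial_deriv:
  assumes f: "hol_fun n W f" and W: "open_cspace n W" and V: "open_cspace k V"
    and F: "\<And>i. i < n \<Longrightarrow> hol_fun k V (\<lambda>z. F z i)" and im: "\<And>z. z \<in> V \<Longrightarrow> F z \<in> W"
    and z: "z \<in> V" and j: "j < k"
  shows "((\<lambda>w. f (F (z(j := w)))) has_field_derivative
      (\<Sum>i<n. partial_deriv i f (F z) * partial_deriv j (\<lambda>z. F z i) z)) (at (z j))"
proof -
  \<comment> \<open>The default \<open>F z\<close> keeps the curve in \<open>cspace n\<close> for
    every parameter, as the chain rule asks; only its germ at \<open>z j\<close> matters.\<close>
  define \<gamma> where "\<gamma> w = (if z(j := w) \<in> V then F (z(j := w)) else F z)" for w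
  have op: "open {w. z(j := w) \<in> V}" using open_cspace_slice[OF V _ j] z open_cspace_subset[OF V] by auto
  have zj: "z j \<in> {w. z(j := w) \<in> V}" using z by simp
  have "((\<lambda>t. f (\<gamma> t)) has_field_derivative (\<Sum>i<n. partial_deriv i f (\<gamma> (z j)) * partial_deriv j (\<lambda>z. F z i) z)) (at (z j))"
  proof (rule hol_fun_chain[OF f W])
    show "\<gamma> (z j) \<in> W" using z im by (simp add: \<gamma>_def)
    show "\<gamma> t \<in> cspace n" for t using z im open_cspace_subset[OF W] by (auto simp: \<gamma>_def)
    show "((\<lambda>t. \<gamma> t i) has_field_derivative partial_deriv j (\<lambda>z. F z i) z) (at (z j))" if "i < n" for i
      by (rule has_field_derivative_transform_within_open[OF hol_fun_has_partial_deriv[OF F[OF that] z j] op zj])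
        (simp add: \<gamma>_def)
  qed
  then have "((\<lambda>t. f (\<gamma> t)) has_field_derivative (\<Sum>i<n. partial_deriv i f (F z) * partial_deriv j (\<lambda>z. F z i) z)) (at (z j))"
    using z by (simp add: \<gamma>_def)
  then show ?thesis
    by (rule has_field_derivative_transform_within_open[OF _ op zj]) (simp add: \<gamma>_def)
qed

lemma hol_fun_compose:
  assumes f: "hol_fun n W f" and W: "open_cspace n W" and V: "open_cspace k V"
    and F: "\<And>i. i < n \<Longrightarrow> hol_fun k V (\<lambda>z. F z i)" and im: "\<And>z. z \<in> V \<Longrightarrow> F z \<in> W"
  shows "hol_fun k V (\<lambda>z. f (F z))"
proof (rule hol_funI)
  have "continuous_on V F"
    by (rule continuous_on_cvecI[of n]) (use F im open_cspace_subset[OF W] in \<open>auto simp: hol_fun_def\<close>)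
  then show "continuous_on V (\<lambda>z. f (F z))"
    using f im continuous_on_compose2[of W f V F] by (auto simp: hol_fun_def)
  show "\<exists>D. ((\<lambda>w. f (F (z(j := w)))) has_field_derivative D) (at (z j))" if "z \<in> V" "j < k" for z j
    using hol_fun_compose_partial_deriv[OF f W V F im that] by blast
qed

lemma partial_deriv_compose:
  assumes "hol_fun n W f" "open_cspace n W" "open_cspace k V"
    "\<And>i. i < n \<Longrightarrow> hol_fun k V (\<lambda>z. F z i)" "\<And>z. z \<in> V \<Longrightarrow> F z \<in> W" "z \<in> V" "j < k"
  shows "partial_deriv j (\<lambda>z. f (F z)) z = (\<Sum>i<n. partial_deriv i f (F z) * partial_deriv j (\<lambda>z. F z i) z)"
  unfolding partial_deriv_def[of j "\<lambda>z. f (F z)"] using hol_fun_compose_partial_deriv[OF assms] by (rule DERIV_imp_deriv)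

section \<open>Algebraic operations, parameter integrals and derivatives\<close>

lemma hol_fun_const: "hol_fun n W (\<lambda>z. c)"
  by (auto simp: hol_fun_def)

lemma hol_fun_coord: "hol_fun n W (\<lambda>z. z i)"
proof (rule hol_funI)
  show "continuous_on W (\<lambda>z. z i)" by (intro continuous_on_coord continuous_on_id)
  show "\<exists>D. ((\<lambda>w. (z(j := w)) i) has_field_derivative D) (at (z j))" for z :: cvec and j
    by (cases "i = j") (auto intro: derivative_intros)
qed

lemma partial_deriv_add:
  assumes "hol_fun n W f" "hol_fun n W g" "z \<in> W" "j < n"
  shows "partial_deriv j (\<lambda>z. f z + g z) z = partial_deriv j f z + partial_deriv j g z"
  unfolding partial_deriv_def[of _ "\<lambda>z. f z + g z"]
  using hol_fun_has_partial_deriv[OF assms(1,3,4)] hol_fun_has_partial_deriv[OF assms(2,3,4)]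
  by (intro DERIV_imp_deriv) (auto intro!: derivative_eq_intros)

lemma hol_fun_add:
  assumes "hol_fun n W f" "hol_fun n W g"
  shows "hol_fun n W (\<lambda>z. f z + g z)"
  using assms unfolding hol_fun_def
  by (auto intro!: continuous_intros field_differentiable_add)

lemma hol_fun_diff:
  assumes "hol_fun n W f" "hol_fun n W g"
  shows "hol_fun n W (\<lambda>z. f z - g z)"
  using assms unfolding hol_fun_def
  by (auto intro!: continuous_intros field_differentiable_diff)

lemma hol_fun_mult:
  assumes "hol_fun n W f" "hol_fun n W g"
  shows "hol_fun n W (\<lambda>z. f z * g z)"
  using assms unfolding hol_fun_def
  by (auto intro!: continuous_intros field_differentiable_mult)

lemma hol_fun_divide:
  assumes "hol_fun n W f" "hol_fun n W g" "\<And>z. z \<in> W \<Longrightarrow> g z \<noteq> 0"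
  shows "hol_fun n W (\<lambda>z. f z / g z)"
  using assms unfolding hol_fun_def
  by (auto intro!: continuous_intros field_differentiable_divide)

lemma hol_fun_sum:
  assumes "\<And>i. i \<in> A \<Longrightarrow> hol_fun n W (f i)"
  shows "hol_fun n W (\<lambda>z. \<Sum>i\<in>A. f i z)"
  using assms by (induction A rule: infinite_finite_induct) (auto intro: hol_fun_const hol_fun_add)

lemma hol_fun_prod:
  assumes "\<And>i. i \<in> A \<Longrightarrow> hol_fun n W (f i)"
  shows "hol_fun n W (\<lambda>z. \<Prod>i\<in>A. f i z)"
  using assms by (induction A rule: infinite_finite_induct) (auto intro: hol_fun_const hol_fun_mult)

text \<open>Leibniz' rule is applied in each coordinate. The joint continuity of the derivative that
  it asks for is \<open>continuous_on_deriv_param\<close> with the integration variable as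
  parameter.\<close>

lemma hol_fun_integral:
  fixes H :: "cvec \<Rightarrow> real \<Rightarrow> complex"
  assumes W: "open_cspace n W" and hol: "\<And>t. t \<in> {0..1} \<Longrightarrow> hol_fun n W (\<lambda>z. H z t)"
    and cont: "continuous_on (W \<times> {0..1}) (\<lambda>(z, t). H z t)"
  shows "hol_fun n W (\<lambda>z. integral {0..1} (H z))"
proof (rule hol_funI)
  have "continuous_on (W \<times> cbox 0 1) (\<lambda>(z, t). H z t)" using cont by simp
  from integral_continuous_on_param[OF this]
  show "continuous_on W (\<lambda>z. integral {0..1} (H z))" by simp
  fix z j assume z: "z \<in> W" "j < n"
  have zc: "z \<in> cspace n" using z open_cspace_subset[OF W] by auto
  have "open {w. z(j := w) \<in> W}" using open_cspace_slice[OF W zc z(2)] .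
  moreover have "z j \<in> {w. z(j := w) \<in> W}" using z by simp
  ultimately obtain r where r: "r > 0" "ball (z j) r \<subseteq> {w. z(j := w) \<in> W}"
    using open_contains_ball by blast
  let ?U = "ball (z j) r"
  have updU: "z(j := x) \<in> W" if "x \<in> ?U" for x using r that by blast
  have cmap: "continuous_on ({0..1} \<times> ?U) (\<lambda>q. (z(j := snd q), fst q))"
    by (intro continuous_on_Pair continuous_on_fun_upd continuous_on_fst continuous_on_snd continuous_on_id continuous_on_const)
  have "continuous_on ({0..1} \<times> ?U) (\<lambda>q. (\<lambda>(z, t). H z t) (z(j := snd q), fst q))"
    by (rule continuous_on_compose2[OF cont cmap]) (use updU in \<open>auto simp del: mem_ball\<close>)
  then have c1: "continuous_on ({0..1} \<times> ?U) (\<lambda>(t, x). H (z(j := x)) t)" by (simp add: case_prod_beta)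
  have h1: "(\<lambda>x. H (z(j := x)) t) holomorphic_on ?U" if "t \<in> {0..1}" for t
    using hol_fun_slice[OF hol[OF that] z(2), of z] r(2) by (rule holomorphic_on_subset)
  have c2: "continuous_on ({0..1} \<times> ?U) (\<lambda>(t, x). deriv (\<lambda>x. H (z(j := x)) t) x)"
    using continuous_on_deriv_param[OF c1 h1] by simp
  have "(\<lambda>x. integral (cbox 0 1) ((\<lambda>x. H (z(j := x))) x)) holomorphic_on ?U"
  proof (rule leibniz_rule_holomorphic)
    show "((\<lambda>x. H (z(j := x)) t) has_field_derivative deriv (\<lambda>x. H (z(j := x)) t) x) (at x within ?U)"
      if "x \<in> ?U" "t \<in> cbox 0 1" for x t
      using holomorphic_derivI[OF h1[of t] _ that(1)] that(2) by simp
    show "H (z(j := x)) integrable_on cbox 0 1" if "x \<in> ?U" for x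
    proof (rule integrable_continuous)
      have "continuous_on {0..1} (\<lambda>t. (\<lambda>(t, x). H (z(j := x)) t) (t, x))"
        by (rule continuous_on_compose2[OF c1]) (use that in \<open>auto intro!: continuous_intros\<close>)
      then show "continuous_on (cbox 0 1) (H (z(j := x)))" by simp
    qed
    have "continuous_on (?U \<times> {0..1}) (\<lambda>q. (\<lambda>(t, x). deriv (\<lambda>x. H (z(j := x)) t) x) (snd q, fst q))"
      by (rule continuous_on_compose2[OF c2])
        (auto intro!: continuous_on_Pair continuous_on_fst continuous_on_snd continuous_on_id)
    then show "continuous_on (?U \<times> cbox 0 1) (\<lambda>(x, t). deriv (\<lambda>x. H (z(j := x)) t) x)"
      by (simp add: case_prod_beta)
  qed auto
  then have "(\<lambda>x. integral {0..1} (H (z(j := x)))) field_differentiable at (z j)"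
    using r(1) by (auto intro: holomorphic_on_imp_differentiable_at)
  then show "\<exists>D. ((\<lambda>w. integral {0..1} (H (z(j := w)))) has_field_derivative D) (at (z j))"
    by (simp add: field_differentiable_def)
qed

text \<open>Parametrising the circle reduces this to the unit interval. The kernel is controlled
  only on the circle, so it may be singular elsewhere.\<close>

lemma hol_fun_contour_integral:
  fixes K :: "cvec \<Rightarrow> complex \<Rightarrow> complex"
  assumes W: "open_cspace n W" and hol: "\<And>u. u \<in> sphere c r \<Longrightarrow> hol_fun n W (\<lambda>z. K z u)"
    and cont: "continuous_on (W \<times> sphere c r) (\<lambda>(z, u). K z u)" and r: "r > 0"
  shows "hol_fun n W (\<lambda>z. contour_integral (circlepath c r) (K z))"
proof -
  define H where "H z t = K z (circlepath c r t) * (2 * pi * \<i> * r * exp (2 * of_real pi * \<i> * t))" for z t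
  have cp: "circlepath c r t \<in> sphere c r" if "t \<in> {0..1}" for t
    using that path_image_circlepath[of c r] r by (auto simp: path_image_def)
  have "contour_integral (circlepath c r) (K z) = integral {0..1} (H z)" for z
    unfolding contour_integral_integral H_def
    by (rule integral_cong) (simp add: vector_derivative_circlepath mult_ac)
  moreover have "hol_fun n W (\<lambda>z. integral {0..1} (H z))"
  proof (rule hol_fun_integral[OF W])
    show "hol_fun n W (\<lambda>z. H z t)" if "t \<in> {0..1}" for t
      unfolding H_def by (intro hol_fun_mult hol_fun_const hol cp that)
    have c1: "continuous_on (W \<times> {0..1}) (\<lambda>q. (fst q, circlepath c r (snd q)))"
      unfolding circlepath by (intro continuous_intros)
    have "continuous_on (W \<times> {0..1}) (\<lambda>q. (\<lambda>(z, u). K z u) (fst q, circlepath c r (snd q)))"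
      by (rule continuous_on_compose2[OF cont c1]) (use cp in auto)
    then have "continuous_on (W \<times> {0..1}) (\<lambda>q. K (fst q) (circlepath c r (snd q)))" by simp
    then show "continuous_on (W \<times> {0..1}) (\<lambda>(z, t). H z t)"
      unfolding H_def case_prod_beta by (intro continuous_intros)
  qed
  ultimately show ?thesis by simp
qed

text \<open>Cauchy's formula represents the derivative as an integral of
  \<open>f (z(j := u)) / (u - z j)^2\<close> over a fixed circle, and such an integral is
  holomorphic in all coordinates of \<open>z\<close>.\<close>

lemma hol_fun_partial_deriv:
  assumes f: "hol_fun n W f" and W: "open_cspace n W" and j: "j < n"
  shows "hol_fun n W (partial_deriv j f)"
proof (rule hol_fun_local[OF _ W])
  fix a assume a: "a \<in> W"
  obtain e where e: "e > 0" "polydisc n a (\<lambda>_. e) \<subseteq> W" using open_cspace_polydisc[OF W a] by blast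
  \<comment> \<open>Half the radius puts the circle about \<open>a j\<close> inside the domain; the
    strict inequalities of the polydisc keep \<open>z j\<close> off the circle.\<close>
  define r where "r = e / 2"
  have r: "0 < r" "r < e" using e by (auto simp: r_def)
  let ?P = "polydisc n a (\<lambda>_. r)" and ?c = "a j"
  have PP: "open_cspace n ?P" by (rule polydisc_open_cspace)
  have aP: "a \<in> ?P" using a open_cspace_subset[OF W] r by (auto intro: polydisc_centre)
  have upd: "z(j := u) \<in> W" if "z \<in> ?P" "cmod (u - ?c) < e" for z u
  proof -
    have "z \<in> polydisc n a (\<lambda>_. e)" using that r by (force simp: polydisc_def)
    then show ?thesis using polydisc_upd[of z n a _ j u] j that e(2) by auto
  qed
  have sph: "cmod (u - ?c) < e" if "u \<in> sphere ?c r" for u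
    using that r by (simp add: dist_norm norm_minus_commute)
  have ne: "u - z j \<noteq> 0" if "z \<in> ?P" "u \<in> sphere ?c r" for z u
    using that j by (auto simp: polydisc_def dist_norm norm_minus_commute)
  have hol: "hol_fun n ?P (\<lambda>z. f (z(j := u)))" if u: "u \<in> sphere ?c r" for u
  proof (rule hol_fun_compose[OF f W PP])
    show "hol_fun n ?P (\<lambda>z. (z(j := u)) i)" for i
      by (cases "i = j") (auto intro: hol_fun_const hol_fun_coord)
  qed (use upd sph[OF u] in auto)
  define K where "K z u = f (z(j := u)) / (u - z j)^2" for z u
  have "hol_fun n ?P (\<lambda>z. contour_integral (circlepath ?c r) (K z))"
  proof (rule hol_fun_contour_integral[OF PP])
    show "hol_fun n ?P (\<lambda>z. K z u)" if "u \<in> sphere ?c r" for u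
      unfolding K_def power2_eq_square
      using ne that by (intro hol_fun_divide hol_fun_mult hol_fun_diff hol_fun_const hol_fun_coord hol) auto
    have c1: "continuous_on (?P \<times> sphere ?c r) (\<lambda>q. (fst q)(j := snd q))"
      by (intro continuous_on_fun_upd continuous_on_fst continuous_on_snd continuous_on_id)
    have "continuous_on W f" using f by (simp add: hol_fun_def)
    from continuous_on_compose2[OF this c1]
    have "continuous_on (?P \<times> sphere ?c r) (\<lambda>q. f ((fst q)(j := snd q)))" using upd sph by fastforce
    moreover have "continuous_on (?P \<times> sphere ?c r) (\<lambda>q. snd q - fst q j)"
      by (intro continuous_intros continuous_on_coord)
    ultimately show "continuous_on (?P \<times> sphere ?c r) (\<lambda>(z, u). K z u)"
      unfolding K_def case_prod_beta using ne by (intro continuous_on_divide continuous_on_power) auto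
  qed (use r in auto)
  then have hG: "hol_fun n ?P (\<lambda>z. 1 / (2 * of_real pi * \<i>) * contour_integral (circlepath ?c r) (K z))"
    by (intro hol_fun_mult hol_fun_const)
  have eq: "1 / (2 * of_real pi * \<i>) * contour_integral (circlepath ?c r) (K z) = partial_deriv j f z"
    if z: "z \<in> ?P" for z
  proof -
    have h: "(\<lambda>w. f (z(j := w))) holomorphic_on ball ?c e"
      by (rule holomorphic_on_subset[OF hol_fun_slice[OF f j]])
        (use upd[OF z] in \<open>auto simp: dist_norm norm_minus_commute\<close>)
    have "z j \<in> ball ?c r" using z j by (auto simp: polydisc_def dist_norm norm_minus_commute)
    moreover have "continuous_on (cball ?c r) (\<lambda>w. f (z(j := w)))"
      using h r by (intro holomorphic_on_imp_continuous_on holomorphic_on_subset[OF h]) auto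
    moreover have "(\<lambda>w. f (z(j := w))) holomorphic_on ball ?c r"
      using r by (intro holomorphic_on_subset[OF h]) auto
    ultimately have "(K z has_contour_integral (2 * of_real pi * \<i> * deriv (\<lambda>w. f (z(j := w))) (z j))) (circlepath ?c r)"
      using Cauchy_has_contour_integral_higher_derivative_circlepath[of ?c r "\<lambda>w. f (z(j := w))" "z j" 1]
      unfolding K_def by (simp add: power2_eq_square)
    then show ?thesis by (simp add: contour_integral_unique partial_deriv_def)
  qed
  have "hol_fun n ?P (partial_deriv j f)" by (rule hol_fun_cong[OF PP eq hG])
  with PP aP show "\<exists>V. open_cspace n V \<and> a \<in> V \<and> hol_fun n V (partial_deriv j f)" by (intro exI[of _ ?P] conjI)
qed

text \<open>Weierstrass' theorem on each slice, together with continuity of uniform limits.\<close>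

lemma hol_fun_uniform_limit:
  assumes W: "open_cspace n W" and f: "\<And>k. hol_fun n W (f k)" and ul: "uniform_limit W f g sequentially"
  shows "hol_fun n W g"
proof (rule hol_funI)
  show "continuous_on W g"
    by (rule uniform_limit_theorem[OF _ ul]) (use f in \<open>auto simp: hol_fun_def\<close>)
  fix z j assume z: "z \<in> W" "j < n"
  let ?S = "{w. z(j := w) \<in> W}"
  have S: "open ?S" using open_cspace_slice[OF W _ z(2)] z(1) open_cspace_subset[OF W] by auto
  have "(\<lambda>w. g (z(j := w))) holomorphic_on ?S"
  proof (rule holomorphic_uniform_sequence[OF S])
    show "(\<lambda>w. f k (z(j := w))) holomorphic_on ?S" for k by (rule hol_fun_slice[OF f z(2)])
    fix x assume "x \<in> ?S"
    then obtain d where d: "d > 0" "cball x d \<subseteq> ?S" using S open_contains_cball by blast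
    have "uniform_limit (cball x d) (\<lambda>k w. f k (z(j := w))) (\<lambda>w. g (z(j := w))) sequentially"
      using ul d(2) by (force simp: uniform_limit_iff elim!: eventually_mono)
    then show "\<exists>d>0. cball x d \<subseteq> ?S \<and> uniform_limit (cball x d) (\<lambda>k w. f k (z(j := w))) (\<lambda>w. g (z(j := w))) sequentially"
      using d by blast
  qed
  then have "(\<lambda>w. g (z(j := w))) field_differentiable at (z j)"
    using S z by (auto intro: holomorphic_on_imp_differentiable_at)
  then show "\<exists>D. ((\<lambda>w. g (z(j := w))) has_field_derivative D) (at (z j))"
    by (simp add: field_differentiable_def)
qed

section \<open>Restriction to complex lines and the identity theorem\<close>

definition line_point :: "cvec \<Rightarrow> cvec \<Rightarrow> complex \<Rightarrow> cvec" where
  "line_point a v s = (\<lambda>i. a i + s * v i)"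

lemma line_point_cspace: "a \<in> cspace n \<Longrightarrow> v \<in> cspace n \<Longrightarrow> line_point a v s \<in> cspace n"
  by (simp add: line_point_def cspace_def)

lemma continuous_on_line_point: "continuous_on S (line_point a v)"
  unfolding line_point_def by (intro continuous_on_coordinatewise_then_product continuous_intros)

lemma hol_fun_line:
  assumes f: "hol_fun n W f" and W: "open_cspace n W" and av: "a \<in> cspace n" "v \<in> cspace n" and s: "line_point a v s \<in> W"
  shows "((\<lambda>s. f (line_point a v s)) has_field_derivative (\<Sum>j<n. partial_deriv j f (line_point a v s) * v j)) (at s)"
proof (rule hol_fun_chain[OF f W, of "line_point a v" s])
  show "line_point a v s \<in> W" by (rule s)
  show "((\<lambda>t. line_point a v t i) has_field_derivative v i) (at s)" for i
    unfolding line_point_def by (auto intro!: derivative_eq_intros)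
qed (use av line_point_cspace in auto)

text \<open>Each coordinate of the line is affine in \<open>s\<close>, so the set is an intersection
  of preimages of discs. Convexity supplies the connectedness for analytic continuation along the
  line.\<close>

lemma convex_line_polydisc:
  assumes "a \<in> polydisc n c r" "b \<in> polydisc n c r"
  shows "convex {s. line_point a (\<lambda>i. b i - a i) s \<in> polydisc n c r}" (is "convex ?S")
proof -
  have "?S = (\<Inter>i\<in>{..<n}. {s. a i + s * (b i - a i) \<in> ball (c i) (r i)})"
    using assms by (auto simp: polydisc_def line_point_def cspace_def dist_norm norm_minus_commute)
  moreover have "convex {s. a i + s * (b i - a i) \<in> ball (c i) (r i)}" for i
  proof -
    have eq: "{s. a i + s * (b i - a i) \<in> ball (c i) (r i)} = (\<lambda>s. s * (b i - a i)) -` (ball (c i - a i) (r i))"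
      by (auto simp: dist_norm algebra_simps)
    show ?thesis unfolding eq
      by (rule convex_linear_vimage) (auto simp: bounded_linear.linear bounded_linear_mult_left)
  qed
  ultimately show ?thesis by (metis (no_types, lifting) convex_INT)
qed

lemma open_line_polydisc:
  assumes "a \<in> cspace n" "v \<in> cspace n" "open_cspace n W"
  shows "open {s. line_point a v s \<in> W}"
  using open_cspace_vimage[OF assms(3), of UNIV "line_point a v"] continuous_on_line_point line_point_cspace[OF assms(1,2)] by auto

lemma hol_fun_line_holomorphic:
  assumes f: "hol_fun n W f" and W: "open_cspace n W" and av: "a \<in> cspace n" "v \<in> cspace n"
  shows "(\<lambda>s. f (line_point a v s)) holomorphic_on {s. line_point a v s \<in> W}"
proof -
  have "(\<lambda>s. f (line_point a v s)) field_differentiable at s" if "line_point a v s \<in> W" for s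
    using hol_fun_line[OF f W av that] by (auto simp: field_differentiable_def)
  then show ?thesis by (simp add: holomorphic_on_def field_differentiable_at_within)
qed

lemma line_point_0 [simp]: "line_point a v 0 = a" by (simp add: line_point_def)
lemma line_point_1 [simp]: "line_point a (\<lambda>i. b i - a i) 1 = b" by (simp add: line_point_def)

text \<open>The complex line from a point of \<open>O'\<close> to \<open>b\<close> meets the
  polydisc in a connected set, so the identity theorem in one variable applies on that line.\<close>

lemma hol_fun_identity:
  assumes f: "hol_fun n (polydisc n c r) f" and O: "open_cspace n O'" "O' \<noteq> {}" "O' \<subseteq> polydisc n c r"
    and zero: "\<And>z. z \<in> O' \<Longrightarrow> f z = 0" and b: "b \<in> polydisc n c r"
  shows "f b = 0"
proof -
  let ?P = "polydisc n c r"
  obtain a where a: "a \<in> O'" using O by auto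
  have cs: "a \<in> cspace n" "b \<in> cspace n" using a b O by (auto simp: polydisc_def)
  let ?v = "\<lambda>i. b i - a i"
  have v: "?v \<in> cspace n" using cs by (auto simp: cspace_def)
  have aP: "a \<in> ?P" using a O by auto
  have "f (line_point a ?v 1) = 0"
  proof (rule analytic_continuation_open[where f="\<lambda>s. f (line_point a ?v s)" and z=1 and g="\<lambda>_. 0" and s="{s. line_point a ?v s \<in> O'}" and s'="{s. line_point a ?v s \<in> ?P}"])
    show "open {s. line_point a ?v s \<in> O'}" "open {s. line_point a ?v s \<in> ?P}"
      using open_line_polydisc[OF cs(1) v] O(1) polydisc_open_cspace by blast+
    show "connected {s. line_point a ?v s \<in> ?P}" using convex_line_polydisc[OF aP b] by (rule convex_connected)
    show "(\<lambda>s. f (line_point a ?v s)) holomorphic_on {s. line_point a ?v s \<in> ?P}"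
      by (rule hol_fun_line_holomorphic[OF f polydisc_open_cspace cs(1) v])
    have "0 \<in> {s. line_point a ?v s \<in> O'}" using a by simp
    then show "{s. line_point a ?v s \<in> O'} \<noteq> {}" by blast
  qed (use O b zero in auto)
  then show ?thesis by simp
qed

text \<open>Derivatives along a line are combinations of partial derivatives, so a family closed
  under these has only zero Taylor coefficients at \<open>a\<close> along the line. The closed
  family replaces an induction over multi-indices; the contrapositive later yields a partial
  derivative that does not vanish on the bad set.\<close>

lemma hol_fun_derivs_zero:
  assumes hol: "\<And>f. f \<in> \<V> \<Longrightarrow> hol_fun n (polydisc n c r) f"
    and cl: "\<And>f j. f \<in> \<V> \<Longrightarrow> j < n \<Longrightarrow> partial_deriv j f \<in> \<V>"
    and zero: "\<And>f. f \<in> \<V> \<Longrightarrow> f a = 0" and a: "a \<in> polydisc n c r" and b: "b \<in> polydisc n c r"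
    and f: "f \<in> \<V>"
  shows "f b = 0"
proof -
  let ?P = "polydisc n c r" and ?v = "\<lambda>i. b i - a i"
  have cs: "a \<in> cspace n" "b \<in> cspace n" using a b by (auto simp: polydisc_def)
  have v: "?v \<in> cspace n" using cs by (auto simp: cspace_def)
  let ?S = "{s. line_point a ?v s \<in> ?P}"
  have S: "open ?S" using open_line_polydisc[OF cs(1) v polydisc_open_cspace] .
  have S0: "0 \<in> ?S" "1 \<in> ?S" using a b by auto
  have holl: "(\<lambda>s. g (line_point a ?v s)) holomorphic_on ?S" if "g \<in> \<V>" for g
    by (rule hol_fun_line_holomorphic[OF hol[OF that] polydisc_open_cspace cs(1) v])
  \<comment> \<open>All members are treated at once, since one differentiation replaces
    \<open>g\<close> by its partial derivatives.\<close>
  have "(deriv ^^ k) (\<lambda>s. g (line_point a ?v s)) 0 = 0" if "g \<in> \<V>" for g k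
    using that
  proof (induction k arbitrary: g)
    case 0
    then show ?case using zero by simp
  next
    case (Suc k)
    have "(deriv ^^ Suc k) (\<lambda>s. g (line_point a ?v s)) 0 = (deriv ^^ k) (deriv (\<lambda>s. g (line_point a ?v s))) 0"
      by (simp add: funpow_Suc_right del: funpow.simps)
    also have "\<dots> = (deriv ^^ k) (\<lambda>s. \<Sum>j<n. ?v j * partial_deriv j g (line_point a ?v s)) 0"
    proof (rule higher_deriv_transform_within_open[OF _ _ S S0(1)])
      show "deriv (\<lambda>s. g (line_point a ?v s)) holomorphic_on ?S"
        using holl[OF Suc.prems] S by (rule holomorphic_deriv)
      show "(\<lambda>s. \<Sum>j<n. ?v j * partial_deriv j g (line_point a ?v s)) holomorphic_on ?S"
        using cl[OF Suc.prems] by (intro holomorphic_intros holl) auto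
      show "deriv (\<lambda>s. g (line_point a ?v s)) x = (\<Sum>j<n. ?v j * partial_deriv j g (line_point a ?v x))" if "x \<in> ?S" for x
        using hol_fun_line[OF hol[OF Suc.prems] polydisc_open_cspace cs(1) v, of x] that
        by (simp add: DERIV_imp_deriv mult.commute)
    qed
    also have "\<dots> = (\<Sum>j<n. ?v j * (deriv ^^ k) (\<lambda>s. partial_deriv j g (line_point a ?v s)) 0)"
    proof -
      have "(deriv ^^ k) (\<lambda>s. \<Sum>j\<in>A. ?v j * partial_deriv j g (line_point a ?v s)) 0
         = (\<Sum>j\<in>A. ?v j * (deriv ^^ k) (\<lambda>s. partial_deriv j g (line_point a ?v s)) 0)" if "finite A" "A \<subseteq> {..<n}" for A
        using that
      proof (induction A rule: finite_induct)
        case empty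
        then show ?case by (simp add: higher_deriv_const)
      next
        case (insert x F)
        have h1: "(\<lambda>s. partial_deriv j g (line_point a ?v s)) holomorphic_on ?S" if "j < n" for j
          using holl cl Suc.prems that by blast
        have h2: "(\<lambda>s. \<Sum>j\<in>F. ?v j * partial_deriv j g (line_point a ?v s)) holomorphic_on ?S"
          using insert.prems by (intro holomorphic_intros h1) auto
        have h3: "(\<lambda>s. ?v x * partial_deriv x g (line_point a ?v s)) holomorphic_on ?S"
          using insert.prems by (intro holomorphic_intros h1) auto
        have "(deriv ^^ k) (\<lambda>s. \<Sum>j\<in>insert x F. ?v j * partial_deriv j g (line_point a ?v s)) 0
          = (deriv ^^ k) (\<lambda>s. ?v x * partial_deriv x g (line_point a ?v s) + (\<Sum>j\<in>F. ?v j * partial_deriv j g (line_point a ?v s))) 0"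
          using insert.hyps by simp
        also have "\<dots> = (deriv ^^ k) (\<lambda>s. ?v x * partial_deriv x g (line_point a ?v s)) 0 + (deriv ^^ k) (\<lambda>s. \<Sum>j\<in>F. ?v j * partial_deriv j g (line_point a ?v s)) 0"
          by (rule higher_deriv_add[OF h3 h2 S S0(1)])
        also have "(deriv ^^ k) (\<lambda>s. ?v x * partial_deriv x g (line_point a ?v s)) 0 = ?v x * (deriv ^^ k) (\<lambda>s. partial_deriv x g (line_point a ?v s)) 0"
          using insert.prems by (intro higher_deriv_cmult[OF h1 S0(1) S]) auto
        finally show ?case using insert by simp
      qed
      then show ?thesis by blast
    qed
    also have "\<dots> = 0" using Suc.IH cl[OF Suc.prems] by simp
    finally show ?case .
  qed
  then have "f (line_point a ?v 1) = 0"
    using holomorphic_fun_eq_0_on_connected[OF holl[OF f] S _ _ S0(1,2)] f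
      convex_connected[OF convex_line_polydisc[OF a b]] by blast
  then show ?thesis by simp
qed

section \<open>Implicit functions, division by a coordinate, extension across a graph\<close>

lemma hol_fun_upd_coord:
  assumes "hol_fun n W f"
  shows "hol_fun n W (\<lambda>z. (z(j := f z)) i)"
  using assms by (cases "i = j") (auto intro: hol_fun_coord)

lemma hol_fun_compose_upd:
  assumes "hol_fun n W f" "open_cspace n W" "open_cspace n V" "hol_fun n V g" "\<And>z. z \<in> V \<Longrightarrow> z(j := g z) \<in> W"
  shows "hol_fun n V (\<lambda>z. f (z(j := g z)))"
  using hol_fun_compose[OF assms(1-3), of "\<lambda>z. z(j := g z)"] hol_fun_upd_coord[OF assms(4)] assms(5) by blast

lemma hol_fun_continuous_upd:
  "hol_fun n V g \<Longrightarrow> continuous_on V (\<lambda>z. z(j := g z))"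
  unfolding hol_fun_def by (intro continuous_on_fun_upd continuous_on_id) auto

text \<open>Newton's iteration with the slope frozen at \<open>b\<close> contracts in the
  \<open>j\<close>-th coordinate. Its iterates are holomorphic in \<open>z\<close> and converge
  uniformly, which makes the solution holomorphic. The bound by a quarter of the radius leaves an
  annulus without zeros for a later Cauchy integral.\<close>

lemma implicit_function:
  assumes g: "hol_fun n W g" and W: "open_cspace n W" and b: "b \<in> W" and j: "j < n"
    and g0: "g b = 0" and gd: "partial_deriv j g b \<noteq> 0"
  obtains r \<phi> where "\<And>i. r i > 0" "polydisc n b r \<subseteq> W" "hol_fun n (polydisc n b r) \<phi>"
    "\<And>z x. \<phi> (z(j := x)) = \<phi> z" "\<And>z. z \<in> polydisc n b r \<Longrightarrow> cmod (\<phi> z - b j) \<le> r j / 4"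
    "\<And>z. z \<in> polydisc n b r \<Longrightarrow> g z = 0 \<longleftrightarrow> z j = \<phi> z"
proof -
  let ?A = "partial_deriv j g b"
  \<comment> \<open>On this set the Newton map has derivative of norm at most 1/2.\<close>
  have "open_cspace n {z\<in>W. partial_deriv j g z / ?A \<in> ball 1 (1/2)}"
    using gd by (intro open_cspace_Collect[OF W] continuous_on_divide partial_deriv_continuous[OF g W j]) auto
  moreover have "b \<in> {z\<in>W. partial_deriv j g z / ?A \<in> ball 1 (1/2)}" using b gd by simp
  ultimately obtain \<epsilon> where \<epsilon>: "\<epsilon> > 0" "polydisc n b (\<lambda>_. \<epsilon>) \<subseteq> {z\<in>W. partial_deriv j g z / ?A \<in> ball 1 (1/2)}"
    using open_cspace_polydisc by blast
  have gc: "continuous_on W g" using g by (simp add: hol_fun_def)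
  \<comment> \<open>The disc of radius \<epsilon>/8 is to be invariant: the contraction contributes
    half of \<epsilon>/8, and the initial error \<epsilon>/16 the other half.\<close>
  have "open_cspace n {z\<in>W. g z / ?A \<in> ball 0 (\<epsilon>/16)}"
    using gd by (intro open_cspace_Collect[OF W] continuous_on_divide gc) auto
  moreover have "b \<in> {z\<in>W. g z / ?A \<in> ball 0 (\<epsilon>/16)}" using b g0 \<epsilon> by simp
  ultimately obtain d where d: "d > 0" "polydisc n b (\<lambda>_. d) \<subseteq> {z\<in>W. g z / ?A \<in> ball 0 (\<epsilon>/16)}"
    using open_cspace_polydisc by blast
  define \<delta> where "\<delta> = min d \<epsilon>"
  have \<delta>: "0 < \<delta>" "\<delta> \<le> d" "\<delta> \<le> \<epsilon>" using d \<epsilon> by (auto simp: \<delta>_def)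
  \<comment> \<open>Long in direction \<open>j\<close>, in which the iteration moves; short
    transversally, where \<open>g\<close> must remain small at height \<open>b j\<close>.\<close>
  define r where "r = (\<lambda>i. if i = j then \<epsilon> else \<delta>)"
  let ?Q = "polydisc n b r"
  have rpos: "r i > 0" for i using \<epsilon> \<delta> by (simp add: r_def)
  have rj: "r j = \<epsilon>" by (simp add: r_def)
  have Qsub: "?Q \<subseteq> polydisc n b (\<lambda>_. \<epsilon>)" by (rule polydisc_mono) (use \<delta> in \<open>auto simp: r_def\<close>)
  then have QW: "?Q \<subseteq> W" using \<epsilon> by blast
  have Qopn: "open_cspace n ?Q" by (rule polydisc_open_cspace)
  define T where "T z x = x - g (z(j := x)) / ?A" for z x
  have updQ: "z(j := x) \<in> ?Q" if "z \<in> ?Q" "x \<in> ball (b j) \<epsilon>" for z x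
    using polydisc_upd[OF that(1) j, of x] that(2) rj by (simp add: dist_norm norm_minus_commute)
  have contr: "cmod (T z x - T z y) \<le> 1/2 * cmod (x - y)"
    if z: "z \<in> ?Q" and xy: "x \<in> ball (b j) \<epsilon>" "y \<in> ball (b j) \<epsilon>" for z x y
  proof (rule field_differentiable_bound[OF convex_ball _ _ xy])
    fix w assume w: "w \<in> ball (b j) \<epsilon>"
    have wQ: "z(j := w) \<in> ?Q" using updQ z w by blast
    have "((\<lambda>x. g (z(j := x))) has_field_derivative partial_deriv j g (z(j := w))) (at w)"
      using hol_fun_has_partial_deriv'[OF g _ j] wQ QW by blast
    then have "(T z has_field_derivative (1 - partial_deriv j g (z(j := w)) / ?A)) (at w)"
      unfolding T_def using gd by (auto intro!: derivative_eq_intros)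
    then show "(T z has_field_derivative (1 - partial_deriv j g (z(j := w)) / ?A)) (at w within ball (b j) \<epsilon>)"
      using has_field_derivative_at_within by blast
    have "partial_deriv j g (z(j := w)) / ?A \<in> ball 1 (1/2)" using wQ Qsub \<epsilon>(2) by blast
    then show "cmod (1 - partial_deriv j g (z(j := w)) / ?A) \<le> 1/2" by (simp add: dist_norm)
  qed
  have Tb: "cmod (T z (b j) - b j) \<le> \<epsilon> / 16" if "z \<in> ?Q" for z
  proof -
    have "z(j := b j) \<in> polydisc n b (\<lambda>_. d)"
      using that \<delta> d(1) j by (auto simp: polydisc_def r_def cspace_upd intro: less_le_trans)
    then have "g (z(j := b j)) / ?A \<in> ball 0 (\<epsilon>/16)" using d(2) by blast
    then show ?thesis by (simp add: T_def less_imp_le)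
  qed
  let ?B = "cball (b j) (\<epsilon>/8)"
  have BB: "?B \<subseteq> ball (b j) \<epsilon>" using \<epsilon> by auto
  have bB: "b j \<in> ball (b j) \<epsilon>" using \<epsilon> by simp
  have TB: "T z x \<in> ?B" if "z \<in> ?Q" "x \<in> ?B" for z x
  proof -
    have "cmod (T z x - T z (b j)) \<le> 1/2 * cmod (x - b j)" using contr that BB bB by blast
    moreover have "cmod (x - b j) \<le> \<epsilon>/8" using that by (simp add: dist_norm norm_minus_commute)
    ultimately have "cmod (T z x - b j) \<le> \<epsilon>/16 + \<epsilon>/16"
      using Tb[OF that(1)] norm_triangle_ineq[of "T z x - T z (b j)" "T z (b j) - b j"] by simp
    then show ?thesis by (simp add: dist_norm norm_minus_commute)
  qed
  have fixT: "T z x = x \<longleftrightarrow> g (z(j := x)) = 0" for z x using gd by (simp add: T_def)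
  \<comment> \<open>The choice sees \<open>z\<close> only through \<open>z(j := x)\<close>, so it is
    independent of \<open>z j\<close> by construction, even outside the polydisc.\<close>
  define \<phi> where "\<phi> z = (SOME x. x \<in> ?B \<and> g (z(j := x)) = 0)" for z
  have phi: "\<phi> z \<in> ?B \<and> g (z(j := \<phi> z)) = 0" if z: "z \<in> ?Q" for z
  proof -
    have "\<exists>!x\<in>?B. T z x = x"
    proof (rule Banach_fix[where c="1/2"])
      show "complete ?B" by (rule compact_imp_complete) simp
      show "?B \<noteq> {}" using \<epsilon> by simp
      show "T z ` ?B \<subseteq> ?B" using TB[OF z] by blast
      show "dist (T z x) (T z y) \<le> 1/2 * dist x y" if "x \<in> ?B" "y \<in> ?B" for x y
        using contr[OF z subsetD[OF BB that(1)] subsetD[OF BB that(2)]] by (simp add: dist_norm)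
    qed auto
    then have "\<exists>x. x \<in> ?B \<and> g (z(j := x)) = 0" unfolding fixT by blast
    then show ?thesis unfolding \<phi>_def by (rule someI_ex)
  qed
  have indep: "\<phi> (z(j := x)) = \<phi> z" for z x by (simp add: \<phi>_def)
  have phiT: "T z (\<phi> z) = \<phi> z" if "z \<in> ?Q" for z using phi[OF that] fixT by blast
  define it where "it k z = ((T z) ^^ k) (b j)" for k z
  have itB: "it k z \<in> ?B" if "z \<in> ?Q" for k z
  proof (induction k)
    case 0
    then show ?case using \<epsilon> by (simp add: it_def)
  next
    case (Suc k)
    have "it (Suc k) z = T z (it k z)" by (simp add: it_def)
    then show ?case using TB[OF that Suc] by simp
  qed
  have ithol: "hol_fun n ?Q (it k)" for k
  proof (induction k)
    case 0
    then show ?case by (simp add: it_def hol_fun_const)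
  next
    case (Suc k)
    have eq: "it (Suc k) = (\<lambda>z. it k z - g (z(j := it k z)) / ?A)" by (simp add: it_def T_def fun_eq_iff)
    have "z(j := it k z) \<in> ?Q" if "z \<in> ?Q" for z using updQ[OF that] itB[OF that] BB by blast
    then show ?case unfolding eq using gd QW
      by (intro hol_fun_diff hol_fun_divide hol_fun_const Suc hol_fun_compose_upd[OF g W Qopn]) auto
  qed
  have itlim: "cmod (it k z - \<phi> z) \<le> \<epsilon> * (1/2)^k" if z: "z \<in> ?Q" for k z
  proof (induction k)
    case 0
    have "cmod (b j - \<phi> z) \<le> \<epsilon>/8" using phi[OF z] by (simp add: dist_norm)
    then show ?case using \<epsilon> by (simp add: it_def)
  next
    case (Suc k)
    have "cmod (T z (it k z) - T z (\<phi> z)) \<le> 1/2 * cmod (it k z - \<phi> z)"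
      using contr[OF z] itB[OF z] phi[OF z] BB by blast
    then have "cmod (it (Suc k) z - \<phi> z) \<le> 1/2 * cmod (it k z - \<phi> z)"
      using phiT[OF z] by (simp add: it_def)
    then show ?case using Suc by simp
  qed
  have "uniform_limit ?Q it \<phi> sequentially"
    unfolding uniform_limit_iff
  proof (intro allI impI)
    fix e :: real assume e: "e > 0"
    have "(\<lambda>k. \<epsilon> * (1/2)^k) \<longlonglongrightarrow> \<epsilon> * 0"
      by (intro tendsto_mult tendsto_const LIMSEQ_realpow_zero) auto
    then have "\<forall>\<^sub>F k in sequentially. \<epsilon> * (1/2)^k < e" using e by (auto dest: order_tendstoD)
    then show "\<forall>\<^sub>F k in sequentially. \<forall>z\<in>?Q. dist (it k z) (\<phi> z) < e"
      by eventually_elim (use itlim in \<open>auto simp: dist_norm intro: le_less_trans\<close>)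
  qed
  then have hphi: "hol_fun n ?Q \<phi>" by (rule hol_fun_uniform_limit[OF Qopn ithol])
  show ?thesis
  proof (rule that[OF rpos QW hphi indep])
    fix z assume z: "z \<in> ?Q"
    show "cmod (\<phi> z - b j) \<le> r j / 4"
      using phi[OF z] \<epsilon> by (simp add: rj dist_norm norm_minus_commute)
    show "g z = 0 \<longleftrightarrow> z j = \<phi> z"
    proof
      \<comment> \<open>The contraction estimate holds on the whole disc of radius \<epsilon>, so
        uniqueness of the zero reaches beyond the invariant disc in which it was found.\<close>
      assume "g z = 0"
      then have "T z (z j) = z j" using fixT[of z "z j"] by simp
      moreover have "z j \<in> ball (b j) \<epsilon>"
        using z j rj by (auto simp: polydisc_def dist_norm norm_minus_commute)
      then have "cmod (T z (z j) - T z (\<phi> z)) \<le> 1/2 * cmod (z j - \<phi> z)"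
        using contr[OF z] phi[OF z] BB by blast
      ultimately show "z j = \<phi> z" using phiT[OF z] by simp
    next
      assume "z j = \<phi> z"
      then show "g z = 0" using phi[OF z] by (metis fun_upd_triv)
    qed
  qed
qed

text \<open>Integrating the \<open>j\<close>-th partial derivative along the segment from
  \<open>z(j := 0)\<close> to \<open>z\<close> recovers \<open>u z\<close>, and the chain rule
  contributes the factor \<open>z j\<close>. The integral is holomorphic across the hyperplane as
  well.\<close>

lemma hadamard_division:
  assumes u: "hol_fun n (polydisc n c r) u" and j: "j < n" and c: "c j = 0"
    and zero: "\<And>z. z \<in> polydisc n c r \<Longrightarrow> u (z(j := 0)) = 0"
  obtains q where "hol_fun n (polydisc n c r) q" "\<And>z. z \<in> polydisc n c r \<Longrightarrow> u z = z j * q z"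
proof -
  let ?P = "polydisc n c r"
  have P: "open_cspace n ?P" by (rule polydisc_open_cspace)
  have upd: "z(j := of_real t * z j) \<in> ?P" if "z \<in> ?P" "t \<in> {0..1}" for z t
  proof (rule polydisc_upd[OF that(1) j])
    have "cmod (of_real t * z j) \<le> cmod (z j)"
      using that(2) by (simp add: norm_mult mult_left_le_one_le)
    then show "cmod (of_real t * z j - c j) < r j" using that(1) j c by (auto simp: polydisc_def)
  qed
  let ?D = "partial_deriv j u"
  have D: "hol_fun n ?P ?D" by (rule hol_fun_partial_deriv[OF u P j])
  define q where "q z = integral {0..1} (\<lambda>t. ?D (z(j := of_real t * z j)))" for z
  have c1: "continuous_on (?P \<times> {0..1}) (\<lambda>q. (fst q)(j := of_real (snd q) * (fst q) j))"
    by (intro continuous_on_fun_upd continuous_on_fst continuous_on_id continuous_on_mult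
        continuous_on_of_real continuous_on_snd continuous_on_coord)
  have "hol_fun n ?P q"
    unfolding q_def
  proof (rule hol_fun_integral[OF P])
    show "hol_fun n ?P (\<lambda>z. ?D (z(j := of_real t * z j)))" if "t \<in> {0..1}" for t
      using upd that by (intro hol_fun_compose_upd[OF D P P] hol_fun_mult hol_fun_const hol_fun_coord) auto
    have "continuous_on (?P \<times> {0..1}) (\<lambda>q. ?D ((fst q)(j := of_real (snd q) * (fst q) j)))"
      by (rule continuous_on_compose2[OF _ c1, of ?P]) (use D upd in \<open>auto simp: hol_fun_def\<close>)
    then show "continuous_on (?P \<times> {0..1}) (\<lambda>(z, t). ?D (z(j := of_real t * z j)))"
      by (simp add: case_prod_beta)
  qed
  moreover have "u z = z j * q z" if z: "z \<in> ?P" for z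
  proof -
    have "((\<lambda>t. ?D (z(j := of_real t * z j)) * z j) has_integral
        u (z(j := of_real 1 * z j)) - u (z(j := of_real 0 * z j))) {0..1}"
    proof (rule fundamental_theorem_of_calculus)
      fix t :: real assume t: "t \<in> {0..1}"
      have "((\<lambda>w. u (z(j := w))) has_field_derivative ?D (z(j := of_real t * z j))) (at (of_real t * z j))"
        by (rule hol_fun_has_partial_deriv'[OF u upd[OF z t] j])
      then have "((\<lambda>s. u (z(j := s * z j))) has_field_derivative ?D (z(j := of_real t * z j)) * z j) (at (of_real t))"
        by (rule DERIV_chain2) (auto intro!: derivative_eq_intros)
      then show "((\<lambda>t. u (z(j := of_real t * z j))) has_vector_derivative ?D (z(j := of_real t * z j)) * z j) (at t within {0..1})"
        by (rule has_vector_derivative_real_field)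
    qed simp
    then have "((\<lambda>t. ?D (z(j := of_real t * z j)) * z j) has_integral u z) {0..1}"
      using zero[OF z] by simp
    then have "integral {0..1} (\<lambda>t. ?D (z(j := of_real t * z j)) * z j) = u z" by (rule integral_unique)
    then show ?thesis by (simp add: q_def mult.commute)
  qed
  ultimately show ?thesis using that by blast
qed

text \<open>Divide by \<open>z j\<close> as long as the function vanishes on the whole hyperplane.
  Each division lowers the order of vanishing at 0 of the slice through \<open>a\<close>, which is
  finite because \<open>u a\<close> is nonzero. The last quotient is nonzero somewhere on the
  hyperplane, hence near that point.\<close>

lemma nonvanishing_off_hyperplane:
  assumes u: "hol_fun n (polydisc n c r) u" and j: "j < n" and c: "c j = 0" and rj: "r j > 0"
    and a: "a \<in> polydisc n c r" "u a \<noteq> 0"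
  obtains z2 V where "open_cspace n V" "z2 \<in> V" "V \<subseteq> polydisc n c r" "z2 j = 0"
    "\<And>z. z \<in> V \<Longrightarrow> z j \<noteq> 0 \<Longrightarrow> u z \<noteq> 0"
proof -
  let ?P = "polydisc n c r"
  have P: "open_cspace n ?P" by (rule polydisc_open_cspace)
  let ?B = "ball (0::complex) (r j)"
  have updP: "z(j := w) \<in> ?P" if "z \<in> ?P" "w \<in> ?B" for z w
    using polydisc_upd[OF that(1) j, of w] that(2) c by simp
  \<comment> \<open>The factorisation is asked only for nonzero \<open>w\<close>, so that a factor
    \<open>w\<close> can be cancelled without a condition at 0.\<close>
  define order where "order u N \<longleftrightarrow> (\<exists>\<rho>>0. \<exists>h. isCont h 0 \<and> h 0 \<noteq> 0 \<and>
     (\<forall>w. 0 < cmod w \<and> cmod w < \<rho> \<longrightarrow> u (a(j := w)) = w ^ N * h w))" for u :: "cvec \<Rightarrow> complex" and N :: nat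
  have step: "\<exists>V z2. open_cspace n V \<and> z2 \<in> V \<and> V \<subseteq> ?P \<and> z2 j = 0 \<and> (\<forall>z\<in>V. z j \<noteq> 0 \<longrightarrow> u z \<noteq> 0)"
    if "hol_fun n ?P u" "order u N" for u N
    using that
  proof (induction N arbitrary: u)
    case N: (0 u)
    have slice: "(\<lambda>w. u (a(j := w))) holomorphic_on ?B"
      by (rule holomorphic_on_subset[OF hol_fun_slice[OF N(1) j]]) (use updP[OF a(1)] in \<open>auto simp del: mem_ball\<close>)
    then have "isCont (\<lambda>w. u (a(j := w))) 0"
      using rj holomorphic_on_imp_continuous_on[OF slice] by (simp add: continuous_on_eq_continuous_at)
    then have l1: "(\<lambda>w. u (a(j := w))) \<midarrow>0\<rightarrow> u (a(j := 0))" by (simp add: isCont_def)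
    obtain \<rho> h where h: "\<rho> > 0" "isCont h 0" "h 0 \<noteq> 0" "\<And>w. 0 < cmod w \<Longrightarrow> cmod w < \<rho> \<Longrightarrow> u (a(j := w)) = h w"
      using N(2) unfolding order_def by auto
    have "h \<midarrow>0\<rightarrow> h 0" using h(2) by (simp add: isCont_def)
    then have "(\<lambda>w. u (a(j := w))) \<midarrow>0\<rightarrow> h 0"
      by (rule Lim_transform_within[OF _ h(1)]) (use h(4) in \<open>auto simp: dist_norm\<close>)
    then have "u (a(j := 0)) = h 0" using l1 LIM_unique by blast
    then have nz: "u (a(j := 0)) \<noteq> 0" using h by simp
    have "open_cspace n {z\<in>?P. u z \<in> - {0}}"
      using N(1) by (intro open_cspace_Collect[OF P]) (auto simp: hol_fun_def)
    moreover have "a(j := 0) \<in> {z\<in>?P. u z \<in> - {0}}"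
      using nz updP[OF a(1), of 0] rj by (simp del: fun_upd_apply)
    moreover have "(a(j := 0)) j = 0" by simp
    ultimately show ?case
      by (intro exI[of _ "{z\<in>?P. u z \<in> - {0}}"] exI[of _ "a(j := 0)"] conjI) (auto simp del: fun_upd_apply)
  next
    case (Suc M u)
    show ?case
    proof (cases "\<exists>z\<in>?P. u (z(j := 0)) \<noteq> 0")
      case True
      then obtain z where z: "z \<in> ?P" "u (z(j := 0)) \<noteq> 0" by blast
      have "open_cspace n {z\<in>?P. u z \<in> - {0}}"
        using Suc(2) by (intro open_cspace_Collect[OF P]) (auto simp: hol_fun_def)
      moreover have "z(j := 0) \<in> {z\<in>?P. u z \<in> - {0}}"
        using z updP[OF z(1), of 0] rj by (simp del: fun_upd_apply)
      moreover have "(z(j := 0)) j = 0" by simp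
      ultimately show ?thesis
        by (intro exI[of _ "{z\<in>?P. u z \<in> - {0}}"] exI[of _ "z(j := 0)"] conjI) (auto simp del: fun_upd_apply)
    next
      case False
      then obtain q where q: "hol_fun n ?P q" "\<And>z. z \<in> ?P \<Longrightarrow> u z = z j * q z"
        using hadamard_division[where u=u, OF Suc(2) j c] by blast
      obtain \<rho> h where h: "\<rho> > 0" "isCont h 0" "h 0 \<noteq> 0"
        "\<And>w. 0 < cmod w \<Longrightarrow> cmod w < \<rho> \<Longrightarrow> u (a(j := w)) = w ^ Suc M * h w"
        using Suc(3) unfolding order_def by blast
      \<comment> \<open>The quotient keeps the same factor \<open>h\<close> and loses one power of
        \<open>w\<close>.\<close>
      have "order q M"
        unfolding order_def
      proof (intro exI[of _ "min \<rho> (r j)"] exI[of _ h] conjI allI impI)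
        fix w :: complex assume w: "0 < cmod w \<and> cmod w < min \<rho> (r j)"
        then have "a(j := w) \<in> ?P" using updP[OF a(1), of w] by simp
        then have "u (a(j := w)) = w * q (a(j := w))" using q(2) by fastforce
        moreover have "u (a(j := w)) = w ^ Suc M * h w" using h(4) w by simp
        ultimately show "q (a(j := w)) = w ^ M * h w" using w by auto
      qed (use h rj in auto)
      then obtain V z2 where V: "open_cspace n V" "z2 \<in> V" "V \<subseteq> ?P" "z2 j = 0" "\<forall>z\<in>V. z j \<noteq> 0 \<longrightarrow> q z \<noteq> 0"
        using Suc(1)[OF q(1)] by blast
      moreover have "u z \<noteq> 0" if "z \<in> V" "z j \<noteq> 0" for z
        using that V q(2)[of z] by auto
      ultimately show ?thesis by blast
    qed
  qed
  have "\<exists>N. order u N"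
  proof -
    let ?U = "\<lambda>w. u (a(j := w))"
    have slice: "?U holomorphic_on ?B"
      by (rule holomorphic_on_subset[OF hol_fun_slice[OF u j]]) (use updP[OF a(1)] in \<open>auto simp del: mem_ball\<close>)
    have cont: "isCont ?U 0"
      using rj holomorphic_on_imp_continuous_on[OF slice] by (simp add: continuous_on_eq_continuous_at)
    show ?thesis
    proof (cases "?U 0 = 0")
      case False
      then have "order u 0" unfolding order_def
        using cont rj by (intro exI[of _ "r j"] conjI exI[of _ ?U]) auto
      then show ?thesis by blast
    next
      case True
      have aj: "a j \<in> ?B" using a(1) j c by (auto simp: polydisc_def)
      have nc: "\<not> ?U constant_on ?B"
      proof
        assume "?U constant_on ?B"
        then obtain k where "\<And>w. w \<in> ?B \<Longrightarrow> ?U w = k" unfolding constant_on_def by blast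
        then have "?U (a j) = ?U 0" using aj rj by (metis centre_in_ball)
        then show False using True a(2) by simp
      qed
      have "0 \<in> ?B" using rj by simp
      obtain g s N where g: "0 < N" "0 < s" "ball 0 s \<subseteq> ?B" "g holomorphic_on ball 0 s"
         "\<And>w. w \<in> ball 0 s \<Longrightarrow> ?U w = (w - 0) ^ N * g w" "\<And>w. w \<in> ball 0 s \<Longrightarrow> g w \<noteq> 0"
        by (rule holomorphic_factor_zero_nonconstant[OF slice open_ball connected_ball \<open>0 \<in> ?B\<close> True nc]) (rule that)
      have "isCont g 0"
        using g(2) holomorphic_on_imp_continuous_on[OF g(4)] by (simp add: continuous_on_eq_continuous_at)
      then have "order u N" unfolding order_def
        using g(2,5,6) by (intro exI[of _ s] conjI exI[of _ g]) auto
      then show ?thesis by blast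
    qed
  qed
  then obtain N where "order u N" ..
  from step[OF u this] obtain V z2 where V: "open_cspace n V" "z2 \<in> V" "V \<subseteq> ?P" "z2 j = 0"
    "\<forall>z\<in>V. z j \<noteq> 0 \<longrightarrow> u z \<noteq> 0" by (elim exE conjE)
  show ?thesis by (rule that[OF V(1-4)]) (use V(5) in simp)
qed

text \<open>The circle of radius \<open>r j / 2\<close> about \<open>b j\<close> avoids the graph,
  which stays within \<open>r j / 4\<close>, so a Cauchy integral over it exists on every slice. On
  slices missing \<open>E\<close> it returns \<open>f\<close>; \<open>z1\<close> provides an open
  set of these, and the identity theorem in the transverse variables extends the equality to an
  annulus in every slice.\<close>

lemma hartogs_graph:
  assumes j: "j < n" and b: "b \<in> cspace n" and rpos: "\<And>i. r i > 0"
    and QE: "open_cspace n (polydisc n b r - E)" and f: "hol_fun n (polydisc n b r - E) f"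
    and \<phi>: "hol_fun n (polydisc n b r) \<phi>" and indep: "\<And>z x. \<phi> (z(j := x)) = \<phi> z"
    and bd: "\<And>z. z \<in> polydisc n b r \<Longrightarrow> cmod (\<phi> z - b j) \<le> r j / 4"
    and gr: "\<And>z. z \<in> polydisc n b r \<Longrightarrow> z \<in> E \<Longrightarrow> z j = \<phi> z"
    and z1: "z1 \<in> polydisc n b r" "z1(j := \<phi> z1) \<notin> E"
  obtains G where "hol_fun n (polydisc n b (r(j := r j / 2))) G"
    "\<And>z. z \<in> polydisc n b (r(j := r j / 2)) - E \<Longrightarrow> G z = f z"
proof -
  let ?\<epsilon> = "r j" and ?Q = "polydisc n b r" and ?Q' = "polydisc n b (r(j := r j / 2))"
  let ?c = "b j"
  have \<epsilon>: "?\<epsilon> > 0" by (rule rpos)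
  have Q: "open_cspace n ?Q" and Q': "open_cspace n ?Q'" by (rule polydisc_open_cspace)+
  have QQ: "?Q' \<subseteq> ?Q" by (rule polydisc_mono) (use \<epsilon> in auto)
  have upd: "z(j := w) \<in> ?Q" if "z \<in> ?Q" "w \<in> ball ?c ?\<epsilon>" for z w
    using polydisc_upd[OF that(1) j, of w] that(2) by (simp add: dist_norm norm_minus_commute)
  have upd': "z(j := w) \<in> ?Q'" if "z \<in> ?Q" "w \<in> ball ?c (?\<epsilon>/2)" for z w
    using that j by (auto simp: polydisc_def cspace_upd dist_norm norm_minus_commute)
  have phib: "\<phi> z \<in> ball ?c (?\<epsilon>/2)" if "z \<in> ?Q" for z
    using bd[OF that] \<epsilon> by (simp add: dist_norm norm_minus_commute)
  have notE: "z(j := w) \<notin> E" if z: "z \<in> ?Q" and w: "w \<in> ball ?c ?\<epsilon>" "dist ?c w > ?\<epsilon>/4" for z w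
  proof
    assume "z(j := w) \<in> E"
    then have "w = \<phi> z" using gr[OF upd[OF z w(1)]] indep by simp
    then show False using bd[OF z] w by (simp add: dist_norm norm_minus_commute)
  qed
  have sph: "u \<in> ball ?c ?\<epsilon>" "dist ?c u > ?\<epsilon>/4" if "u \<in> sphere ?c (?\<epsilon>/2)" for u
    using that \<epsilon> by auto
  have inQE: "z(j := u) \<in> ?Q - E" if "z \<in> ?Q'" "u \<in> sphere ?c (?\<epsilon>/2)" for z u
    using that upd notE sph QQ by blast
  have ne: "u - z j \<noteq> 0" if "z \<in> ?Q'" "u \<in> sphere ?c (?\<epsilon>/2)" for z u
    using that j by (auto simp: polydisc_def dist_norm norm_minus_commute)
  define K where "K z u = f (z(j := u)) / (u - z j)" for z u
  define G where "G z = 1 / (2 * of_real pi * \<i>) * contour_integral (circlepath ?c (?\<epsilon>/2)) (K z)" for z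
  have holG: "hol_fun n ?Q' G"
    unfolding G_def
  proof (intro hol_fun_mult hol_fun_const hol_fun_contour_integral[OF Q'])
    show "hol_fun n ?Q' (\<lambda>z. K z u)" if u: "u \<in> sphere ?c (?\<epsilon>/2)" for u
      unfolding K_def using ne u inQE
      by (intro hol_fun_divide hol_fun_diff hol_fun_const hol_fun_coord hol_fun_compose_upd[OF f QE Q']) auto
    have c1: "continuous_on (?Q' \<times> sphere ?c (?\<epsilon>/2)) (\<lambda>q. (fst q)(j := snd q))"
      by (intro continuous_on_fun_upd continuous_on_fst continuous_on_snd continuous_on_id)
    have "continuous_on (?Q - E) f" using f by (simp add: hol_fun_def)
    from continuous_on_compose2[OF this c1]
    have "continuous_on (?Q' \<times> sphere ?c (?\<epsilon>/2)) (\<lambda>q. f ((fst q)(j := snd q)))" using inQE by fastforce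
    moreover have "continuous_on (?Q' \<times> sphere ?c (?\<epsilon>/2)) (\<lambda>q. snd q - fst q j)"
      by (intro continuous_intros continuous_on_coord)
    ultimately show "continuous_on (?Q' \<times> sphere ?c (?\<epsilon>/2)) (\<lambda>(z, u). K z u)"
      unfolding K_def case_prod_beta using ne by (intro continuous_on_divide) auto
  qed (use \<epsilon> in auto)
  have slice: "(\<lambda>w. f (z(j := w))) holomorphic_on {w \<in> ball ?c ?\<epsilon>. z(j := w) \<notin> E}" if "z \<in> ?Q" for z
    using hol_fun_slice[OF f j] by (rule holomorphic_on_subset) (use upd[OF that] in auto)
  have Cauchy: "G z = f z" if z: "z \<in> ?Q'" and zE: "z(j := \<phi> z) \<notin> E" for z
  proof -
    have zQ: "z \<in> ?Q" using z QQ by auto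
    have "z(j := w) \<notin> E" if "w \<in> ball ?c ?\<epsilon>" for w
    proof
      assume "z(j := w) \<in> E"
      moreover from this have "w = \<phi> z" using gr[OF upd[OF zQ that]] indep by simp
      ultimately show False using zE by simp
    qed
    then have "(\<lambda>w. f (z(j := w))) holomorphic_on cball ?c (?\<epsilon>/2)"
      by (intro holomorphic_on_subset[OF slice[OF zQ]]) (use \<epsilon> in auto)
    moreover have "cmod (z j - ?c) < ?\<epsilon>/2" using z j by (auto simp: polydisc_def)
    ultimately have "(K z has_contour_integral (2 * of_real pi * \<i> * f (z(j := z j)))) (circlepath ?c (?\<epsilon>/2))"
      unfolding K_def by (rule Cauchy_integral_circlepath_simple)
    then show ?thesis by (simp add: G_def contour_integral_unique)
  qed
  \<comment> \<open>A slice meets \<open>E\<close> at most at height \<open>\<phi> z\<close>, so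
    these are the points whose whole slice is free of \<open>E\<close>.\<close>
  define O' where "O' = {z\<in>?Q'. z(j := \<phi> z) \<in> ?Q - E}"
  have O': "open_cspace n O'"
    unfolding O'_def
  proof (rule open_cspace_vimage'[OF QE _ Q'])
    show "continuous_on ?Q' (\<lambda>z. z(j := \<phi> z))"
      using hol_fun_continuous_upd[OF hol_fun_subset[OF \<phi> QQ]] .
    show "(\<lambda>z. z(j := \<phi> z)) ` ?Q' \<subseteq> cspace n"
      using j by (auto simp: polydisc_def intro: cspace_upd)
  qed
  have O'iff: "z \<in> O' \<longleftrightarrow> z \<in> ?Q' \<and> z(j := \<phi> z) \<notin> E" for z
    using upd[of z "\<phi> z"] phib[of z] QQ \<epsilon> by (auto simp: O'_def)
  \<comment> \<open>\<open>z1\<close> may lie outside the thinner polydisc, so its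
    \<open>j\<close>-th entry is reset to the centre; the slice stays the same.\<close>
  have "z1(j := ?c) \<in> O'"
    using O'iff z1 upd'[OF z1(1), of ?c] \<epsilon> indep by simp
  then have O'ne: "O' \<noteq> {}" by blast
  have main: "G z = f z" if z: "z \<in> ?Q'" "z \<notin> E" for z
  proof (cases "z(j := \<phi> z) \<in> E")
    case False
    then show ?thesis using Cauchy z by blast
  next
    case True
    have zQ: "z \<in> ?Q" using z QQ by auto
    \<comment> \<open>The height \<open>t\<close> is frozen in the annulus, where \<open>E\<close>
      has no points, so both terms are holomorphic on all of \<open>?Q'\<close>.\<close>
    have ann: "f (z(j := t)) - G (z(j := t)) = 0" if t: "t \<in> ball ?c (?\<epsilon>/2)" "dist ?c t > ?\<epsilon>/4" for t
    proof (rule hol_fun_identity[where f="\<lambda>y. f (y(j := t)) - G (y(j := t))" and b=z and O'=O'])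
      have t': "t \<in> ball ?c ?\<epsilon>" using t by auto
      have "y(j := t) \<in> ?Q - E" if "y \<in> ?Q'" for y using upd[of y t] notE[of y t] t t' that QQ by blast
      moreover have "y(j := t) \<in> ?Q'" if "y \<in> ?Q'" for y using upd'[of y t] t that QQ by blast
      ultimately show "hol_fun n ?Q' (\<lambda>y. f (y(j := t)) - G (y(j := t)))"
        by (intro hol_fun_diff hol_fun_compose_upd[OF f QE Q'] hol_fun_compose_upd[OF holG Q' Q'] hol_fun_const) auto
      show "f (y(j := t)) - G (y(j := t)) = 0" if "y \<in> O'" for y
      proof -
        have y: "y \<in> ?Q'" "y(j := \<phi> y) \<notin> E" using that O'iff by auto
        then have "y(j := t) \<in> ?Q'" using upd'[of y t] t QQ by blast
        then have "G (y(j := t)) = f (y(j := t))" by (rule Cauchy) (simp add: indep y)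
        then show ?thesis by simp
      qed
    qed (use O' O'ne z O'iff in auto)
    \<comment> \<open>In this slice only \<open>\<phi> z\<close> can belong to \<open>E\<close>. A
      disc without one point is connected, so equality spreads inwards from the annulus.\<close>
    let ?S = "ball ?c (?\<epsilon>/2) - {\<phi> z}"
    have zw: "z(j := w) \<notin> E" if "w \<in> ?S" for w
    proof
      assume E: "z(j := w) \<in> E"
      have "w \<in> ball ?c ?\<epsilon>" using that subset_ball[of "?\<epsilon>/2" ?\<epsilon> ?c] \<epsilon> by (auto simp del: mem_ball)
      then have "w = \<phi> z" using gr[OF upd[OF zQ] E] indep by simp
      then show False using that by simp
    qed
    have "f (z(j := z j)) - G (z(j := z j)) = 0"
    proof (rule analytic_continuation_open[where f="\<lambda>w. f (z(j := w)) - G (z(j := w))" and z="z j" and g="\<lambda>_. 0"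
          and s="ball ?c (?\<epsilon>/2) - cball ?c (?\<epsilon>/4)" and s'="?S"])
      show "open (ball ?c (?\<epsilon>/2) - cball ?c (?\<epsilon>/4))" "open ?S" by (auto intro: open_Diff)
      \<comment> \<open>3/8 lies halfway between the radii 1/4 and 1/2 of the annulus.\<close>
      have "?c + of_real (3/8 * ?\<epsilon>) \<in> ball ?c (?\<epsilon>/2) - cball ?c (?\<epsilon>/4)"
        using \<epsilon> by (simp add: dist_norm norm_mult del: of_real_mult)
      then show "ball ?c (?\<epsilon>/2) - cball ?c (?\<epsilon>/4) \<noteq> {}" by blast
      show "connected ?S" by (rule connected_open_delete) auto
      show "ball ?c (?\<epsilon>/2) - cball ?c (?\<epsilon>/4) \<subseteq> ?S"
        using bd[OF zQ] by (auto simp: dist_norm norm_minus_commute)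
      have h1: "(\<lambda>w. f (z(j := w))) holomorphic_on ?S"
        by (rule holomorphic_on_subset[OF slice[OF zQ]]) (use zw subset_ball[of "?\<epsilon>/2" ?\<epsilon> ?c] \<epsilon> in \<open>auto simp del: mem_ball\<close>)
      have h2: "(\<lambda>w. G (z(j := w))) holomorphic_on ?S"
        by (rule holomorphic_on_subset[OF hol_fun_slice[OF holG j]]) (use upd'[OF zQ] in auto)
      show "(\<lambda>w. f (z(j := w)) - G (z(j := w))) holomorphic_on ?S" using h1 h2 by (rule holomorphic_on_diff)
      show "z j \<in> ?S"
      proof -
        have "z j \<noteq> \<phi> z" using True z(2) by (metis fun_upd_triv)
        then show ?thesis using z(1) j by (auto simp: polydisc_def dist_norm norm_minus_commute)
      qed
    qed (use ann in auto)
    then show ?thesis by simp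
  qed
  show ?thesis using that holG main by blast
qed

section \<open>Extension across analytic sets of codimension two\<close>

definition loc_analytic :: "nat \<Rightarrow> cvec set \<Rightarrow> cvec set \<Rightarrow> bool" where
  "loc_analytic n W S \<longleftrightarrow> (\<forall>z\<in>W. \<exists>V F. open_cspace n V \<and> z \<in> V \<and> V \<subseteq> W \<and> finite F \<and>
     (\<forall>f\<in>F. hol_fun n V f) \<and> S \<inter> V = {y\<in>V. \<forall>f\<in>F. f y = 0})"

definition biholo :: "nat \<Rightarrow> cvec set \<Rightarrow> cvec set \<Rightarrow> (cvec \<Rightarrow> cvec) \<Rightarrow> (cvec \<Rightarrow> cvec) \<Rightarrow> bool" where
  "biholo n U V \<Psi> \<Phi> \<longleftrightarrow> open_cspace n U \<and> open_cspace n V \<and>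
     (\<forall>i<n. hol_fun n U (\<lambda>z. \<Psi> z i)) \<and> (\<forall>i<n. hol_fun n V (\<lambda>z. \<Phi> z i)) \<and>
     (\<forall>z\<in>U. \<Psi> z \<in> V \<and> \<Phi> (\<Psi> z) = z) \<and> (\<forall>z\<in>V. \<Phi> z \<in> U \<and> \<Psi> (\<Phi> z) = z)"

lemma loc_analytic_open:
  assumes "loc_analytic n W S" "open_cspace n W"
  shows "open_cspace n (W - S)"
proof (subst openin_subopen, intro ballI)
  fix z assume z: "z \<in> W - S"
  then obtain V F where V: "open_cspace n V" "z \<in> V" "V \<subseteq> W" "finite F" "\<forall>f\<in>F. hol_fun n V f"
    "S \<inter> V = {y\<in>V. \<forall>f\<in>F. f y = 0}"
    using assms(1) unfolding loc_analytic_def by (meson DiffD1)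
  then obtain f where f: "f \<in> F" "f z \<noteq> 0" using z by blast
  have "open_cspace n {y\<in>V. f y \<in> - {0}}"
    using V(5) f by (intro open_cspace_Collect[OF V(1)]) (auto simp: hol_fun_def)
  moreover have "{y\<in>V. f y \<in> - {0}} \<subseteq> W - S" using V(3,6) f by auto
  moreover have "z \<in> {y\<in>V. f y \<in> - {0}}" using V(2) f by simp
  ultimately show "\<exists>T. open_cspace n T \<and> z \<in> T \<and> T \<subseteq> W - S" by blast
qed

text \<open>The set where the functions differ is open and contained in \<open>S\<close>, hence
  empty. This is what makes local extensions unique and lets them be glued.\<close>

lemma hol_eq_off_thin:
  assumes u: "hol_fun n V u" "hol_fun n V' u'" and V: "open_cspace n V" "open_cspace n V'"
    and thin: "\<And>A. open_cspace n A \<Longrightarrow> A \<subseteq> S \<Longrightarrow> A = {}"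
    and eq: "\<And>y. y \<in> V \<inter> V' - S \<Longrightarrow> u y = u' y" and z: "z \<in> V \<inter> V'"
  shows "u z = u' z"
proof (rule ccontr)
  assume ne: "u z \<noteq> u' z"
  have VV: "open_cspace n (V \<inter> V')" using V by (rule openin_Int)
  have "continuous_on (V \<inter> V') (\<lambda>y. u y - u' y)"
    using u unfolding hol_fun_def by (intro continuous_on_diff) (auto intro: continuous_on_subset)
  then have "open_cspace n {y\<in>V \<inter> V'. u y - u' y \<in> - {0}}" by (rule open_cspace_Collect[OF VV]) auto
  moreover have "{y\<in>V \<inter> V'. u y - u' y \<in> - {0}} \<subseteq> S" using eq by auto
  ultimately have "{y\<in>V \<inter> V'. u y - u' y \<in> - {0}} = {}" by (rule thin)
  then show False using ne z by auto
qed

text \<open>\<open>thin\<close> and \<open>nostr\<close> are the local content of codimension at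
  least 2: \<open>S\<close> has no interior and is nowhere a coordinate hyperplane in suitable
  coordinates. All local extensions are glued into one on \<open>W - E\<close>; a point of
  \<open>E\<close> would produce a piece of hypersurface that coincides with
  \<open>S\<close>.\<close>

theorem hol_extension:
  assumes W: "open_cspace n W" and an: "loc_analytic n W S"
    and thin: "\<And>A. open_cspace n A \<Longrightarrow> A \<subseteq> S \<Longrightarrow> A = {}"
    and nostr: "\<And>j U V \<Psi> \<Phi>. j < n \<Longrightarrow> biholo n U V \<Psi> \<Phi> \<Longrightarrow> U \<subseteq> W \<Longrightarrow> U \<inter> S \<noteq> {} \<Longrightarrow>
       S \<inter> U = {z\<in>U. \<Psi> z j = 0} \<Longrightarrow> False"
    and f: "hol_fun n (W - S) f"
  obtains u where "hol_fun n W u" "\<And>z. z \<in> W - S \<Longrightarrow> u z = f z"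
proof -
  define ext where "ext V u \<longleftrightarrow> open_cspace n V \<and> V \<subseteq> W \<and> hol_fun n V u \<and> (\<forall>y\<in>V - S. u y = f y)" for V u
  define good where "good z \<longleftrightarrow> (\<exists>V u. ext V u \<and> z \<in> V)" for z
  define E where "E = {z\<in>W. \<not> good z}"
  have WS: "open_cspace n (W - S)" by (rule loc_analytic_open[OF an W])
  have extf: "ext (W - S) f" using WS f by (simp add: ext_def)
  have uniq: "u z = u' z" if "ext V u" "ext V' u'" "z \<in> V" "z \<in> V'" for V u V' u' z
    by (rule hol_eq_off_thin[of n V u V' u' S]) (use that thin in \<open>auto simp: ext_def\<close>)
  \<comment> \<open>Local extensions agree on overlaps by \<open>uniq\<close>, so the value does not
    depend on the neighbourhood.\<close>
  define ft where "ft z = (THE y. \<exists>V u. ext V u \<and> z \<in> V \<and> y = u z)" for z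
  have ft: "ft z = u z" if "ext V u" "z \<in> V" for V u z
    unfolding ft_def
  proof (rule the_equality)
    show "\<exists>V' u'. ext V' u' \<and> z \<in> V' \<and> u z = u' z" using that by blast
    show "y = u z" if "\<exists>V u. ext V u \<and> z \<in> V \<and> y = u z" for y
      using that uniq \<open>ext V u\<close> \<open>z \<in> V\<close> by blast
  qed
  have ftf: "ft z = f z" if "z \<in> W - S" for z using ft[OF extf that] .
  have ES: "E \<subseteq> S" using extf unfolding E_def good_def by blast
  have extW: "V \<subseteq> W" if "ext V u" for V u using that by (simp add: ext_def)
  have WE: "W - E = \<Union> {V. \<exists>u. ext V u}" unfolding E_def good_def using extW by blast
  have WEo: "open_cspace n (W - E)" unfolding WE by (rule openin_Union) (auto simp: ext_def)
  have hft: "hol_fun n (W - E) ft"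
  proof (rule hol_fun_local[OF _ WEo])
    fix z assume "z \<in> W - E"
    then obtain V u where V: "ext V u" "z \<in> V" by (auto simp: E_def good_def)
    have "hol_fun n V ft"
      by (rule hol_fun_cong[of n V u]) (use V ft in \<open>auto simp: ext_def\<close>)
    then show "\<exists>V. open_cspace n V \<and> z \<in> V \<and> hol_fun n V ft" using V unfolding ext_def by (intro exI[of _ V]) simp
  qed
  have "E = {}"
  proof (rule ccontr)
    assume "E \<noteq> {}"
    then obtain a where a: "a \<in> E" by blast
    then have aW: "a \<in> W" by (simp add: E_def)
    obtain V0 F0 where V0: "open_cspace n V0" "a \<in> V0" "V0 \<subseteq> W" "\<forall>f\<in>F0. hol_fun n V0 f"
      "S \<inter> V0 = {y\<in>V0. \<forall>f\<in>F0. f y = 0}"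
      using an aW unfolding loc_analytic_def by meson
    obtain e where e: "e > 0" "polydisc n a (\<lambda>_. e) \<subseteq> V0" using open_cspace_polydisc[OF V0(1,2)] by blast
    let ?P = "polydisc n a (\<lambda>_. e)"
    have aP: "a \<in> ?P" using aW open_cspace_subset[OF W] e(1) by (auto intro: polydisc_centre)
    have Po: "open_cspace n ?P" by (rule polydisc_open_cspace)
    have "\<not> ?P \<subseteq> S" using thin[OF Po] aP by blast
    then obtain w h where h: "w \<in> ?P" "h \<in> F0" "h w \<noteq> 0" using V0(5) e(2) by blast
    \<comment> \<open>Vanishing is asked on \<open>E\<close> instead of \<open>S\<close>: a partial
      derivative that leaves the family is then nonzero at a point of \<open>E\<close> itself, which
      is where the graph is wanted.\<close>
    define \<V> where "\<V> = {g. hol_fun n ?P g \<and> (\<forall>z\<in>E \<inter> ?P. g z = 0)}"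
    have "hol_fun n V0 h" using V0(4) h(2) by blast
    then have "hol_fun n ?P h" using e(2) by (rule hol_fun_subset)
    moreover have "h z = 0" if "z \<in> E \<inter> ?P" for z using that ES V0(5) e(2) h(2) by blast
    ultimately have hV: "h \<in> \<V>" by (simp add: \<V>_def)
    \<comment> \<open>Otherwise every member would vanish on \<open>?P\<close>, among them the
      defining function \<open>h\<close>, which is nonzero at \<open>w\<close>.\<close>
    have "\<exists>g\<in>\<V>. \<exists>j<n. partial_deriv j g \<notin> \<V>"
    proof (rule ccontr)
      assume "\<not> ?thesis"
      then have cl: "\<And>g j. g \<in> \<V> \<Longrightarrow> j < n \<Longrightarrow> partial_deriv j g \<in> \<V>" by blast
      have "h w = 0"
        by (rule hol_fun_derivs_zero[OF _ cl _ aP h(1) hV]) (use a aP in \<open>auto simp: \<V>_def\<close>)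
      then show False using h(3) by simp
    qed
    then obtain g j where g: "g \<in> \<V>" "j < n" "partial_deriv j g \<notin> \<V>" by blast
    have gh: "hol_fun n ?P g" using g(1) by (simp add: \<V>_def)
    have "hol_fun n ?P (partial_deriv j g)" by (rule hol_fun_partial_deriv[OF gh Po g(2)])
    then obtain b where b: "b \<in> E" "b \<in> ?P" "partial_deriv j g b \<noteq> 0" using g(3) unfolding \<V>_def by blast
    have gE: "g z = 0" if "z \<in> E" "z \<in> ?P" for z using g(1) that unfolding \<V>_def by blast
    have j: "j < n" by (rule g(2))
    have bW: "b \<in> W" using b(1) by (simp add: E_def)
    have bc: "b \<in> cspace n" using bW open_cspace_subset[OF W] by auto
    obtain Vb Fb where Vb: "open_cspace n Vb" "b \<in> Vb" "Vb \<subseteq> W" "\<forall>f\<in>Fb. hol_fun n Vb f"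
      "S \<inter> Vb = {y\<in>Vb. \<forall>f\<in>Fb. f y = 0}"
      using an bW unfolding loc_analytic_def by meson
    have PV: "open_cspace n (?P \<inter> Vb)" using Po Vb(1) by (rule openin_Int)
    have "hol_fun n (?P \<inter> Vb) g" using gh by (rule hol_fun_subset) simp
    from implicit_function[OF this PV _ j gE[OF b(1,2)] b(3)]
    obtain r \<phi> where rpos: "\<And>i. r i > 0" and Qsub: "polydisc n b r \<subseteq> ?P \<inter> Vb"
      and \<phi>: "hol_fun n (polydisc n b r) \<phi>" and indep: "\<And>z x. \<phi> (z(j := x)) = \<phi> z"
      and bd: "\<And>z. z \<in> polydisc n b r \<Longrightarrow> cmod (\<phi> z - b j) \<le> r j / 4"
      and g\<phi>: "\<And>z. z \<in> polydisc n b r \<Longrightarrow> g z = 0 \<longleftrightarrow> z j = \<phi> z"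
      using b(2) Vb(2) by blast
    let ?Q = "polydisc n b r"
    have Qo: "open_cspace n ?Q" by (rule polydisc_open_cspace)
    have QW: "?Q \<subseteq> W" using Qsub Vb(3) by blast
    have gr: "z j = \<phi> z" if "z \<in> ?Q" "z \<in> E" for z using gE[of z] that g\<phi>[of z] Qsub by blast
    have "?Q - E = ?Q \<inter> (W - E)" using QW by blast
    then have QE: "open_cspace n (?Q - E)" using openin_Int[OF Qo WEo] by simp
    have fQE: "hol_fun n (?Q - E) ft" using hft by (rule hol_fun_subset) (use QW in blast)
    \<comment> \<open>A graph point outside \<open>E\<close> would let the Cauchy integral extend
      the function over \<open>b\<close>, against \<open>b \<in> E\<close>.\<close>
    have inE: "z(j := \<phi> z) \<in> E" if z: "z \<in> ?Q" for z
    proof (rule ccontr)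
      assume "z(j := \<phi> z) \<notin> E"
      from hartogs_graph[OF j bc rpos QE fQE \<phi> indep bd gr z this]
      obtain G where G: "hol_fun n (polydisc n b (r(j := r j / 2))) G"
        "\<And>z. z \<in> polydisc n b (r(j := r j / 2)) - E \<Longrightarrow> G z = ft z" by blast
      let ?Q' = "polydisc n b (r(j := r j / 2))"
      have sub: "?Q' \<subseteq> ?Q" by (rule polydisc_mono) (use rpos[of j] in auto)
      have "G y = f y" if "y \<in> ?Q' - S" for y
      proof -
        have "y \<in> ?Q' - E" using that ES by blast
        moreover have "y \<in> W - S" using that sub QW by blast
        ultimately show ?thesis using G(2) ftf by simp
      qed
      then have "ext ?Q' G" using G(1) sub QW polydisc_open_cspace unfolding ext_def by blast
      moreover have "b \<in> ?Q'" using bc rpos by (auto intro!: polydisc_centre)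
      ultimately have "good b" unfolding good_def by blast
      then show False using b(1) by (simp add: E_def)
    qed
    \<comment> \<open>The shear \<theta> below takes the hyperplane \<open>z j = 0\<close> to the
      graph. Halving the \<open>j\<close>-th radius leaves room for \<phi>, which stays within a
      quarter radius of \<open>b j\<close>, so that sheared points remain in
      \<open>?Q\<close>.\<close>
    let ?c = "b(j := 0)" and ?s = "r(j := r j / 2)"
    let ?P0 = "polydisc n ?c ?s"
    have P0o: "open_cspace n ?P0" by (rule polydisc_open_cspace)
    have toQ: "z(j := x) \<in> ?Q" if "z \<in> ?P0" "x \<in> ball (b j) (r j)" for z x
      using that j by (auto simp: polydisc_def cspace_upd dist_norm norm_minus_commute)
    have \<phi>0: "hol_fun n ?P0 \<phi>"
    proof -
      have "hol_fun n ?P0 (\<lambda>z. \<phi> (z(j := b j)))"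
        by (rule hol_fun_compose_upd[OF \<phi> Qo P0o hol_fun_const]) (use toQ rpos[of j] in simp)
      then show ?thesis by (simp add: indep)
    qed
    have bd0: "cmod (\<phi> z - b j) \<le> r j / 4" if "z \<in> ?P0" for z
      using bd[OF toQ[OF that, of "b j"]] rpos[of j] indep by simp
    define \<theta> where "\<theta> z = z(j := z j + \<phi> z)" for z
    define \<theta>' where "\<theta>' z = z(j := z j - \<phi> z)" for z
    have \<theta>\<theta>': "\<theta> (\<theta>' z) = z" "\<theta>' (\<theta> z) = z" for z by (simp_all add: \<theta>_def \<theta>'_def indep)
    have \<theta>Q: "\<theta> z \<in> ?Q" if z: "z \<in> ?P0" for z
    proof -
      have "cmod (z j) < r j / 2" using z j by (auto simp: polydisc_def)
      then have "cmod (z j + \<phi> z - b j) < r j"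
        using bd0[OF z] norm_triangle_ineq[of "z j" "\<phi> z - b j"] rpos[of j] by (simp add: algebra_simps)
      then show ?thesis unfolding \<theta>_def
        by (intro toQ[OF z]) (simp add: dist_norm norm_minus_commute)
    qed
    have \<theta>hol: "hol_fun n ?P0 (\<lambda>z. \<theta> z i)" for i
      unfolding \<theta>_def by (intro hol_fun_upd_coord hol_fun_add hol_fun_coord \<phi>0)
    have \<theta>'hol: "hol_fun n ?Q (\<lambda>z. \<theta>' z i)" for i
      unfolding \<theta>'_def by (intro hol_fun_upd_coord hol_fun_diff hol_fun_coord \<phi>)
    have \<theta>'o: "open_cspace n {y\<in>?Q. \<theta>' y \<in> A}" if "open_cspace n A" for A
    proof (rule open_cspace_vimage'[OF that _ Qo])
      show "continuous_on ?Q \<theta>'" unfolding \<theta>'_def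
        by (rule hol_fun_continuous_upd[where n=n]) (intro hol_fun_diff hol_fun_coord \<phi>)
      show "\<theta>' ` ?Q \<subseteq> cspace n" using j by (auto simp: \<theta>'_def polydisc_def intro: cspace_upd)
    qed
    have cP0: "?c \<in> ?P0" using rpos bc j by (auto intro!: polydisc_centre cspace_upd)
    \<comment> \<open>If all defining functions vanished on the sheared polydisc, \<open>S\<close>
      would contain a nonempty open set.\<close>
    have "\<exists>h\<in>Fb. \<exists>z\<in>?P0. h (\<theta> z) \<noteq> 0"
    proof (rule ccontr)
      assume no: "\<not> ?thesis"
      have "{y\<in>?Q. \<theta>' y \<in> ?P0} \<subseteq> S"
      proof
        fix y assume y: "y \<in> {y\<in>?Q. \<theta>' y \<in> ?P0}"
        then have "\<forall>h\<in>Fb. h (\<theta> (\<theta>' y)) = 0" using no by blast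
        then show "y \<in> S" using y Qsub Vb(5) by (auto simp: \<theta>\<theta>')
      qed
      then have "{y\<in>?Q. \<theta>' y \<in> ?P0} = {}" using thin[OF \<theta>'o[OF P0o]] by blast
      moreover have "\<theta> ?c \<in> {y\<in>?Q. \<theta>' y \<in> ?P0}" using \<theta>Q[OF cP0] cP0 by (simp add: \<theta>\<theta>')
      ultimately show False by blast
    qed
    then obtain h0 z0 where h0: "h0 \<in> Fb" "z0 \<in> ?P0" "h0 (\<theta> z0) \<noteq> 0" by blast
    have h0hol: "hol_fun n ?P0 (\<lambda>z. h0 (\<theta> z))"
    proof (rule hol_fun_compose[where f=h0 and F=\<theta>, OF _ Vb(1) P0o])
      show "hol_fun n Vb h0" using Vb(4) h0(1) by blast
      show "\<theta> z \<in> Vb" if "z \<in> ?P0" for z using \<theta>Q[OF that] Qsub by blast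
    qed (rule \<theta>hol)
    \<comment> \<open>Over \<open>V\<close> this defining function is nonzero off the hyperplane, so
      \<open>S\<close> lies in the graph there; \<open>inE\<close> gives the other
      inclusion.\<close>
    obtain z2 V where V: "open_cspace n V" "z2 \<in> V" "V \<subseteq> ?P0" "z2 j = 0" "\<And>z. z \<in> V \<Longrightarrow> z j \<noteq> 0 \<Longrightarrow> h0 (\<theta> z) \<noteq> 0"
    proof (rule nonvanishing_off_hyperplane[OF h0hol j _ _ h0(2,3)])
      show "(b(j := 0)) j = 0" "0 < (r(j := r j / 2)) j" using rpos[of j] by simp_all
    qed (rule that)
    let ?U = "{y\<in>?Q. \<theta>' y \<in> V}"
    have \<theta>U: "\<theta> z \<in> ?U" if "z \<in> V" for z using \<theta>Q[of z] that V(3) \<theta>\<theta>' by auto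
    have bih: "biholo n ?U V \<theta>' \<theta>"
      unfolding biholo_def
    proof (intro conjI allI impI ballI)
      show "open_cspace n ?U" by (rule \<theta>'o[OF V(1)])
      show "hol_fun n ?U (\<lambda>z. \<theta>' z i)" for i using \<theta>'hol by (rule hol_fun_subset) auto
      show "hol_fun n V (\<lambda>z. \<theta> z i)" for i using \<theta>hol V(3) by (rule hol_fun_subset)
    qed (use V(1) \<theta>U \<theta>\<theta>' in auto)
    have iff: "y \<in> S \<longleftrightarrow> \<theta>' y j = 0" if y: "y \<in> ?U" for y
    proof
      assume yS: "y \<in> S"
      show "\<theta>' y j = 0"
      proof (rule ccontr)
        assume "\<theta>' y j \<noteq> 0"
        then have "h0 (\<theta> (\<theta>' y)) \<noteq> 0" using V(5) y by blast
        then have "h0 y \<noteq> 0" by (simp add: \<theta>\<theta>')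
        then show False using yS y Qsub Vb(5) h0(1) by blast
      qed
    next
      assume "\<theta>' y j = 0"
      then have "y j = \<phi> y" by (simp add: \<theta>'_def)
      then have "y(j := \<phi> y) = y" by (metis fun_upd_triv)
      then show "y \<in> S" using inE[of y] y ES by auto
    qed
    show False
    proof (rule nostr[OF j bih])
      show "?U \<subseteq> W" using QW by blast
      have "\<theta> z2 \<in> S" using iff[OF \<theta>U[OF V(2)]] V(4) by (simp add: \<theta>\<theta>')
      then show "?U \<inter> S \<noteq> {}" using \<theta>U[OF V(2)] by blast
      show "S \<inter> ?U = {z\<in>?U. \<theta>' z j = 0}" using iff by blast
    qed
  qed
  then show ?thesis using hft ftf by (intro that[of ft]) simp_all
qed

section \<open>Minors and alternating functions on tuples\<close>

abbreviation perms :: "nat \<Rightarrow> (nat \<Rightarrow> nat) set" where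
  "perms p \<equiv> {\<pi>. \<pi> permutes {0..<p}}"

text \<open>Tuples are extensional, so there are finitely many of them and composition with a
  permutation stays among them.\<close>

abbreviation tuples :: "nat \<Rightarrow> nat \<Rightarrow> (nat \<Rightarrow> nat) set" where
  "tuples n p \<equiv> {0..<p} \<rightarrow>\<^sub>E {0..<n}"

definition csign :: "(nat \<Rightarrow> nat) \<Rightarrow> complex" where "csign \<pi> = of_int (sign \<pi>)"

text \<open>The restriction makes the enumeration extensional, hence one of the
  \<open>tuples\<close>.\<close>

definition enum :: "nat set \<Rightarrow> nat \<Rightarrow> nat" where
  "enum K = restrict (\<lambda>a. sorted_list_of_set K ! a) {0..<card K}"

definition alternating :: "nat \<Rightarrow> nat \<Rightarrow> ((nat \<Rightarrow> nat) \<Rightarrow> complex) \<Rightarrow> bool" where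
  "alternating n p c \<longleftrightarrow> (\<forall>f\<in>tuples n p. \<forall>\<pi>\<in>perms p. c (f \<circ> \<pi>) = csign \<pi> * c f)"

text \<open>With the entries given by a function, a submatrix is just a composition with
  \<open>enum\<close>.\<close>

definition det_fun :: "nat \<Rightarrow> (nat \<Rightarrow> nat \<Rightarrow> complex) \<Rightarrow> complex" where
  "det_fun p A = Determinant.det (Matrix.mat p p (\<lambda>(a, b). A a b))"

lemma finite_perms: "finite (perms p)" by (simp add: finite_permutations)

lemma det_fun_cols: "det_fun p A = (\<Sum>\<pi>\<in>perms p. csign \<pi> * (\<Prod>b<p. A (\<pi> b) b))"
proof -
  have "det_fun p A = (\<Sum>\<pi>\<in>perms p. of_int (sign \<pi>) * (\<Prod>j<p. Matrix.mat p p (\<lambda>(a, b). A a b) $$ (\<pi> j, j)))"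
    unfolding det_fun_def by (rule det_col) simp
  also have "\<dots> = (\<Sum>\<pi>\<in>perms p. csign \<pi> * (\<Prod>b<p. A (\<pi> b) b))"
    unfolding csign_def
  proof (rule sum.cong[OF refl])
    fix \<pi> assume "\<pi> \<in> perms p"
    then have "\<pi> b < p" if "b < p" for b using permutes_in_image[of \<pi> "{0..<p}" b] that by auto
    then show "of_int (sign \<pi>) * (\<Prod>j<p. Matrix.mat p p (\<lambda>(a, b). A a b) $$ (\<pi> j, j)) =
        of_int (sign \<pi>) * (\<Prod>b<p. A (\<pi> b) b)" by simp
  qed
  finally show ?thesis .
qed

lemma csign_comp: "\<pi> \<in> perms p \<Longrightarrow> \<rho> \<in> perms p \<Longrightarrow> csign (\<pi> \<circ> \<rho>) = csign \<pi> * csign \<rho>"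
  unfolding csign_def by (subst sign_compose) (auto intro: permutes_imp_permutation[of "{0..<p}"])

lemma csign_square: "csign \<pi> * csign \<pi> = 1"
  unfolding csign_def sign_def by auto

lemma csign_transpose: "i \<noteq> j \<Longrightarrow> csign (Transposition.transpose i j) = -1"
  by (simp add: csign_def sign_swap_id)

lemma prod_permute:
  assumes "\<pi> \<in> perms p"
  shows "(\<Prod>b<p. h (\<pi> b)) = (\<Prod>b<p. (h b :: complex))"
  using assms prod.permute[of \<pi> "{..<p}" h] by (simp add: atLeast0LessThan)

lemma det_fun_cols_permute:
  assumes "\<pi> \<in> perms p"
  shows "det_fun p (\<lambda>a b. A a (\<pi> b)) = csign \<pi> * det_fun p A"
proof -
  have inv: "Hilbert_Choice.inv \<pi> \<in> perms p" using assms permutes_inv by blast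
  have "det_fun p (\<lambda>a b. A a (\<pi> b)) = (\<Sum>\<rho>\<in>perms p. csign (\<rho> \<circ> \<pi>) * (\<Prod>b<p. A ((\<rho> \<circ> \<pi>) b) (\<pi> b)))"
    unfolding det_fun_cols by (rule sum_permutations_compose_right) (use assms in simp)
  also have "\<dots> = (\<Sum>\<rho>\<in>perms p. csign \<pi> * (csign \<rho> * (\<Prod>b<p. A (\<rho> b) b)))"
  proof (rule sum.cong[OF refl])
    fix \<rho> assume \<rho>: "\<rho> \<in> perms p"
    have "(\<Prod>b<p. A ((\<rho> \<circ> \<pi>) b) (\<pi> b)) = (\<Prod>b<p. A (\<rho> b) b)"
      using prod_permute[OF assms, of "\<lambda>b. A (\<rho> b) b"] by simp
    then show "csign (\<rho> \<circ> \<pi>) * (\<Prod>b<p. A ((\<rho> \<circ> \<pi>) b) (\<pi> b)) = csign \<pi> * (csign \<rho> * (\<Prod>b<p. A (\<rho> b) b))"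
      using csign_comp[OF \<rho> assms] by simp
  qed
  finally show ?thesis by (simp add: det_fun_cols sum_distrib_left)
qed

lemma tuples_comp: "f \<in> tuples n p \<Longrightarrow> \<pi> \<in> perms p \<Longrightarrow> f \<circ> \<pi> \<in> tuples n p"
proof -
  assume f: "f \<in> tuples n p" and \<pi>: "\<pi> \<in> perms p"
  show ?thesis
  proof (rule PiE_I)
    fix x assume "x \<in> {0..<p}"
    then have "\<pi> x \<in> {0..<p}" using \<pi> permutes_in_image[of \<pi> "{0..<p}" x] by simp
    then show "(f \<circ> \<pi>) x \<in> {0..<n}" using PiE_mem[OF f] by simp
  next
    fix x assume x: "x \<notin> {0..<p}"
    then have "\<pi> x = x" using \<pi> by (simp add: permutes_def)
    then show "(f \<circ> \<pi>) x = undefined" using PiE_arb[OF f x] by simp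
  qed
qed

lemma tuples_sum_permute:
  assumes "\<pi> \<in> perms p"
  shows "(\<Sum>f\<in>tuples n p. h f) = (\<Sum>f\<in>tuples n p. h (f \<circ> \<pi>))"
proof (rule sum.reindex_bij_witness[of _ "\<lambda>f. f \<circ> \<pi>" "\<lambda>f. f \<circ> Hilbert_Choice.inv \<pi>"])
  have inv: "Hilbert_Choice.inv \<pi> \<in> perms p" using assms permutes_inv by blast
  have p: "\<pi> permutes {0..<p}" using assms by simp
  show "f \<circ> Hilbert_Choice.inv \<pi> \<circ> \<pi> = f" for f :: "nat \<Rightarrow> nat" using permutes_inv_o[OF p] by (simp add: o_assoc[symmetric])
  show "f \<circ> \<pi> \<circ> Hilbert_Choice.inv \<pi> = f" for f :: "nat \<Rightarrow> nat" using permutes_inv_o[OF p] by (simp add: o_assoc[symmetric])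
  then show "h (f \<circ> Hilbert_Choice.inv \<pi> \<circ> \<pi>) = h f" for f using permutes_inv_o[OF p] by (simp add: o_assoc[symmetric])
  show "f \<circ> \<pi> \<in> tuples n p" if "f \<in> tuples n p" for f by (rule tuples_comp[OF that assms])
  show "f \<circ> Hilbert_Choice.inv \<pi> \<in> tuples n p" if "f \<in> tuples n p" for f by (rule tuples_comp[OF that inv])
qed

text \<open>The transposition of two positions with equal entries fixes \<open>f\<close> but
  reverses the sign of \<open>c f\<close>.\<close>

lemma alternating_noninj:
  assumes c: "alternating n p c" and f: "f \<in> tuples n p" "\<not> inj_on f {0..<p}"
  shows "c f = 0"
proof -
  obtain i j where ij: "i < p" "j < p" "i \<noteq> j" "f i = f j" using f(2) by (auto simp: inj_on_def)
  have t: "Transposition.transpose i j \<in> perms p" using ij permutes_swap_id[of i "{0..<p}" j] by simp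
  have "f \<circ> Transposition.transpose i j = f" using ij by (auto simp: Transposition.transpose_def fun_eq_iff)
  then have "c f = csign (Transposition.transpose i j) * c f" using c f(1) t unfolding alternating_def by metis
  then show ?thesis using ij by (simp add: csign_transpose)
qed

lemma enum_tuple: "K \<in> multi_index n p \<Longrightarrow> enum K \<in> tuples n p"
proof -
  assume K: "K \<in> multi_index n p"
  then have fin: "finite K" and card: "card K = p" "K \<subseteq> {..<n}"
    by (auto simp: multi_index_def intro: finite_subset)
  have "sorted_list_of_set K ! a \<in> K" if "a < p" for a
    using that fin card nth_mem[of a "sorted_list_of_set K"] by simp
  then show ?thesis unfolding enum_def card(1) using card by fastforce
qed

lemma enum_bij:
  assumes "finite K" "card K = p"
  shows "bij_betw (enum K) {0..<p} K"
proof -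
  have "bij_betw (\<lambda>a. sorted_list_of_set K ! a) {0..<p} K"
    using bij_betw_nth[of "sorted_list_of_set K" "{0..<p}" K] assms by (simp add: atLeast0LessThan)
  then show ?thesis unfolding enum_def assms(2) using bij_betw_cong by (metis (mono_tags, lifting) restrict_apply')
qed

lemma multi_index_finite: "K \<in> multi_index n p \<Longrightarrow> finite K \<and> card K = p \<and> K \<subseteq> {..<n}"
  by (auto simp: multi_index_def intro: finite_subset)

lemma finite_multi_index: "finite (multi_index n p)"
  by (rule finite_subset[of _ "Pow {..<n}"]) (auto simp: multi_index_def)

text \<open>The image of an injective tuple recovers \<open>K\<close>, and comparison with the
  sorted enumeration recovers the permutation. This is the bridge between sums over tuples and sums
  over multi-indices.\<close>

lemma enum_perm_bij:
  "bij_betw (\<lambda>(K, \<pi>). enum K \<circ> \<pi>) (multi_index n p \<times> perms p) {f\<in>tuples n p. inj_on f {0..<p}}"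
  unfolding bij_betw_def
proof
  let ?h = "\<lambda>(K, \<pi>). enum K \<circ> \<pi>"
  have im: "(enum K \<circ> \<pi>) ` {0..<p} = K" if "K \<in> multi_index n p" "\<pi> \<in> perms p" for K \<pi>
  proof -
    have "(enum K \<circ> \<pi>) ` {0..<p} = enum K ` \<pi> ` {0..<p}" by (simp add: image_comp)
    then show ?thesis
      using that permutes_image[of \<pi> "{0..<p}"] enum_bij[of K p] multi_index_finite[OF that(1)]
      by (simp add: bij_betw_def)
  qed
  show "inj_on ?h (multi_index n p \<times> perms p)"
  proof (rule inj_onI)
    fix x y assume x: "x \<in> multi_index n p \<times> perms p" and y: "y \<in> multi_index n p \<times> perms p" and eq: "?h x = ?h y"
    obtain K \<pi> L \<rho> where xy: "x = (K, \<pi>)" "y = (L, \<rho>)" by (metis surj_pair)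
    have K: "K \<in> multi_index n p" "L \<in> multi_index n p" and \<pi>: "\<pi> \<in> perms p" "\<rho> \<in> perms p"
      using x y xy by auto
    have eq': "enum K \<circ> \<pi> = enum L \<circ> \<rho>" using eq xy by simp
    then have KL: "K = L" using im[OF K(1) \<pi>(1)] im[OF K(2) \<pi>(2)] by metis
    have inj: "inj_on (enum K) {0..<p}"
      using enum_bij multi_index_finite[OF K(1)] by (auto simp: bij_betw_def)
    have "\<pi> a = \<rho> a" for a
    proof (cases "a < p")
      case True
      then have "\<pi> a \<in> {0..<p}" "\<rho> a \<in> {0..<p}" using \<pi> permutes_in_image[of _ "{0..<p}" a] by auto
      moreover have "enum K (\<pi> a) = enum K (\<rho> a)" using eq' KL by (metis comp_apply)
      ultimately show ?thesis using inj by (auto simp: inj_on_def)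
    next
      case False
      then show ?thesis using \<pi> by (simp add: permutes_def)
    qed
    then show "x = y" using xy KL by auto
  qed
  show "?h ` (multi_index n p \<times> perms p) = {f\<in>tuples n p. inj_on f {0..<p}}"
  proof (intro equalityI subsetI)
    fix f assume "f \<in> ?h ` (multi_index n p \<times> perms p)"
    then obtain K \<pi> where K: "K \<in> multi_index n p" "\<pi> \<in> perms p" "f = enum K \<circ> \<pi>" by auto
    have "inj_on f {0..<p}"
      using K(3) im[OF K(1,2)] multi_index_finite[OF K(1)] by (intro eq_card_imp_inj_on) auto
    then show "f \<in> {f\<in>tuples n p. inj_on f {0..<p}}" using K tuples_comp[OF enum_tuple] by auto
  next
    fix f assume f: "f \<in> {f\<in>tuples n p. inj_on f {0..<p}}"
    let ?K = "f ` {0..<p}"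
    have K: "?K \<in> multi_index n p" using f by (auto simp: multi_index_def card_image)
    have b1: "bij_betw (enum ?K) {0..<p} ?K" using enum_bij multi_index_finite[OF K] by blast
    have b2: "bij_betw f {0..<p} ?K" using f by (auto simp: bij_betw_def)
    \<comment> \<open>\<open>permutes\<close> demands the identity outside
      \<open>{0..<p}\<close>.\<close>
    define \<pi> where "\<pi> a = (if a \<in> {0..<p} then inv_into {0..<p} (enum ?K) (f a) else a)" for a
    have "bij_betw (inv_into {0..<p} (enum ?K) \<circ> f) {0..<p} {0..<p}"
      using bij_betw_trans[OF b2 bij_betw_inv_into[OF b1]] .
    then have "bij_betw \<pi> {0..<p} {0..<p}"
      by (rule bij_betw_cong[THEN iffD1, rotated]) (simp add: \<pi>_def)
    then have \<pi>: "\<pi> permutes {0..<p}" by (rule bij_imp_permutes) (auto simp: \<pi>_def)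
    have "(enum ?K \<circ> \<pi>) a = f a" for a
    proof (cases "a \<in> {0..<p}")
      case True
      then have "f a \<in> enum ?K ` {0..<p}" using b1 by (auto simp: bij_betw_def)
      then show ?thesis using True by (simp add: \<pi>_def f_inv_into_f)
    next
      case False
      have "f \<in> tuples n p" using f by simp
      then have "f a = undefined" by (rule PiE_arb[OF _ False])
      moreover have "enum ?K a = undefined" by (rule PiE_arb[OF enum_tuple[OF K] False])
      moreover have "\<pi> a = a" using False by (simp only: \<pi>_def if_False)
      ultimately show ?thesis by simp
    qed
    then have "f = ?h (?K, \<pi>)" by auto
    then show "f \<in> ?h ` (multi_index n p \<times> perms p)" using K \<pi> by blast
  qed
qed

lemma finite_tuples: "finite (tuples n p)" by (simp add: finite_PiE)

text \<open>Tuples with a repeated entry contribute nothing. The others are grouped by their image,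
  and alternation turns the sum over rearrangements into Leibniz' formula for a determinant.\<close>

lemma sum_tuples_alternating:
  assumes c: "alternating n p c"
  shows "(\<Sum>f\<in>tuples n p. (\<Prod>b<p. B (f b) b) * c f) = (\<Sum>K\<in>multi_index n p. det_fun p (\<lambda>a b. B (enum K a) b) * c (enum K))"
proof -
  have "(\<Sum>f\<in>tuples n p. (\<Prod>b<p. B (f b) b) * c f) = (\<Sum>f\<in>{f\<in>tuples n p. inj_on f {0..<p}}. (\<Prod>b<p. B (f b) b) * c f)"
    by (rule sum.mono_neutral_right[OF finite_tuples]) (use alternating_noninj[OF c] in auto)
  also have "\<dots> = (\<Sum>(K, \<pi>)\<in>multi_index n p \<times> perms p. (\<Prod>b<p. B ((enum K \<circ> \<pi>) b) b) * c (enum K \<circ> \<pi>))"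
    using sum.reindex_bij_betw[OF enum_perm_bij, of "\<lambda>f. (\<Prod>b<p. B (f b) b) * c f" n p]
    by (simp add: case_prod_beta)
  also have "\<dots> = (\<Sum>K\<in>multi_index n p. \<Sum>\<pi>\<in>perms p. (\<Prod>b<p. B ((enum K \<circ> \<pi>) b) b) * c (enum K \<circ> \<pi>))"
    by (simp add: sum.cartesian_product)
  also have "\<dots> = (\<Sum>K\<in>multi_index n p. det_fun p (\<lambda>a b. B (enum K a) b) * c (enum K))"
    unfolding det_fun_cols sum_distrib_right
    using c enum_tuple unfolding alternating_def by (intro sum.cong refl) (simp add: mult_ac)
  finally show ?thesis .
qed

lemma alternating_zeroI:
  assumes c: "alternating n p c" and z: "\<And>K. K \<in> multi_index n p \<Longrightarrow> c (enum K) = 0" and f: "f \<in> tuples n p"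
  shows "c f = 0"
proof (cases "inj_on f {0..<p}")
  case True
  then have "f \<in> (\<lambda>(K, \<pi>). enum K \<circ> \<pi>) ` (multi_index n p \<times> perms p)"
    using f enum_perm_bij[of n p] by (auto simp: bij_betw_def)
  then obtain K \<pi> where K: "K \<in> multi_index n p" "\<pi> \<in> perms p" "f = enum K \<circ> \<pi>" by auto
  then have "c f = csign \<pi> * c (enum K)" using c enum_tuple unfolding alternating_def by blast
  then show ?thesis using z K by simp
qed (use alternating_noninj[OF c f] in simp)

text \<open>Expanding the product of sums gives a sum over tuples that choose one index per column;
  the determinant that remains alternates in the tuple, so the sum collapses to
  multi-indices.\<close>

lemma cauchy_binet:
  "det_fun p (\<lambda>a b. \<Sum>l<n. A a l * B l b) = (\<Sum>L\<in>multi_index n p. det_fun p (\<lambda>a b. A a (enum L b)) * det_fun p (\<lambda>a b. B (enum L a) b))"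
proof -
  have "det_fun p (\<lambda>a b. \<Sum>l<n. A a l * B l b)
      = (\<Sum>\<pi>\<in>perms p. csign \<pi> * (\<Prod>b\<in>{0..<p}. \<Sum>l\<in>{0..<n}. A (\<pi> b) l * B l b))"
    unfolding det_fun_cols by (simp add: atLeast0LessThan)
  also have "\<dots> = (\<Sum>\<pi>\<in>perms p. csign \<pi> * (\<Sum>f\<in>tuples n p. \<Prod>b\<in>{0..<p}. A (\<pi> b) (f b) * B (f b) b))"
    by (subst prod_sum_PiE) auto
  also have "\<dots> = (\<Sum>f\<in>tuples n p. (\<Prod>b<p. B (f b) b) * det_fun p (\<lambda>a b. A a (f b)))"
    unfolding det_fun_cols sum_distrib_left
    by (subst sum.swap) (simp add: prod.distrib atLeast0LessThan mult_ac)
  also have "\<dots> = (\<Sum>L\<in>multi_index n p. det_fun p (\<lambda>a b. B (enum L a) b) * det_fun p (\<lambda>a b. A a (enum L b)))"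
  proof (rule sum_tuples_alternating)
    show "alternating n p (\<lambda>f. det_fun p (\<lambda>a b. A a (f b)))"
      unfolding alternating_def using det_fun_cols_permute[of _ p "\<lambda>a b. A a (f b)" for f] by simp
  qed
  finally show ?thesis by (simp add: mult_ac)
qed

text \<open>
  The value of the alternating form \<open>\<Sum>\<^bsub>K\<^esub> w K dz\<^sub>K\<close> on the coordinate vectors with indices
  \<open>f 0, \<dots>, f (p - 1)\<close>.
\<close>

definition antisym_ext :: "nat \<Rightarrow> nat \<Rightarrow> (nat set \<Rightarrow> complex) \<Rightarrow> (nat \<Rightarrow> nat) \<Rightarrow> complex" where
  "antisym_ext n p w f = (\<Sum>K\<in>multi_index n p. det_fun p (\<lambda>a b. if enum K a = f b then 1 else 0) * w K)"

lemma alternating_antisym_ext: "alternating n p (antisym_ext n p w)"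
  unfolding alternating_def antisym_ext_def
proof (intro ballI)
  fix f \<pi> assume "f \<in> tuples n p" "\<pi> \<in> perms p"
  then show "(\<Sum>K\<in>multi_index n p. det_fun p (\<lambda>a b. if enum K a = (f \<circ> \<pi>) b then 1 else 0) * w K) =
       csign \<pi> * (\<Sum>K\<in>multi_index n p. det_fun p (\<lambda>a b. if enum K a = f b then 1 else 0) * w K)"
    using det_fun_cols_permute[of \<pi> p "\<lambda>a b. if enum _ a = f b then 1 else 0"]
    by (simp add: sum_distrib_left mult_ac)
qed

text \<open>A permutation with a nonzero product would write one tuple in two ways, and uniqueness
  in \<open>enum_perm_bij\<close> leaves only the identity with \<open>K = L\<close>.\<close>

lemma det_fun_enum_delta:
  assumes K: "K \<in> multi_index n p" and L: "L \<in> multi_index n p"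
  shows "det_fun p (\<lambda>a b. if enum K a = enum L b then 1 else 0) = (if K = L then 1 else 0)"
proof -
  have K': "finite K" "card K = p" "finite L" "card L = p" using multi_index_finite K L by auto
  have prodeq: "(\<Prod>b<p. if enum K (\<pi> b) = enum L b then 1 else (0::complex)) =
      (if K = L \<and> \<pi> = id then 1 else 0)" if \<pi>: "\<pi> \<in> perms p" for \<pi>
  proof (cases "\<forall>b<p. enum K (\<pi> b) = enum L b")
    case True
    have p: "(K, \<pi>) \<in> multi_index n p \<times> perms p" "(L, id) \<in> multi_index n p \<times> perms p"
      using K L \<pi> permutes_id by auto
    have "enum K \<circ> \<pi> = enum L \<circ> id"
    proof
      fix b show "(enum K \<circ> \<pi>) b = (enum L \<circ> id) b"
      proof (cases "b < p")
        case False
        have "\<pi> b = b" using \<pi> False by (simp add: permutes_def)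
        then show ?thesis using False K' by (simp add: enum_def)
      qed (use True in simp)
    qed
    then have "(K, \<pi>) = (L, id)"
      using inj_onD[OF bij_betw_imp_inj_on[OF enum_perm_bij] _ p] by simp
    then show ?thesis using True by auto
  next
    case False
    then have "(\<Prod>b<p. if enum K (\<pi> b) = enum L b then 1 else (0::complex)) = 0" by (intro prod_zero) auto
    then show ?thesis using False by auto
  qed
  have "det_fun p (\<lambda>a b. if enum K a = enum L b then 1 else 0) = (\<Sum>\<pi>\<in>perms p. csign \<pi> * (if K = L \<and> \<pi> = id then 1 else 0))"
    unfolding det_fun_cols using prodeq by (intro sum.cong refl) simp
  also have "\<dots> = (\<Sum>\<pi>\<in>perms p. if \<pi> = id then (if K = L then csign \<pi> else 0) else 0)"
    by (intro sum.cong refl) auto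
  also have "\<dots> = (if K = L then 1 else 0)"
    using finite_perms permutes_id by (subst sum.delta) (auto simp: csign_def)
  finally show ?thesis .
qed

lemma antisym_ext_enum:
  assumes "L \<in> multi_index n p"
  shows "antisym_ext n p w (enum L) = w L"
proof -
  have "antisym_ext n p w (enum L) = (\<Sum>K\<in>multi_index n p. if K = L then w K else 0)"
    unfolding antisym_ext_def using assms by (intro sum.cong refl) (simp add: det_fun_enum_delta)
  then show ?thesis using assms finite_multi_index by (simp add: sum.delta)
qed

section \<open>Removing one entry of a tuple\<close>

definition tail :: "nat \<Rightarrow> (nat \<Rightarrow> nat) \<Rightarrow> nat \<Rightarrow> nat" where
  "tail p f = restrict (\<lambda>a. f (Suc a)) {0..<p}"

text \<open>\<open>insert_index s\<close> is the increasing map that omits the value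
  \<open>s\<close>, so the remaining entries keep their order.\<close>

definition skip :: "nat \<Rightarrow> nat \<Rightarrow> (nat \<Rightarrow> nat) \<Rightarrow> nat \<Rightarrow> nat" where
  "skip p s f = restrict (\<lambda>a. f (insert_index s a)) {0..<p}"

lemma tail_tuple: "f \<in> tuples n (Suc p) \<Longrightarrow> tail p f \<in> tuples n p"
  unfolding tail_def using PiE_mem[of f "{0..<Suc p}" "\<lambda>_. {0..<n}"] by (intro PiE_I) auto

lemma skip_tuple: "f \<in> tuples n (Suc p) \<Longrightarrow> skip p s f \<in> tuples n p"
  unfolding skip_def insert_index_def using PiE_mem[of f "{0..<Suc p}" "\<lambda>_. {0..<n}"] by (intro PiE_I) auto

text \<open>The permutations of \<open>Suc p\<close> letters are sorted by the value \<open>s\<close> they take at \<open>0\<close>.\<close>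

lemma sum_perms_Suc:
  assumes c: "\<And>x. x < n \<Longrightarrow> alternating n p (B x)" and f: "f \<in> tuples n (Suc p)"
  shows "(\<Sum>\<sigma>\<in>perms (Suc p). csign \<sigma> * B (f (\<sigma> 0)) (tail p (f \<circ> \<sigma>)))
     = of_nat (fact p) * (\<Sum>s<Suc p. (-1) ^ s * B (f s) (skip p s f))"
proof -
  have part: "perms (Suc p) = (\<Union>s\<in>{..<Suc p}. {\<sigma>. \<sigma> permutes {0..<Suc p} \<and> \<sigma> 0 = s})"
  proof (intro equalityI subsetI)
    fix \<sigma> assume "\<sigma> \<in> perms (Suc p)"
    then have "\<sigma> 0 < Suc p" using permutes_in_image[of \<sigma> "{0..<Suc p}" 0] by auto
    then show "\<sigma> \<in> (\<Union>s\<in>{..<Suc p}. {\<sigma>. \<sigma> permutes {0..<Suc p} \<and> \<sigma> 0 = s})"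
      using \<open>\<sigma> \<in> perms (Suc p)\<close> by blast
  qed auto
  have fin: "finite {\<sigma>. \<sigma> permutes {0..<Suc p} \<and> \<sigma> 0 = s}" for s
    by (rule finite_subset[OF _ finite_perms[of "Suc p"]]) auto
  have "(\<Sum>\<sigma>\<in>perms (Suc p). csign \<sigma> * B (f (\<sigma> 0)) (tail p (f \<circ> \<sigma>))) =
     (\<Sum>s<Suc p. \<Sum>\<sigma>\<in>{\<sigma>. \<sigma> permutes {0..<Suc p} \<and> \<sigma> 0 = s}. csign \<sigma> * B (f (\<sigma> 0)) (tail p (f \<circ> \<sigma>)))"
    unfolding part by (rule sum.UNION_disjoint) (use fin in auto)
  also have "\<dots> = (\<Sum>s<Suc p. of_nat (fact p) * ((-1) ^ s * B (f s) (skip p s f)))"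
  proof (rule sum.cong[OF refl])
    fix s assume s: "s \<in> {..<Suc p}"
    \<comment> \<open>A permutation that takes 0 to \<open>s\<close> is
      \<open>permutation_insert 0 s \<rho>\<close> for exactly one permutation \<rho> of
      \<open>p\<close> letters.\<close>
    have "(\<Sum>\<sigma>\<in>{\<sigma>. \<sigma> permutes {0..<Suc p} \<and> \<sigma> 0 = s}. csign \<sigma> * B (f (\<sigma> 0)) (tail p (f \<circ> \<sigma>)))
       = (\<Sum>\<rho>\<in>perms p. csign (permutation_insert 0 s \<rho>) * B (f s) (tail p (f \<circ> permutation_insert 0 s \<rho>)))"
      unfolding permutation_fix[of 0 p s, OF zero_less_Suc, OF s[unfolded lessThan_iff]]
      by (subst sum.reindex) (use permutation_insert_inj_on[of 0 p s] s in auto)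
    also have "\<dots> = (\<Sum>\<rho>\<in>perms p. (-1) ^ s * B (f s) (skip p s f))"
    proof (rule sum.cong[OF refl])
      fix \<rho> assume \<rho>: "\<rho> \<in> perms p"
      have "tail p (f \<circ> permutation_insert 0 s \<rho>) = skip p s f \<circ> \<rho>"
      proof
        fix a show "tail p (f \<circ> permutation_insert 0 s \<rho>) a = (skip p s f \<circ> \<rho>) a"
        proof (cases "a < p")
          case True
          then have "\<rho> a < p" using \<rho> permutes_in_image[of \<rho> "{0..<p}" a] by auto
          then show ?thesis using True by (simp add: tail_def skip_def permutation_insert_expand insert_index_def)
        next
          case False
          then have "\<rho> a = a" using \<rho> by (simp add: permutes_def)
          then show ?thesis using False by (simp add: tail_def skip_def)
        qed
      qed
      \<comment> \<open>The sign of \<rho> arises once from alternation and once from the inserted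
        permutation, so it cancels, and all \<open>p!\<close> permutations \<rho> contribute the
        same term.\<close>
      then have "B (f s) (tail p (f \<circ> permutation_insert 0 s \<rho>)) = csign \<rho> * B (f s) (skip p s f)"
        using c[of "f s"] skip_tuple[OF f] \<rho> PiE_mem[OF f, of s] s unfolding alternating_def by simp
      moreover have "csign (permutation_insert 0 s \<rho>) = (-1) ^ s * csign \<rho>"
        using signof_permutation_insert[of \<rho> p 0 s, where ?'a = complex] \<rho> s by (simp add: csign_def)
      ultimately show "csign (permutation_insert 0 s \<rho>) * B (f s) (tail p (f \<circ> permutation_insert 0 s \<rho>))
         = (-1) ^ s * B (f s) (skip p s f)"
        using csign_square[of \<rho>] by (simp add: mult_ac)
    qed
    also have "\<dots> = of_nat (fact p) * ((-1) ^ s * B (f s) (skip p s f))"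
      using card_permutations[of "{0..<p}" p] by simp
    finally show "(\<Sum>\<sigma>\<in>{\<sigma>. \<sigma> permutes {0..<Suc p} \<and> \<sigma> 0 = s}. csign \<sigma> * B (f (\<sigma> 0)) (tail p (f \<circ> \<sigma>)))
       = of_nat (fact p) * ((-1) ^ s * B (f s) (skip p s f))" .
  qed
  finally show ?thesis by (simp only: sum_distrib_left)
qed

lemma enum_strict_mono:
  assumes "finite K" "a < b" "b < card K"
  shows "enum K a < enum K b"
  using assms strict_sorted_list_of_set[of K] sorted_wrt_nth_less[of "(<)" "sorted_list_of_set K" a b]
  by (simp add: enum_def)

lemma enum_unique:
  assumes "finite K" "card K = p" "f ` {0..<p} = K" "\<And>a b. a < b \<Longrightarrow> b < p \<Longrightarrow> f a < f b" "f \<in> extensional {0..<p}"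
  shows "enum K = f"
proof
  fix x
  let ?xs = "map f [0..<p]"
  have "sorted_wrt (<) ?xs" using assms(4) by (auto simp: sorted_wrt_iff_nth_less)
  moreover have "set ?xs = K" using assms(3) by simp
  ultimately have "sorted_list_of_set K = ?xs"
    using sorted_list_of_set.idem_if_sorted_distinct strict_sorted_equal[of "sorted_list_of_set K" ?xs] assms(1)
    by (simp add: strict_sorted_list_of_set)
  then show "enum K x = f x" using assms(2,5) by (auto simp: enum_def extensional_def)
qed

text \<open>Since the enumeration increases, the elements below the \<open>s\<close>-th one are
  exactly its first \<open>s\<close> entries. This translates deletion from an index set, with its
  sign, into \<open>skip\<close> on tuples.\<close>

lemma enum_remove:
  assumes I: "I \<in> multi_index n (Suc p)" and s: "s < Suc p"
  shows "enum (I - {enum I s}) = skip p s (enum I)" "index_sign I (enum I s) = (-1) ^ s"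
    "I - {enum I s} \<in> multi_index n p"
proof -
  have fin: "finite I" "card I = Suc p" "I \<subseteq> {..<n}" using multi_index_finite[OF I] by auto
  have bij: "bij_betw (enum I) {0..<Suc p} I" by (rule enum_bij[OF fin(1,2)])
  have sI: "enum I s \<in> I" using bij s by (auto simp: bij_betw_def)
  have mono: "enum I a < enum I b" if "a < b" "b < Suc p" for a b
    using enum_strict_mono[OF fin(1) that(1)] that(2) fin(2) by simp
  have insim: "insert_index s ` {0..<p} = {0..<Suc p} - {s}"
    using insert_index_image[of s p] s by auto
  show "enum (I - {enum I s}) = skip p s (enum I)"
  proof (rule enum_unique)
    show "finite (I - {enum I s})" using fin by simp
    show "card (I - {enum I s}) = p" using fin sI by simp
    have "skip p s (enum I) ` {0..<p} = enum I ` (insert_index s ` {0..<p})"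
      by (auto simp: skip_def)
    also have "\<dots> = I - {enum I s}"
      unfolding insim using bij s by (subst inj_on_image_set_diff[of _ "{0..<Suc p}"]) (auto simp: bij_betw_def)
    finally show "skip p s (enum I) ` {0..<p} = I - {enum I s}" .
    show "skip p s (enum I) a < skip p s (enum I) b" if "a < b" "b < p" for a b
      using that by (auto simp: skip_def insert_index_def intro!: mono)
  qed (simp add: skip_def)
  have "{i\<in>I. i < enum I s} = enum I ` {0..<s}"
  proof (intro equalityI subsetI)
    fix i assume i: "i \<in> {i\<in>I. i < enum I s}"
    then have "i \<in> enum I ` {0..<Suc p}" using bij by (simp add: bij_betw_def)
    then obtain a where a: "a < Suc p" "i = enum I a" by auto
    then have "a < s" using i mono[of s a] by (cases a s rule: linorder_cases) auto
    then show "i \<in> enum I ` {0..<s}" using a by auto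
  qed (use bij s mono in \<open>auto simp: bij_betw_def\<close>)
  moreover have "inj_on (enum I) {0..<s}"
    by (rule inj_on_subset[of _ "{0..<Suc p}"]) (use bij s in \<open>auto simp: bij_betw_def\<close>)
  ultimately show "index_sign I (enum I s) = (-1) ^ s" by (simp add: index_sign_def card_image)
  show "I - {enum I s} \<in> multi_index n p" using fin sI by (auto simp: multi_index_def)
qed

lemma sum_enum:
  assumes "I \<in> multi_index n q"
  shows "(\<Sum>k\<in>I. h k) = (\<Sum>s<q. h (enum I s))"
  using sum.reindex_bij_betw[OF enum_bij, of I q h] multi_index_finite[OF assms] by (simp add: atLeast0LessThan)

lemma jacobian_minor_det_fun:
  assumes "card K = p" "card I = p"
  shows "jacobian_minor F z K I = det_fun p (\<lambda>a b. partial_deriv (enum I b) (\<lambda>z. F z (enum K a)) z)"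
  unfolding jacobian_minor_def det_fun_def assms Let_def
  by (intro arg_cong[of _ _ Determinant.det] eq_matI) (auto simp: enum_def assms partial_deriv_def)

section \<open>Pullback of holomorphic forms\<close>

text \<open>The increment of \<open>f\<close> in direction \<open>j\<close> is an integral of
  \<open>partial_deriv j f\<close>. Differentiating it in direction \<open>i\<close> under the
  integral and letting the increment shrink gives the mixed derivative in the other order.\<close>

lemma partial_deriv_commute:
  assumes f: "hol_fun n W f" and W: "open_cspace n W" and z: "z \<in> W" and i: "i < n" and j: "j < n"
  shows "partial_deriv i (partial_deriv j f) z = partial_deriv j (partial_deriv i f) z"
proof (cases "i = j")
  case False
  obtain e where e: "e > 0" "polydisc n z (\<lambda>_. e) \<subseteq> W" using open_cspace_polydisc[OF W z] by blast
  let ?P = "polydisc n z (\<lambda>_. e)" and ?a = "z j"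
  let ?Bi = "ball (z i) e" and ?Bj = "ball (z j) e"
  have zc: "z \<in> cspace n" using z open_cspace_subset[OF W] by auto
  have yP: "z(i := x, j := b) \<in> W" if "x \<in> ?Bi" "b \<in> ?Bj" for x b
  proof -
    have "z(i := x, j := b) \<in> ?P"
      using that zc i j e(1) False by (auto simp: polydisc_def cspace_upd dist_norm norm_minus_commute)
    then show ?thesis using e(2) by blast
  qed
  have ab: "?a + of_real t * (b - ?a) \<in> ?Bj" if "b \<in> ?Bj" "t \<in> {0..1}" for b and t :: real
  proof -
    have "cmod (of_real t * (b - ?a)) \<le> cmod (b - ?a)"
      using that(2) by (simp add: norm_mult mult_left_le_one_le)
    then show ?thesis using that(1) by (simp add: dist_norm norm_minus_commute)
  qed
  have D: "hol_fun n W (partial_deriv j f)" and Di: "hol_fun n W (partial_deriv i f)" using hol_fun_partial_deriv[OF f W] i j by auto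
  have DD: "hol_fun n W (partial_deriv i (partial_deriv j f))" by (rule hol_fun_partial_deriv[OF D W i])
  \<comment> \<open>The maps \<open>h\<close> and \<open>k\<close> allow the \<open>i\<close>-th
    entry or the endpoint of the segment to vary, or both to stay fixed.\<close>
  have cont: "continuous_on (A \<times> {0..1}) (\<lambda>(q, t). u (z(i := h q, j := ?a + of_real t * (k q - ?a))))"
    if u: "hol_fun n W u" and hk: "continuous_on A h" "continuous_on A k" "h ` A \<subseteq> ?Bi" "k ` A \<subseteq> ?Bj"
    for u and A :: "complex set" and h k
  proof -
    have "continuous_on (A \<times> {0..1::real}) (\<lambda>q. h (fst q))" "continuous_on (A \<times> {0..1::real}) (\<lambda>q. k (fst q))"
      using continuous_on_compose2[OF hk(1), of "A \<times> {0..1::real}" fst]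
        continuous_on_compose2[OF hk(2), of "A \<times> {0..1::real}" fst]
      by (auto simp: continuous_on_fst continuous_on_id)
    then have c1: "continuous_on (A \<times> {0..1}) (\<lambda>q. z(i := h (fst q), j := ?a + of_real (snd q) * (k (fst q) - ?a)))"
      by (intro continuous_on_fun_upd continuous_intros)
    have inW: "z(i := h (fst q), j := ?a + of_real (snd q) * (k (fst q) - ?a)) \<in> W" if "q \<in> A \<times> {0..1}" for q
    proof (intro yP ab)
      have "fst q \<in> A" "snd q \<in> {0..1}" using that by auto
      then show "h (fst q) \<in> ?Bi" "k (fst q) \<in> ?Bj" "snd q \<in> {0..1}" using hk(3,4) by blast+
    qed
    have cu: "continuous_on W u" using u by (simp add: hol_fun_def)
    have "continuous_on (A \<times> {0..1}) (\<lambda>q. u (z(i := h (fst q), j := ?a + of_real (snd q) * (k (fst q) - ?a))))"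
      by (rule continuous_on_compose2[OF cu c1]) (rule image_subsetI, rule inW)
    then show ?thesis by (simp add: case_prod_beta)
  qed
  \<comment> \<open>The mean of the mixed derivative over the segment from \<open>z j\<close> to
    \<open>b\<close>; at \<open>b = z j\<close> it is the mixed derivative at
    \<open>z\<close>.\<close>
  define R where "R b = integral {0..1} (\<lambda>t. partial_deriv i (partial_deriv j f) (z(j := ?a + of_real t * (b - ?a))))" for b
  have eq: "partial_deriv i f (z(j := b)) - partial_deriv i f z = (b - ?a) * R b" if b: "b \<in> ?Bj" for b
  proof -
    define L where "L x = (b - ?a) * integral (cbox 0 1) (\<lambda>t. partial_deriv j f (z(i := x, j := ?a + of_real t * (b - ?a))))" for x
    have L: "f (z(i := x, j := b)) - f (z(i := x, j := ?a)) = L x" if x: "x \<in> ?Bi" for x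
    proof -
      have "((\<lambda>t. partial_deriv j f (z(i := x, j := ?a + of_real t * (b - ?a))) * (b - ?a)) has_integral
        f (z(i := x, j := ?a + of_real 1 * (b - ?a))) - f (z(i := x, j := ?a + of_real 0 * (b - ?a)))) {0..1}"
      proof (rule fundamental_theorem_of_calculus)
        fix t :: real assume t: "t \<in> {0..1}"
        have "((\<lambda>w. f (z(i := x, j := w))) has_field_derivative partial_deriv j f (z(i := x, j := ?a + of_real t * (b - ?a))))
            (at (?a + of_real t * (b - ?a)))"
          by (rule hol_fun_has_partial_deriv'[OF f yP[OF x ab[OF b t]] j])
        then have "((\<lambda>s. f (z(i := x, j := ?a + s * (b - ?a)))) has_field_derivative
            partial_deriv j f (z(i := x, j := ?a + of_real t * (b - ?a))) * (b - ?a)) (at (of_real t))"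
          by (rule DERIV_chain2) (auto intro!: derivative_eq_intros)
        then show "((\<lambda>t. f (z(i := x, j := ?a + of_real t * (b - ?a)))) has_vector_derivative
            partial_deriv j f (z(i := x, j := ?a + of_real t * (b - ?a))) * (b - ?a)) (at t within {0..1})"
          by (rule has_vector_derivative_real_field)
      qed simp
      then have "integral {0..1} (\<lambda>t. partial_deriv j f (z(i := x, j := ?a + of_real t * (b - ?a))) * (b - ?a)) =
          f (z(i := x, j := b)) - f (z(i := x, j := ?a))"
        by (intro integral_unique) simp
      then show ?thesis by (simp add: L_def mult.commute)
    qed
    have "(L has_field_derivative (b - ?a) * integral (cbox 0 1) (\<lambda>t. partial_deriv i (partial_deriv j f) (z(i := z i, j := ?a + of_real t * (b - ?a)))))
        (at (z i) within ?Bi)"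
      unfolding L_def
    proof (intro DERIV_cmult leibniz_rule_field_derivative)
      show "((\<lambda>x. partial_deriv j f (z(i := x, j := ?a + of_real t * (b - ?a)))) has_field_derivative
          partial_deriv i (partial_deriv j f) (z(i := x, j := ?a + of_real t * (b - ?a)))) (at x within ?Bi)"
        if "x \<in> ?Bi" "t \<in> cbox 0 1" for x t
        using hol_fun_has_partial_deriv'[OF D, of "z(j := ?a + of_real t * (b - ?a))" i x] that i b
          yP[of x "?a + of_real t * (b - ?a)"] ab False
        by (auto simp: fun_upd_twist has_field_derivative_at_within simp del: mem_ball)
      show "(\<lambda>t. partial_deriv j f (z(i := x, j := ?a + of_real t * (b - ?a)))) integrable_on cbox 0 1"
        if "x \<in> ?Bi" for x
      proof (rule integrable_continuous)
        have "continuous_on ({0::complex} \<times> {0..1}) (\<lambda>(q, t). partial_deriv j f (z(i := x, j := ?a + of_real t * (b - ?a))))"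
          by (rule cont[OF D, of "{0}" "\<lambda>_. x" "\<lambda>_. b"]) (use that b in \<open>auto simp del: mem_ball\<close>)
        from continuous_on_compose2[OF this continuous_on_Pair[OF continuous_on_const continuous_on_id], of 0 "{0..1}"]
        show "continuous_on (cbox 0 1) (\<lambda>t. partial_deriv j f (z(i := x, j := ?a + of_real t * (b - ?a))))" by auto
      qed
      show "continuous_on (?Bi \<times> cbox 0 1) (\<lambda>(x, t). partial_deriv i (partial_deriv j f) (z(i := x, j := ?a + of_real t * (b - ?a))))"
        unfolding cbox_interval
        by (rule cont[OF DD, of ?Bi "\<lambda>x. x" "\<lambda>_. b"]) (use b in \<open>auto simp: continuous_on_const continuous_on_id simp del: mem_ball\<close>)
    qed (use e(1) in auto)
    then have "(L has_field_derivative (b - ?a) * R b) (at (z i) within ?Bi)"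
      unfolding R_def cbox_interval fun_upd_triv .
    moreover have "at (z i) within ?Bi = at (z i)" by (rule at_within_open) (use e(1) in auto)
    ultimately have "(L has_field_derivative (b - ?a) * R b) (at (z i))" by (simp only:)
    then have d1: "((\<lambda>x. f (z(i := x, j := b)) - f (z(i := x, j := ?a))) has_field_derivative (b - ?a) * R b) (at (z i))"
      by (rule has_field_derivative_transform_within_open[of _ _ _ ?Bi]) (use e(1) in \<open>simp_all only: open_ball centre_in_ball L\<close>)
    have e1: "((\<lambda>x. f (z(i := x, j := c))) has_field_derivative partial_deriv i f (z(j := c))) (at (z i))"
      if "c \<in> ?Bj" for c
    proof -
      have "z(j := c) \<in> W" using yP[of "z i" c] that e(1) by simp
      moreover have "(z(j := c)) i = z i" using False by simp
      ultimately show ?thesis using hol_fun_has_partial_deriv[OF f, of "z(j := c)" i] i by (simp only: fun_upd_twist[OF False])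
    qed
    have "((\<lambda>x. f (z(i := x, j := b)) - f (z(i := x, j := ?a))) has_field_derivative
        partial_deriv i f (z(j := b)) - partial_deriv i f (z(j := ?a))) (at (z i))"
      by (rule DERIV_diff[OF e1 e1]) (use b e(1) in auto)
    then show ?thesis using DERIV_unique[OF d1] by simp
  qed
  have "continuous_on ?Bj R"
    unfolding R_def cbox_interval[symmetric]
  proof (rule integral_continuous_on_param)
    have "continuous_on (?Bj \<times> {0..1}) (\<lambda>(b, t). partial_deriv i (partial_deriv j f) (z(i := z i, j := ?a + of_real t * (b - ?a))))"
      by (rule cont[OF DD, of ?Bj "\<lambda>_. z i" "\<lambda>b. b"]) (use e(1) in auto)
    then show "continuous_on (?Bj \<times> cbox 0 1) (\<lambda>(b, t). partial_deriv i (partial_deriv j f) (z(j := ?a + of_real t * (b - ?a))))"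
      unfolding cbox_interval fun_upd_triv .
  qed
  then have "isCont R ?a" using e(1) by (simp add: continuous_on_eq_continuous_at)
  \<comment> \<open>In Caratheodory's form, continuity of \<open>R\<close> at the point is
    differentiability of the product.\<close>
  then have "((\<lambda>b. (b - ?a) * R b) has_field_derivative R ?a) (at ?a)"
    unfolding CARAT_DERIV by (intro exI[of _ R]) simp
  from DERIV_add[OF this DERIV_const[of "partial_deriv i f z"]]
  have "((\<lambda>b. (b - ?a) * R b + partial_deriv i f z) has_field_derivative R ?a) (at ?a)" by simp
  then have "((\<lambda>b. partial_deriv i f (z(j := b))) has_field_derivative R ?a) (at ?a)"
    by (rule has_field_derivative_transform_within_open[of _ _ _ ?Bj]) (use eq e(1) in \<open>auto simp: algebra_simps\<close>)
  then have "partial_deriv j (partial_deriv i f) z = R ?a" by (rule DERIV_unique[OF hol_fun_has_partial_deriv[OF Di z j]])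
  also have "R ?a = partial_deriv i (partial_deriv j f) z" by (simp add: R_def)
  finally show ?thesis by simp
qed simp

definition pullback :: "nat \<Rightarrow> nat \<Rightarrow> (cvec \<Rightarrow> cvec) \<Rightarrow> (cvec \<Rightarrow> nat set \<Rightarrow> complex) \<Rightarrow> cvec \<Rightarrow> nat set \<Rightarrow> complex" where
  "pullback n p F w z I = (\<Sum>K\<in>multi_index n p. jacobian_minor F z K I * w (F z) K)"

text \<open>The coefficients of the exterior derivative of a holomorphic form, with the sign
  convention of \<open>del\<close>.\<close>

definition ext_deriv :: "(cvec \<Rightarrow> nat set \<Rightarrow> complex) \<Rightarrow> cvec \<Rightarrow> nat set \<Rightarrow> complex" where
  "ext_deriv w z I = (\<Sum>k\<in>I. index_sign I k * partial_deriv k (\<lambda>y. w y (I - {k})) z)"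

definition hol_map :: "nat \<Rightarrow> cvec set \<Rightarrow> cvec set \<Rightarrow> (cvec \<Rightarrow> cvec) \<Rightarrow> bool" where
  "hol_map n V W F \<longleftrightarrow> open_cspace n V \<and> open_cspace n W \<and> (\<forall>i<n. hol_fun n V (\<lambda>z. F z i)) \<and> (\<forall>z\<in>V. F z \<in> W)"

lemma det_fun_cong: "(\<And>a b. a < p \<Longrightarrow> b < p \<Longrightarrow> A a b = B a b) \<Longrightarrow> det_fun p A = det_fun p B"
  unfolding det_fun_def by (intro arg_cong[of _ _ Determinant.det] eq_matI) auto

lemma enum_less: "K \<in> multi_index n p \<Longrightarrow> a < p \<Longrightarrow> enum K a < n"
  using PiE_mem[OF enum_tuple, of K n p a] by simp

lemma jacobian_minor_multi_index:
  "K \<in> multi_index n p \<Longrightarrow> I \<in> multi_index n p \<Longrightarrow>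
    jacobian_minor F z K I = det_fun p (\<lambda>a b. partial_deriv (enum I b) (\<lambda>z. F z (enum K a)) z)"
  by (rule jacobian_minor_det_fun) (auto simp: multi_index_def)

text \<open>By the chain rule the Jacobian matrix of a composite is a product of matrices, and
  Cauchy-Binet computes the minors of a product.\<close>

lemma jacobian_minor_compose:
  assumes F: "hol_map n V W F" and G: "\<And>i. i < n \<Longrightarrow> hol_fun n W (\<lambda>z. G z i)" and z: "z \<in> V"
    and K: "K \<in> multi_index n p" and I: "I \<in> multi_index n p"
  shows "jacobian_minor (\<lambda>z. G (F z)) z K I =
    (\<Sum>L\<in>multi_index n p. jacobian_minor G (F z) K L * jacobian_minor F z L I)"
proof -
  have "jacobian_minor (\<lambda>z. G (F z)) z K I =
      det_fun p (\<lambda>a b. \<Sum>l<n. partial_deriv l (\<lambda>y. G y (enum K a)) (F z) * partial_deriv (enum I b) (\<lambda>z. F z l) z)"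
    unfolding jacobian_minor_multi_index[OF K I]
  proof (rule det_fun_cong)
    fix a b assume "a < p" "b < p"
    then show "partial_deriv (enum I b) (\<lambda>z. G (F z) (enum K a)) z =
        (\<Sum>l<n. partial_deriv l (\<lambda>y. G y (enum K a)) (F z) * partial_deriv (enum I b) (\<lambda>z. F z l) z)"
      using F z G enum_less[OF K] enum_less[OF I]
      by (intro partial_deriv_compose[of n W "\<lambda>y. G y (enum K a)" n V F z "enum I b"]) (auto simp: hol_map_def)
  qed
  also have "\<dots> = (\<Sum>L\<in>multi_index n p. det_fun p (\<lambda>a b. partial_deriv (enum L b) (\<lambda>y. G y (enum K a)) (F z)) *
      det_fun p (\<lambda>a b. partial_deriv (enum I b) (\<lambda>z. F z (enum L a)) z))"
    by (rule cauchy_binet)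
  also have "\<dots> = (\<Sum>L\<in>multi_index n p. jacobian_minor G (F z) K L * jacobian_minor F z L I)"
    using K I by (intro sum.cong refl) (simp add: jacobian_minor_multi_index)
  finally show ?thesis .
qed

lemma pullback_compose:
  assumes F: "hol_map n V W F" and G: "\<And>i. i < n \<Longrightarrow> hol_fun n W (\<lambda>z. G z i)" and z: "z \<in> V"
    and I: "I \<in> multi_index n p"
  shows "pullback n p F (pullback n p G w) z I = pullback n p (\<lambda>z. G (F z)) w z I"
proof -
  have "pullback n p F (pullback n p G w) z I = (\<Sum>L\<in>multi_index n p. \<Sum>K\<in>multi_index n p.
      jacobian_minor G (F z) K L * jacobian_minor F z L I * w (G (F z)) K)"
    by (simp add: pullback_def sum_distrib_left mult_ac)
  also have "\<dots> = (\<Sum>K\<in>multi_index n p. \<Sum>L\<in>multi_index n p.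
      jacobian_minor G (F z) K L * jacobian_minor F z L I * w (G (F z)) K)"
    by (rule sum.swap)
  also have "\<dots> = pullback n p (\<lambda>z. G (F z)) w z I"
    unfolding pullback_def using jacobian_minor_compose[OF F G z _ I]
    by (intro sum.cong refl) (simp add: sum_distrib_right)
  finally show ?thesis .
qed

text \<open>The minors see the germ of the map, while the coefficients enter only at the image
  point; hence agreement on an open set for \<open>F\<close> but at a single point for
  \<open>w\<close>.\<close>

lemma pullback_cong:
  assumes V: "open_cspace n V" and z: "z \<in> V" and F: "\<And>y. y \<in> V \<Longrightarrow> F y = F' y"
    and w: "\<And>K. K \<in> multi_index n p \<Longrightarrow> w (F z) K = w' (F z) K" and I: "I \<in> multi_index n p"
  shows "pullback n p F w z I = pullback n p F' w' z I"
  unfolding pullback_def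
proof (rule sum.cong[OF refl])
  fix K assume K: "K \<in> multi_index n p"
  have "jacobian_minor F z K I = jacobian_minor F' z K I"
    unfolding jacobian_minor_multi_index[OF K I]
    by (intro det_fun_cong partial_deriv_cong[OF V z]) (use enum_less[OF I] F in auto)
  then show "jacobian_minor F z K I * w (F z) K = jacobian_minor F' z K I * w' (F' z) K"
    using w[OF K] F[OF z] by simp
qed

lemma partial_deriv_coord: "partial_deriv j (\<lambda>z. z k) z = (if k = j then 1 else 0)"
  unfolding partial_deriv_def by (cases "k = j") auto

lemma pullback_id:
  assumes I: "I \<in> multi_index n p"
  shows "pullback n p (\<lambda>z. z) w z I = w z I"
proof -
  have "jacobian_minor (\<lambda>z. z) z K I = (if K = I then 1 else 0)" if "K \<in> multi_index n p" for K
    unfolding jacobian_minor_multi_index[OF that I] partial_deriv_coord by (rule det_fun_enum_delta[OF that I])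
  then have "pullback n p (\<lambda>z. z) w z I = (\<Sum>K\<in>multi_index n p. if K = I then w z K else 0)"
    unfolding pullback_def by (intro sum.cong refl) simp
  then show ?thesis using I finite_multi_index by (simp add: sum.delta)
qed

lemma hol_fun_pullback:
  assumes F: "hol_map n V W F" and w: "\<And>K. K \<in> multi_index n p \<Longrightarrow> hol_fun n W (\<lambda>y. w y K)"
    and I: "I \<in> multi_index n p"
  shows "hol_fun n V (\<lambda>z. pullback n p F w z I)"
  unfolding pullback_def
proof (intro hol_fun_sum hol_fun_mult)
  fix K assume K: "K \<in> multi_index n p"
  have V: "open_cspace n V" and W: "open_cspace n W" using F by (auto simp: hol_map_def)
  have minor: "jacobian_minor F z K I = (\<Sum>\<pi>\<in>perms p. csign \<pi> * (\<Prod>b<p. partial_deriv (enum I b) (\<lambda>z. F z (enum K (\<pi> b))) z))" for z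
    unfolding jacobian_minor_multi_index[OF K I] det_fun_cols ..
  show "hol_fun n V (\<lambda>z. jacobian_minor F z K I)"
    unfolding minor
  proof (intro hol_fun_sum hol_fun_mult hol_fun_const hol_fun_prod)
    fix \<pi> b assume "\<pi> \<in> perms p" "b \<in> {..<p}"
    then have "\<pi> b < p" using permutes_in_image[of \<pi> "{0..<p}" b] by auto
    then show "hol_fun n V (partial_deriv (enum I b) (\<lambda>z. F z (enum K (\<pi> b))))"
      using F enum_less[OF K] enum_less[OF I] \<open>b \<in> {..<p}\<close> V by (intro hol_fun_partial_deriv) (auto simp: hol_map_def)
  qed
  show "hol_fun n V (\<lambda>z. w (F z) K)"
    using F hol_fun_compose[OF w[OF K] W V, of F] by (auto simp: hol_map_def)
qed

lemma sum_tuples_Suc: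
  "(\<Sum>k\<in>tuples n (Suc p). h (k 0) (tail p k)) = (\<Sum>f\<in>tuples n p. \<Sum>l<n. h l f)"
proof -
  define c where "c l f = restrict (\<lambda>a. case a of 0 \<Rightarrow> l | Suc b \<Rightarrow> f b) {0..<Suc p}" for l and f :: "nat \<Rightarrow> nat"
  have "(\<Sum>k\<in>tuples n (Suc p). h (k 0) (tail p k)) = (\<Sum>(f, l)\<in>tuples n p \<times> {..<n}. h l f)"
  proof (rule sum.reindex_bij_witness[of _ "\<lambda>(f, l). c l f" "\<lambda>k. (tail p k, k 0)"])
    fix k assume k: "k \<in> tuples n (Suc p)"
    show "(tail p k, k 0) \<in> tuples n p \<times> {..<n}"
      using tail_tuple[OF k] PiE_mem[OF k, of 0] by simp
    show "(\<lambda>(f, l). c l f) (tail p k, k 0) = k"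
    proof
      fix a show "(\<lambda>(f, l). c l f) (tail p k, k 0) a = k a"
        using PiE_arb[OF k, of a] by (cases a) (auto simp: c_def tail_def)
    qed
    show "(case (tail p k, k 0) of (f, l) \<Rightarrow> h l f) = h (k 0) (tail p k)" by simp
  next
    fix q assume q: "q \<in> tuples n p \<times> {..<n}"
    obtain f l where fl: "q = (f, l)" "f \<in> tuples n p" "l < n" using q by auto
    show "(\<lambda>(f, l). c l f) q \<in> tuples n (Suc p)"
      unfolding fl prod.case
    proof (rule PiE_I)
      fix x assume "x \<in> {0..<Suc p}"
      then show "c l f x \<in> {0..<n}" using fl(3) PiE_mem[OF fl(2)] by (cases x) (auto simp: c_def)
    qed (simp add: c_def)
    have "tail p (c l f) = f"
    proof
      fix a show "tail p (c l f) a = f a"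
        using PiE_arb[OF fl(2), of a] by (auto simp: c_def tail_def)
    qed
    then show "(tail p ((\<lambda>(f, l). c l f) q), ((\<lambda>(f, l). c l f) q) 0) = q" by (simp add: fl c_def)
  qed
  then show ?thesis by (simp add: sum.cartesian_product)
qed

text \<open>Each term of \<open>ext_deriv\<close> is met once for every order of the
  \<open>p\<close> indices that remain after the direction of differentiation is removed, whence the
  factorial.\<close>

lemma sum_perms_ext_deriv:
  assumes B: "\<And>x. x < n \<Longrightarrow> alternating n p (B x)" and I: "I \<in> multi_index n (Suc p)"
    and Bw: "\<And>k K. k < n \<Longrightarrow> K \<in> multi_index n p \<Longrightarrow> B k (enum K) = partial_deriv k (\<lambda>y. w y K) z"
  shows "(\<Sum>\<sigma>\<in>perms (Suc p). csign \<sigma> * B (enum I (\<sigma> 0)) (tail p (enum I \<circ> \<sigma>))) = of_nat (fact p) * ext_deriv w z I"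
proof -
  have "ext_deriv w z I = (\<Sum>s<Suc p. (-1) ^ s * B (enum I s) (skip p s (enum I)))"
    unfolding ext_deriv_def sum_enum[OF I]
  proof (rule sum.cong[OF refl])
    fix s assume "s \<in> {..<Suc p}"
    then have s: "s < Suc p" by simp
    show "index_sign I (enum I s) * partial_deriv (enum I s) (\<lambda>y. w y (I - {enum I s})) z =
        (-1) ^ s * B (enum I s) (skip p s (enum I))"
      using enum_remove[OF I s] Bw[OF enum_less[OF I s]] by metis
  qed
  then show ?thesis using sum_perms_Suc[OF B enum_tuple[OF I]] by simp
qed

lemma sum_perms_compose_left:
  assumes "\<pi> \<in> perms q"
  shows "(\<Sum>\<sigma>\<in>perms q. h \<sigma>) = (\<Sum>\<sigma>\<in>perms q. h (\<pi> \<circ> \<sigma>))"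
proof (rule sum.reindex_bij_witness[of _ "\<lambda>\<sigma>. \<pi> \<circ> \<sigma>" "\<lambda>\<sigma>. Hilbert_Choice.inv \<pi> \<circ> \<sigma>"])
  have p: "\<pi> permutes {0..<q}" using assms by simp
  show "\<pi> \<circ> (Hilbert_Choice.inv \<pi> \<circ> \<sigma>) = \<sigma>" "Hilbert_Choice.inv \<pi> \<circ> (\<pi> \<circ> \<sigma>) = \<sigma>" for \<sigma> :: "nat \<Rightarrow> nat"
    using permutes_inv_o[OF p] by (simp_all add: o_assoc)
  show "h (\<pi> \<circ> (Hilbert_Choice.inv \<pi> \<circ> \<sigma>)) = h \<sigma>" for \<sigma> :: "nat \<Rightarrow> nat"
    using permutes_inv_o[OF p] by (simp add: o_assoc)
  show "\<pi> \<circ> \<sigma> \<in> perms q" "Hilbert_Choice.inv \<pi> \<circ> \<sigma> \<in> perms q" if "\<sigma> \<in> perms q" for \<sigma>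
    using permutes_compose that p permutes_inv[OF p] by auto
qed

text \<open>Composition with \<pi> merely permutes the summands, at the cost of the sign of
  \<pi>.\<close>

lemma alternating_sum_perms:
  "alternating n q (\<lambda>k. \<Sum>\<sigma>\<in>perms q. csign \<sigma> * C (k \<circ> \<sigma>))"
  unfolding alternating_def
proof (intro ballI)
  fix f \<pi> assume \<pi>: "\<pi> \<in> perms q"
  have "(\<Sum>\<sigma>\<in>perms q. csign \<sigma> * C (f \<circ> \<sigma>)) = (\<Sum>\<sigma>\<in>perms q. csign \<pi> * (csign \<sigma> * C (f \<circ> \<pi> \<circ> \<sigma>)))"
    by (subst sum_perms_compose_left[OF \<pi>], intro sum.cong refl) (simp add: csign_comp[OF \<pi>] o_assoc)
  also have "\<dots> = csign \<pi> * (\<Sum>\<sigma>\<in>perms q. csign \<sigma> * C (f \<circ> \<pi> \<circ> \<sigma>))" by (simp add: sum_distrib_left)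
  finally have "csign \<pi> * (\<Sum>\<sigma>\<in>perms q. csign \<sigma> * C (f \<circ> \<sigma>)) =
      (csign \<pi> * csign \<pi>) * (\<Sum>\<sigma>\<in>perms q. csign \<sigma> * C (f \<circ> \<pi> \<circ> \<sigma>))" by (simp add: mult.assoc)
  then show "(\<Sum>\<sigma>\<in>perms q. csign \<sigma> * C (f \<circ> \<pi> \<circ> \<sigma>)) = csign \<pi> * (\<Sum>\<sigma>\<in>perms q. csign \<sigma> * C (f \<circ> \<sigma>))"
    by (simp add: csign_square)
qed

text \<open>
  Writing the pullback as a sum over all tuples, the antisymmetrised derivative splits into second
  derivatives of \<open>F\<close>, which cancel by symmetry, and the pullback of the antisymmetrisation of \<open>\<partial>w\<close>.
\<close>

lemma ext_deriv_pullback_eq_0: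
  assumes F: "hol_map n V W F" and w: "\<And>K. K \<in> multi_index n p \<Longrightarrow> hol_fun n W (\<lambda>y. w y K)"
    and closed: "\<And>y I. y \<in> W \<Longrightarrow> I \<in> multi_index n (Suc p) \<Longrightarrow> ext_deriv w y I = 0"
    and z: "z \<in> V" and I: "I \<in> multi_index n (Suc p)"
  shows "ext_deriv (pullback n p F w) z I = 0"
proof -
  have V: "open_cspace n V" and W: "open_cspace n W" and Fz: "F z \<in> W" and FW: "\<And>z. z \<in> V \<Longrightarrow> F z \<in> W"
    and Fi: "\<And>i. i < n \<Longrightarrow> hol_fun n V (\<lambda>z. F z i)"
    using F z by (auto simp: hol_map_def)
  define A where "A k i z = partial_deriv i (\<lambda>z. F z k) z" for k i z
  define wh where "wh f y = antisym_ext n p (w y) f" for f y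
  \<comment> \<open>The value of the pulled back form on the coordinate vectors listed by
    \<open>g\<close>, written as an unsorted sum over all tuples.\<close>
  define bh where "bh g z = (\<Sum>f\<in>tuples n p. (\<Prod>b<p. A (f b) (g b) z) * wh f (F z))" for g z
  define dw where "dw l f = partial_deriv l (wh f) (F z)" for l f
  have whol: "hol_fun n W (wh f)" for f
    unfolding wh_def antisym_ext_def by (intro hol_fun_sum hol_fun_mult hol_fun_const w)
  have Ahol: "hol_fun n V (A k i)" if "k < n" "i < n" for k i
    unfolding A_def by (rule hol_fun_partial_deriv[OF Fi[OF that(1)] V that(2)])
  have whF: "hol_fun n V (\<lambda>z. wh f (F z))" for f
    by (rule hol_fun_compose[OF whol W V Fi FW])
  have pbbh: "pullback n p F w z' K = bh (enum K) z'" if K: "K \<in> multi_index n p" for z' K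
  proof -
    have "bh (enum K) z' = (\<Sum>L\<in>multi_index n p. det_fun p (\<lambda>a b. A (enum L a) (enum K b) z') * antisym_ext n p (w (F z')) (enum L))"
      unfolding bh_def wh_def
      by (rule sum_tuples_alternating[OF alternating_antisym_ext, where B="\<lambda>k b. A k (enum K b) z'"])
    also have "\<dots> = pullback n p F w z' K"
      unfolding pullback_def A_def using K
      by (intro sum.cong refl) (simp add: antisym_ext_enum jacobian_minor_multi_index)
    finally show ?thesis by simp
  qed
  have bhhol: "hol_fun n V (bh g)" if g: "g \<in> tuples n p" for g
    unfolding bh_def
  proof (intro hol_fun_sum hol_fun_mult hol_fun_prod whF)
    fix f b assume "f \<in> tuples n p" "b \<in> {..<p}"
    then show "hol_fun n V (A (f b) (g b))" using Ahol[of "f b" "g b"] PiE_mem[OF \<open>f \<in> tuples n p\<close>, of b] PiE_mem[OF g, of b] by simp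
  qed
  have bhalt: "bh (g \<circ> \<pi>) z' = csign \<pi> * bh g z'" if g: "g \<in> tuples n p" and \<pi>: "\<pi> \<in> perms p" for g \<pi> z'
  proof -
    have "bh (g \<circ> \<pi>) z' = (\<Sum>f\<in>tuples n p. (\<Prod>b<p. A ((f \<circ> \<pi>) b) ((g \<circ> \<pi>) b) z') * wh (f \<circ> \<pi>) (F z'))"
      unfolding bh_def by (rule tuples_sum_permute[OF \<pi>])
    also have "\<dots> = (\<Sum>f\<in>tuples n p. csign \<pi> * ((\<Prod>b<p. A (f b) (g b) z') * wh f (F z')))"
    proof (rule sum.cong[OF refl])
      fix f assume f: "f \<in> tuples n p"
      have "wh (f \<circ> \<pi>) (F z') = csign \<pi> * wh f (F z')"
        using alternating_antisym_ext[of n p "w (F z')"] f \<pi> unfolding wh_def alternating_def by blast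
      moreover have "(\<Prod>b<p. A ((f \<circ> \<pi>) b) ((g \<circ> \<pi>) b) z') = (\<Prod>b<p. A (f b) (g b) z')"
        using prod_permute[OF \<pi>, of "\<lambda>b. A (f b) (g b) z'"] by simp
      ultimately show "(\<Prod>b<p. A ((f \<circ> \<pi>) b) ((g \<circ> \<pi>) b) z') * wh (f \<circ> \<pi>) (F z') =
          csign \<pi> * ((\<Prod>b<p. A (f b) (g b) z') * wh f (F z'))" by simp
    qed
    finally show ?thesis by (simp add: bh_def sum_distrib_left)
  qed
  let ?B = "\<lambda>x g. partial_deriv x (bh g) z"
  have Balt: "alternating n p (?B x)" if x: "x < n" for x
    unfolding alternating_def
  proof (intro ballI)
    fix g \<pi> assume g: "g \<in> tuples n p" and \<pi>: "\<pi> \<in> perms p"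
    have "bh (g \<circ> \<pi>) = (\<lambda>z'. csign \<pi> * bh g z')" using bhalt[OF g \<pi>] by (simp add: fun_eq_iff)
    moreover have "partial_deriv x (\<lambda>z'. csign \<pi> * bh g z') z = csign \<pi> * partial_deriv x (bh g) z"
      using DERIV_imp_deriv[OF DERIV_cmult[OF hol_fun_has_partial_deriv[OF bhhol[OF g] z x], of "csign \<pi>"]]
      by (simp add: partial_deriv_def[of _ "\<lambda>z'. csign \<pi> * bh g z'"])
    ultimately show "?B x (g \<circ> \<pi>) = csign \<pi> * ?B x g" by simp
  qed
  \<comment> \<open>It suffices that the left side vanishes, because the factorial is a nonzero
    complex number.\<close>
  have key: "(\<Sum>\<sigma>\<in>perms (Suc p). csign \<sigma> * ?B (enum I (\<sigma> 0)) (tail p (enum I \<circ> \<sigma>))) = of_nat (fact p) * ext_deriv (pullback n p F w) z I"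
    by (rule sum_perms_ext_deriv[OF Balt I]) (simp_all add: pbbh)
  let ?i = "enum I"
  let ?H = "\<lambda>f t \<sigma>. partial_deriv (?i (\<sigma> 0)) (A (f t) (?i (\<sigma> (Suc t)))) z * (\<Prod>b\<in>{..<p} - {t}. A (f b) (?i (\<sigma> (Suc b))) z)"
  let ?G = "\<lambda>f l \<sigma>. (\<Prod>b<p. A (f b) (?i (\<sigma> (Suc b))) z) * (dw l f * A l (?i (\<sigma> 0)) z)"
  have \<sigma>less: "?i (\<sigma> a) < n" if "\<sigma> \<in> perms (Suc p)" "a < Suc p" for \<sigma> a
    using permutes_in_image[of \<sigma> "{0..<Suc p}" a] that enum_less[OF I] by auto
  \<comment> \<open>By the product rule, \<open>?H\<close> collects the terms in which a Jacobian
    entry is differentiated and \<open>?G\<close> those in which the coefficient is.\<close>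
  have deriv: "?B (?i (\<sigma> 0)) (tail p (?i \<circ> \<sigma>)) =
     (\<Sum>f\<in>tuples n p. (\<Sum>t<p. ?H f t \<sigma>) * wh f (F z)) + (\<Sum>f\<in>tuples n p. \<Sum>l<n. ?G f l \<sigma>)"
    if \<sigma>: "\<sigma> \<in> perms (Suc p)" for \<sigma>
  proof -
    let ?x = "?i (\<sigma> 0)" and ?g = "tail p (?i \<circ> \<sigma>)"
    have x: "?x < n" using \<sigma>less[OF \<sigma>, of 0] by simp
    have gb: "?g b = ?i (\<sigma> (Suc b))" if "b < p" for b using that by (simp add: tail_def)
    have dA: "((\<lambda>u. A (f b) (?g b) (z(?x := u))) has_field_derivative partial_deriv ?x (A (f b) (?g b)) z) (at (z ?x))"
      if "f \<in> tuples n p" "b < p" for f b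
      using hol_fun_has_partial_deriv[OF Ahol z x, of "f b" "?g b"] \<sigma>less[OF \<sigma>, of "Suc b"] gb[OF that(2)] PiE_mem[OF that(1), of b] that(2)
      by simp
    have dprod: "((\<lambda>u. \<Prod>b<p. A (f b) (?g b) (z(?x := u))) has_field_derivative
        (\<Sum>t<p. partial_deriv ?x (A (f t) (?g t)) z * (\<Prod>b\<in>{..<p} - {t}. A (f b) (?g b) z))) (at (z ?x))"
      if "f \<in> tuples n p" for f
      using has_field_derivative_prod[of "{..<p}" "\<lambda>b u. A (f b) (?g b) (z(?x := u))" "\<lambda>b. partial_deriv ?x (A (f b) (?g b)) z" "z ?x"]
        dA[OF that] by simp
    have dwh: "((\<lambda>u. wh f (F (z(?x := u)))) has_field_derivative (\<Sum>l<n. dw l f * A l ?x z)) (at (z ?x))" for f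
      unfolding dw_def A_def by (rule hol_fun_compose_partial_deriv[OF whol W V Fi FW z x])
    have "((\<lambda>u. bh ?g (z(?x := u))) has_field_derivative
       (\<Sum>f\<in>tuples n p. (\<Sum>t<p. partial_deriv ?x (A (f t) (?g t)) z * (\<Prod>b\<in>{..<p} - {t}. A (f b) (?g b) z)) * wh f (F z)
         + (\<Sum>l<n. dw l f * A l ?x z) * (\<Prod>b<p. A (f b) (?g b) z))) (at (z ?x))"
      unfolding bh_def
    proof (rule DERIV_sum)
      fix f assume f: "f \<in> tuples n p"
      show "((\<lambda>u. (\<Prod>b<p. A (f b) (?g b) (z(?x := u))) * wh f (F (z(?x := u)))) has_field_derivative
        (\<Sum>t<p. partial_deriv ?x (A (f t) (?g t)) z * (\<Prod>b\<in>{..<p} - {t}. A (f b) (?g b) z)) * wh f (F z)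
         + (\<Sum>l<n. dw l f * A l ?x z) * (\<Prod>b<p. A (f b) (?g b) z)) (at (z ?x))"
        using DERIV_mult[OF dprod[OF f] dwh[of f]] by simp
    qed
    then have "?B ?x ?g = (\<Sum>f\<in>tuples n p. (\<Sum>t<p. partial_deriv ?x (A (f t) (?g t)) z * (\<Prod>b\<in>{..<p} - {t}. A (f b) (?g b) z)) * wh f (F z)
         + (\<Sum>l<n. dw l f * A l ?x z) * (\<Prod>b<p. A (f b) (?g b) z))"
      unfolding partial_deriv_def[of _ "bh ?g"] by (rule DERIV_imp_deriv)
    also have "\<dots> = (\<Sum>f\<in>tuples n p. (\<Sum>t<p. ?H f t \<sigma>) * wh f (F z) + (\<Sum>l<n. ?G f l \<sigma>))"
      using gb by (intro sum.cong refl) (simp add: sum_distrib_left mult_ac)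
    finally show ?thesis by (simp add: sum.distrib)
  qed
  have Hzero: "(\<Sum>\<sigma>\<in>perms (Suc p). csign \<sigma> * ?H f t \<sigma>) = 0" if f: "f \<in> tuples n p" and t: "t < p" for f t
  proof -
    \<comment> \<open>Position 0 holds the direction of differentiation and position
      \<open>Suc t\<close> the column of the differentiated entry. Their exchange preserves the
      second derivative and reverses the sign.\<close>
    let ?\<tau> = "Transposition.transpose 0 (Suc t)"
    have \<tau>: "?\<tau> \<in> perms (Suc p)" using permutes_swap_id[of 0 "{0..<Suc p}" "Suc t"] t by simp
    have Heq: "?H f t (\<sigma> \<circ> ?\<tau>) = ?H f t \<sigma>" if \<sigma>: "\<sigma> \<in> perms (Suc p)" for \<sigma>
    proof -
      have "(\<Prod>b\<in>{..<p} - {t}. A (f b) (?i ((\<sigma> \<circ> ?\<tau>) (Suc b))) z) = (\<Prod>b\<in>{..<p} - {t}. A (f b) (?i (\<sigma> (Suc b))) z)"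
        by (intro prod.cong refl) (auto simp: Transposition.transpose_def)
      moreover have "partial_deriv (?i (\<sigma> (Suc t))) (A (f t) (?i (\<sigma> 0))) z = partial_deriv (?i (\<sigma> 0)) (A (f t) (?i (\<sigma> (Suc t)))) z"
        unfolding A_def
        by (rule partial_deriv_commute[OF Fi V z]) (use PiE_mem[OF f, of t] t \<sigma>less[OF \<sigma>] in auto)
      ultimately show ?thesis by simp
    qed
    have "(\<Sum>\<sigma>\<in>perms (Suc p). csign \<sigma> * ?H f t \<sigma>) = (\<Sum>\<sigma>\<in>perms (Suc p). csign (\<sigma> \<circ> ?\<tau>) * ?H f t (\<sigma> \<circ> ?\<tau>))"
      by (rule sum_permutations_compose_right) (use \<tau> in simp)
    also have "\<dots> = (\<Sum>\<sigma>\<in>perms (Suc p). - (csign \<sigma> * ?H f t \<sigma>))"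
      using Heq csign_comp[OF _ \<tau>] csign_transpose[of 0 "Suc t"] by (intro sum.cong refl) simp
    also have "\<dots> = - (\<Sum>\<sigma>\<in>perms (Suc p). csign \<sigma> * ?H f t \<sigma>)" by (rule sum_negf)
    finally have neg: "(\<Sum>\<sigma>\<in>perms (Suc p). csign \<sigma> * ?H f t \<sigma>) = - (\<Sum>\<sigma>\<in>perms (Suc p). csign \<sigma> * ?H f t \<sigma>)" .
    have "x = 0" if "x = - x" for x :: complex using that by simp
    from this[OF neg] show ?thesis .
  qed
  define C where "C k = dw (k 0) (tail p k)" for k
  have dwalt: "alternating n p (dw l)" if l: "l < n" for l
    unfolding alternating_def
  proof (intro ballI)
    fix g \<pi> assume g: "g \<in> tuples n p" and \<pi>: "\<pi> \<in> perms p"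
    have "wh (g \<circ> \<pi>) = (\<lambda>y. csign \<pi> * wh g y)"
      using alternating_antisym_ext g \<pi> unfolding wh_def alternating_def by (simp add: fun_eq_iff)
    moreover have "partial_deriv l (\<lambda>y. csign \<pi> * wh g y) (F z) = csign \<pi> * partial_deriv l (wh g) (F z)"
      using DERIV_imp_deriv[OF DERIV_cmult[OF hol_fun_has_partial_deriv[OF whol[of g] Fz l], of "csign \<pi>"]]
      by (simp add: partial_deriv_def[of _ "\<lambda>y. csign \<pi> * wh g y"])
    ultimately show "dw l (g \<circ> \<pi>) = csign \<pi> * dw l g" by (simp add: dw_def)
  qed
  \<comment> \<open>An alternating function is determined by sorted tuples, where this one is a
    multiple of \<open>ext_deriv w (F z)\<close>, zero by closedness.\<close>
  have Alt0: "(\<Sum>\<sigma>\<in>perms (Suc p). csign \<sigma> * C (k \<circ> \<sigma>)) = 0" if k: "k \<in> tuples n (Suc p)" for k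
  proof (rule alternating_zeroI[OF alternating_sum_perms _ k])
    fix J assume J: "J \<in> multi_index n (Suc p)"
    have "(\<Sum>\<sigma>\<in>perms (Suc p). csign \<sigma> * dw (enum J (\<sigma> 0)) (tail p (enum J \<circ> \<sigma>))) = of_nat (fact p) * ext_deriv w (F z) J"
    proof (rule sum_perms_ext_deriv[OF dwalt J])
      fix k K assume "k < n" "K \<in> multi_index n p"
      then have "wh (enum K) = (\<lambda>y. w y K)" by (simp add: wh_def antisym_ext_enum fun_eq_iff)
      then show "dw k (enum K) = partial_deriv k (\<lambda>y. w y K) (F z)" by (simp add: dw_def)
    qed
    then show "(\<Sum>\<sigma>\<in>perms (Suc p). csign \<sigma> * C (enum J \<circ> \<sigma>)) = 0" using closed[OF Fz J] by (simp add: C_def)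
  qed
  \<comment> \<open>Relabelling the tuples by \<sigma> moves the permutation from the Jacobian
    factors to \<open>C\<close>, so that these factors come out of the sum over \<sigma>.\<close>
  have Gsum: "(\<Sum>f\<in>tuples n p. \<Sum>l<n. ?G f l \<sigma>) = (\<Sum>k\<in>tuples n (Suc p). (\<Prod>b<Suc p. A (k b) (?i b) z) * C (k \<circ> \<sigma>))"
    if \<sigma>: "\<sigma> \<in> perms (Suc p)" for \<sigma>
  proof -
    have "(\<Sum>f\<in>tuples n p. \<Sum>l<n. ?G f l \<sigma>) = (\<Sum>k\<in>tuples n (Suc p). ?G (tail p k) (k 0) \<sigma>)"
      by (rule sum_tuples_Suc[symmetric, where h="\<lambda>l f. ?G f l \<sigma>"])
    also have "\<dots> = (\<Sum>k\<in>tuples n (Suc p). (\<Prod>b<Suc p. A (k b) (?i (\<sigma> b)) z) * C k)"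
      by (intro sum.cong refl) (simp add: prod.lessThan_Suc_shift C_def tail_def mult_ac del: prod.lessThan_Suc)
    also have "\<dots> = (\<Sum>k\<in>tuples n (Suc p). (\<Prod>b<Suc p. A ((k \<circ> \<sigma>) b) (?i (\<sigma> b)) z) * C (k \<circ> \<sigma>))"
      by (rule tuples_sum_permute[OF \<sigma>])
    also have "\<dots> = (\<Sum>k\<in>tuples n (Suc p). (\<Prod>b<Suc p. A (k b) (?i b) z) * C (k \<circ> \<sigma>))"
      using prod_permute[OF \<sigma>, of "\<lambda>b. A (k b) (?i b) z" for k] by (intro sum.cong refl) simp
    finally show ?thesis .
  qed
  have "(\<Sum>\<sigma>\<in>perms (Suc p). csign \<sigma> * ?B (?i (\<sigma> 0)) (tail p (?i \<circ> \<sigma>)))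
    = (\<Sum>\<sigma>\<in>perms (Suc p). \<Sum>f\<in>tuples n p. \<Sum>t<p. wh f (F z) * (csign \<sigma> * ?H f t \<sigma>))
    + (\<Sum>\<sigma>\<in>perms (Suc p). \<Sum>k\<in>tuples n (Suc p). (\<Prod>b<Suc p. A (k b) (?i b) z) * (csign \<sigma> * C (k \<circ> \<sigma>)))"
    unfolding sum.distrib[symmetric]
  proof (rule sum.cong[OF refl])
    fix \<sigma> assume \<sigma>: "\<sigma> \<in> perms (Suc p)"
    show "csign \<sigma> * ?B (?i (\<sigma> 0)) (tail p (?i \<circ> \<sigma>)) = (\<Sum>f\<in>tuples n p. \<Sum>t<p. wh f (F z) * (csign \<sigma> * ?H f t \<sigma>))
       + (\<Sum>k\<in>tuples n (Suc p). (\<Prod>b<Suc p. A (k b) (?i b) z) * (csign \<sigma> * C (k \<circ> \<sigma>)))"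
      unfolding deriv[OF \<sigma>] Gsum[OF \<sigma>] distrib_left sum_distrib_left sum_distrib_right
      by (intro arg_cong2[of _ _ _ _ "(+)"] sum.cong refl) (simp_all only: mult_ac)
  qed
  also have "(\<Sum>\<sigma>\<in>perms (Suc p). \<Sum>f\<in>tuples n p. \<Sum>t<p. wh f (F z) * (csign \<sigma> * ?H f t \<sigma>))
     = (\<Sum>f\<in>tuples n p. \<Sum>t<p. wh f (F z) * (\<Sum>\<sigma>\<in>perms (Suc p). csign \<sigma> * ?H f t \<sigma>))"
    by (subst sum.swap, intro sum.cong refl, subst sum.swap) (simp only: sum_distrib_left)
  also have "\<dots> = 0" using Hzero by (intro sum.neutral ballI) simp
  also have "(\<Sum>\<sigma>\<in>perms (Suc p). \<Sum>k\<in>tuples n (Suc p). (\<Prod>b<Suc p. A (k b) (?i b) z) * (csign \<sigma> * C (k \<circ> \<sigma>)))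
     = (\<Sum>k\<in>tuples n (Suc p). (\<Prod>b<Suc p. A (k b) (?i b) z) * (\<Sum>\<sigma>\<in>perms (Suc p). csign \<sigma> * C (k \<circ> \<sigma>)))"
    by (subst sum.swap) (simp only: sum_distrib_left)
  also have "\<dots> = 0" using Alt0 by (intro sum.neutral ballI) simp
  finally have "of_nat (fact p) * ext_deriv (pullback n p F w) z I = 0 + 0" unfolding key .
  then show ?thesis by simp
qed

section \<open>Bott--Chern classes of bidegree \<open>(p,0)\<close>\<close>

lemma hol_fun_dir_path:
  assumes f: "hol_fun n W f" and z: "z \<in> W" and j: "j < n"
  shows "((\<lambda>t. f (dir_path j u z t)) has_vector_derivative partial_deriv j f z * u) (at 0)"
proof -
  have "((\<lambda>w. f (z(j := w))) has_field_derivative partial_deriv j f z) (at (z j + of_real 0 * u))"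
    using hol_fun_has_partial_deriv[OF f z j] by simp
  then have "((\<lambda>s. f (z(j := z j + s * u))) has_field_derivative partial_deriv j f z * u) (at (of_real 0))"
    by (rule DERIV_chain2[of _ _ "\<lambda>s. z j + s * u", rotated 0]) (auto intro!: derivative_eq_intros)
  then show ?thesis
    unfolding dir_path_def by (rule has_vector_derivative_real_field)
qed

lemma rpartial_hol_fun:
  assumes "hol_fun n W f" "z \<in> W" "j < n"
  shows "rpartial j u f z = partial_deriv j f z * u"
  unfolding rpartial_def using hol_fun_dir_path[OF assms] by (rule vector_derivative_at)

lemma wirtinger_hol_fun:
  assumes "hol_fun n W f" "z \<in> W" "j < n"
  shows "wirtinger j f z = partial_deriv j f z" "wirtinger_bar j f z = 0"
proof -
  have "\<i> * (x * \<i>) = - x" for x by (simp add: complex_eq_iff)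
  then show "wirtinger j f z = partial_deriv j f z" "wirtinger_bar j f z = 0"
    unfolding wirtinger_def wirtinger_bar_def rpartial_hol_fun[OF assms] by simp_all
qed

text \<open>The real partial derivatives are constant multiples of holomorphic ones, hence
  holomorphic again, so the induction on the order of differentiability closes.\<close>

lemma hol_fun_smooth:
  assumes W: "open_cspace n W" and f: "hol_fun n W f"
  shows "smooth_on n W f"
proof -
  have "Ck_on k n W f" for k
    using f
  proof (induction k arbitrary: f)
    case 0
    then show ?case by (simp add: hol_fun_def)
  next
    case (Suc k)
    have "Ck_on k n W (rpartial j u f)" if "j < n" for j u
    proof (rule Suc.IH, rule hol_fun_cong[OF W])
      show "hol_fun n W (\<lambda>z. partial_deriv j f z * u)" by (intro hol_fun_mult hol_fun_const hol_fun_partial_deriv Suc.prems W that)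
      show "partial_deriv j f z * u = rpartial j u f z" if "z \<in> W" for z
        using rpartial_hol_fun[OF Suc.prems that \<open>j < n\<close>] by simp
    qed
    moreover have "(\<lambda>t. f (dir_path j u z t)) differentiable at 0" if "j < n" "z \<in> W" for j u z
      using hol_fun_dir_path[OF Suc.prems that(2,1)] by (rule differentiableI_vector)
    ultimately show ?case using Suc.prems by (auto simp: hol_fun_def)
  qed
  then show ?thesis by (simp add: smooth_on_def)
qed

text \<open>Continuous real partial derivatives make each slice real differentiable, and the
  Cauchy-Riemann equation turns its real derivative into multiplication by a complex number.\<close>

lemma smooth_hol_fun:
  assumes W: "open_cspace n W" and f: "smooth_on n W f"
    and cr: "\<And>z j. z \<in> W \<Longrightarrow> j < n \<Longrightarrow> wirtinger_bar j f z = 0"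
  shows "hol_fun n W f"
proof (rule hol_funI)
  have C1: "Ck_on (Suc 0) n W f" using f unfolding smooth_on_def by blast
  then show "continuous_on W f" by simp
  fix z j assume z: "z \<in> W" and j: "j < n"
  have rc: "continuous_on W (rpartial j u f)" if "u \<in> {1, \<i>}" for u using C1 j that by auto
  have rd: "(\<lambda>t. f (dir_path j u z t)) differentiable (at 0)" if "u \<in> {1, \<i>}" "z \<in> W" for u z
    using C1 j that by auto
  have zc: "z \<in> cspace n" using z open_cspace_subset[OF W] by auto
  have S: "open {w. z(j := w) \<in> W}" by (rule open_cspace_slice[OF W zc j])
  have "z j \<in> {w. z(j := w) \<in> W}" using z by simp
  then obtain e where e: "e > 0" "ball (z j) e \<subseteq> {w. z(j := w) \<in> W}" using S open_contains_ball by blast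
  \<comment> \<open>A square of half-side \<open>e / 2\<close> fits into the disc of radius
    \<open>e\<close>, since the norm is at most the sum of the absolute real and imaginary
    parts.\<close>
  define d where "d = e / 2"
  have d: "d > 0" using e by (simp add: d_def)
  let ?x = "Re (z j)" and ?y = "Im (z j)"
  let ?X = "ball ?x d" and ?Y = "ball ?y d"
  let ?c = "\<lambda>x y. z(j := Complex x y)"
  have inW: "?c x y \<in> W" if "x \<in> ?X" "y \<in> ?Y" for x y
  proof -
    have "cmod (z j - Complex x y) \<le> \<bar>Re (z j - Complex x y)\<bar> + \<bar>Im (z j - Complex x y)\<bar>" by (rule cmod_le)
    also have "\<dots> < e" using that by (simp add: dist_real_def d_def)
    finally show ?thesis using e(2) by (auto simp: dist_norm)
  qed
  define h where "h x y = f (?c x y)" for x y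
  have line: "((\<lambda>s. f (z(j := Complex x y + of_real (s - r) * u))) has_vector_derivative rpartial j u f (?c x y)) (at r)"
    if xy: "x \<in> ?X" "y \<in> ?Y" and u: "u \<in> {1, \<i>}" for x y u r
  proof -
    have "((\<lambda>t. f (dir_path j u (?c x y) t)) has_vector_derivative rpartial j u f (?c x y)) (at (r - r))"
      using rd[OF u inW[OF xy]] by (simp add: vector_derivative_works rpartial_def)
    then have "((\<lambda>t. f (dir_path j u (?c x y) t)) \<circ> (\<lambda>s. s - r) has_vector_derivative (1 *\<^sub>R rpartial j u f (?c x y))) (at r)"
      by (intro vector_diff_chain_at) (auto intro!: derivative_eq_intros)
    then show ?thesis by (simp add: o_def dir_path_def)
  qed
  have hx: "((\<lambda>x. h x y) has_vector_derivative rpartial j 1 f (?c x y)) (at x)" if "x \<in> ?X" "y \<in> ?Y" for x y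
  proof -
    have "Complex x y + of_real (s - x) * 1 = Complex s y" for s by (simp add: complex_eq_iff)
    then show ?thesis using line[OF that, of 1 x] by (simp add: h_def)
  qed
  have hy: "(h x has_vector_derivative rpartial j \<i> f (?c x y)) (at y)" if "x \<in> ?X" "y \<in> ?Y" for x y
  proof -
    have "Complex x y + of_real (s - y) * \<i> = Complex x s" for s by (simp add: complex_eq_iff)
    then show ?thesis using line[OF that, of \<i> y] by (simp add: h_def[abs_def])
  qed
  define D where "D = rpartial j 1 f z"
  have "D + \<i> * rpartial j \<i> f z = 0" using cr[OF z j] by (simp add: wirtinger_bar_def D_def)
  then have "\<i> * (D + \<i> * rpartial j \<i> f z) = 0" by simp
  then have D2: "rpartial j \<i> f z = \<i> * D" by (simp add: algebra_simps)
  have zz: "?c ?x ?y = z" by (simp add: complex_surj)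
  \<comment> \<open>The theorem on partial derivatives takes the \<open>x\<close>-derivative at the
    point and the \<open>y\<close>-derivative as a family nearby that is continuous at the
    point.\<close>
  have "((\<lambda>(x, y). h x y) has_derivative
      (\<lambda>(tx, ty). tx *\<^sub>R D + blinfun_apply (blinfun_scaleR_left (rpartial j \<i> f (?c ?x ?y))) ty)) (at (?x, ?y) within ?X \<times> ?Y)"
  proof (rule has_derivative_partialsI[where fy="\<lambda>x y. blinfun_scaleR_left (rpartial j \<i> f (?c x y))"])
    show "((\<lambda>x. h x ?y) has_derivative (\<lambda>tx. tx *\<^sub>R D)) (at ?x within ?X)"
      using hx[of ?x ?y] d zz by (simp add: has_vector_derivative_def D_def has_derivative_at_withinI)
    show "(h x has_derivative blinfun_apply (blinfun_scaleR_left (rpartial j \<i> f (?c x y)))) (at y within ?Y)"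
      if "x \<in> ?X" "y \<in> ?Y" for x y
      using hy[OF that] by (simp add: has_vector_derivative_def has_derivative_at_withinI blinfun_scaleR_left.rep_eq)
    have c1: "continuous_on (?X \<times> ?Y) (\<lambda>q. ?c (fst q) (snd q))"
    proof -
      have "continuous_on (?X \<times> ?Y) (\<lambda>q. Complex (fst q) (snd q))"
        unfolding Complex_eq by (intro continuous_intros)
      then show ?thesis by (intro continuous_on_fun_upd continuous_on_const)
    qed
    have "continuous_on (?X \<times> ?Y) (\<lambda>q. rpartial j \<i> f (?c (fst q) (snd q)))"
      by (rule continuous_on_compose2[OF rc c1]) (use inW in \<open>auto simp del: mem_ball\<close>)
    then have "continuous_on (?X \<times> ?Y) (\<lambda>q. blinfun_scaleR_left (rpartial j \<i> f (?c (fst q) (snd q))))"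
      by (intro bounded_linear.continuous_on[OF bounded_linear_blinfun_scaleR_left])
    then show "continuous (at (?x, ?y) within ?X \<times> ?Y) (\<lambda>(x, y). blinfun_scaleR_left (rpartial j \<i> f (?c x y)))"
      using d by (simp add: continuous_on_eq_continuous_within case_prod_unfold)
  qed (use d in auto)
  moreover have "(?x, ?y) \<in> ?X \<times> ?Y" "open (?X \<times> ?Y)" using d by (auto intro: open_Times)
  ultimately have hd: "((\<lambda>(x, y). h x y) has_derivative (\<lambda>(tx, ty). tx *\<^sub>R D + ty *\<^sub>R (\<i> * D))) (at (?x, ?y))"
    unfolding zz D2 by (simp add: at_within_open[of _ "?X \<times> ?Y"] blinfun_scaleR_left.rep_eq)
  have "((\<lambda>w. (Re w, Im w)) has_derivative (\<lambda>w. (Re w, Im w))) (at (z j))"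
    by (intro has_derivative_Pair bounded_linear_imp_has_derivative bounded_linear_Re bounded_linear_Im)
  from has_derivative_compose[OF this hd]
  have "((\<lambda>w. f (z(j := w))) has_derivative (\<lambda>w. Re w *\<^sub>R D + Im w *\<^sub>R (\<i> * D))) (at (z j))"
    by (simp add: h_def complex_surj)
  moreover have "(\<lambda>w. Re w *\<^sub>R D + Im w *\<^sub>R (\<i> * D)) = (*) D"
    by (rule ext) (simp add: complex_eq_iff algebra_simps)
  ultimately show "\<exists>D. ((\<lambda>w. f (z(j := w))) has_field_derivative D) (at (z j))"
    by (auto simp: has_field_derivative_def)
qed

section \<open>Cocycles as closed holomorphic forms\<close>

lemma multi_index_0: "multi_index n 0 = {{}}"
  by (auto simp: multi_index_def dest: finite_subset)

lemma jacobian_minor_empty: "jacobian_minor F z {} {} = 1"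
  by (simp add: jacobian_minor_def)

lemma chart_image_open_cspace:
  assumes "complex_manifold M" "c \<in> cm_atlas M" "cm_dim M = n"
  shows "open_cspace n (chart_image c)"
  using assms by (simp add: complex_manifold_def is_chart_def)

lemma wirtinger_zero: "wirtinger j (\<lambda>w. 0) z = 0" "wirtinger_bar j (\<lambda>w. 0) z = 0"
  by (simp_all add: wirtinger_def wirtinger_bar_def rpartial_def)

text \<open>For \<open>q = 0\<close> the only second index is the empty set, with conjugate minor 1,
  so the transformation law is a pullback by the transition map. The component of
  \<open>del_bar\<close> at \<open>J = {k}\<close> is up to sign the \<open>k\<close>-th
  Cauchy-Riemann operator, and the component of \<open>del\<close> at \<open>J = {}\<close> is
  \<open>ext_deriv\<close>.\<close>

lemma BC_cocycles_iff:
  assumes M: "complex_manifold M" and n: "cm_dim M = n"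
  shows "\<omega> \<in> BC_cocycles M p 0 \<longleftrightarrow>
    (\<forall>c z I J. \<not> (c \<in> cm_atlas M \<and> z \<in> chart_image c \<and> I \<in> multi_index n p \<and> J = {}) \<longrightarrow> \<omega> c z I J = 0) \<and>
    (\<forall>c\<in>cm_atlas M. \<forall>I. hol_fun n (chart_image c) (\<lambda>z. \<omega> c z I {})) \<and>
    (\<forall>c\<in>cm_atlas M. \<forall>c'\<in>cm_atlas M. \<forall>z\<in>snd c ` (fst c \<inter> fst c'). \<forall>I\<in>multi_index n p.
        \<omega> c z I {} = pullback n p (transition c c') (\<lambda>y K. \<omega> c' y K {}) z I) \<and>
    (\<forall>c\<in>cm_atlas M. \<forall>z\<in>chart_image c. \<forall>I\<in>multi_index n (Suc p). ext_deriv (\<lambda>y I. \<omega> c y I {}) z I = 0)"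
  (is "_ \<longleftrightarrow> ?S \<and> ?H \<and> ?T \<and> ?C")
proof
  assume \<omega>: "\<omega> \<in> BC_cocycles M p 0"
  then have S: ?S and T: ?T and sm: "\<And>c I J. c \<in> cm_atlas M \<Longrightarrow> smooth_on n (chart_image c) (\<lambda>z. \<omega> c z I J)"
    and d: "del M \<omega> = zero_form" and db: "del_bar M \<omega> = zero_form"
    by (auto simp: BC_cocycles_def forms_def n multi_index_0 jacobian_minor_empty pullback_def)
  have H: ?H
  proof (intro ballI allI)
    fix c I assume c: "c \<in> cm_atlas M"
    show "hol_fun n (chart_image c) (\<lambda>z. \<omega> c z I {})"
    proof (cases "I \<in> multi_index n p")
      case True
      show ?thesis
      proof (rule smooth_hol_fun[OF chart_image_open_cspace[OF M c n] sm[OF c]])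
        fix z k assume z: "z \<in> chart_image c" and k: "k < n"
        have "del_bar M \<omega> c z I {k} = 0" using db by (simp add: zero_form_def)
        then show "wirtinger_bar k (\<lambda>z. \<omega> c z I {}) z = 0"
          using c z k True by (auto simp: del_bar_def n multi_index_def index_sign_def)
      qed
    next
      case False
      then have "(\<lambda>z. \<omega> c z I {}) = (\<lambda>z. 0)" using S by blast
      then show ?thesis by (simp add: hol_fun_const)
    qed
  qed
  have C: ?C
  proof (intro ballI)
    fix c z I assume c: "c \<in> cm_atlas M" and z: "z \<in> chart_image c" and I: "I \<in> multi_index n (Suc p)"
    have "del M \<omega> c z I {} = 0" using d by (simp add: zero_form_def)
    then have "(\<Sum>k\<in>I. index_sign I k * wirtinger k (\<lambda>w. \<omega> c w (I - {k}) {}) z) = 0"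
      using c z I by (simp add: del_def n multi_index_def)
    moreover have "wirtinger k (\<lambda>w. \<omega> c w (I - {k}) {}) z = partial_deriv k (\<lambda>w. \<omega> c w (I - {k}) {}) z" if "k \<in> I" for k
      using wirtinger_hol_fun(1)[OF _ z, of n "\<lambda>w. \<omega> c w (I - {k}) {}" k] H c that I by (auto simp: multi_index_def)
    ultimately show "ext_deriv (\<lambda>y I. \<omega> c y I {}) z I = 0" unfolding ext_deriv_def by simp
  qed
  show "?S \<and> ?H \<and> ?T \<and> ?C" using S H T C by blast
next
  assume A: "?S \<and> ?H \<and> ?T \<and> ?C"
  then have S: ?S and H: ?H and T: ?T and C: ?C by blast+
  have zero: "\<omega> c z I J = 0" if "\<not> (I \<in> multi_index n p \<and> J = {})" for c z I J using S that by blast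
  have sm: "smooth_on n (chart_image c) (\<lambda>z. \<omega> c z I J)" if c: "c \<in> cm_atlas M" for c I J
  proof (rule hol_fun_smooth[OF chart_image_open_cspace[OF M c n]])
    show "hol_fun n (chart_image c) (\<lambda>z. \<omega> c z I J)"
      using H c zero[of I J] hol_fun_const by (cases "J = {}") auto
  qed
  have "\<omega> \<in> forms M p 0"
    using S T sm by (simp add: forms_def n multi_index_0 jacobian_minor_empty pullback_def)
  moreover have "del M \<omega> = zero_form"
  proof (intro ext)
    fix c z I J
    show "del M \<omega> c z I J = zero_form c z I J"
    proof (cases "c \<in> cm_atlas M \<and> z \<in> chart_image c \<and> I \<subseteq> {..<n} \<and> J \<subseteq> {..<n}")
      case True
      then have fin: "finite I" using finite_subset by blast
      have "(\<Sum>k\<in>I. index_sign I k * wirtinger k (\<lambda>w. \<omega> c w (I - {k}) J) z) = 0"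
      proof (cases "I \<in> multi_index n (Suc p) \<and> J = {}")
        case I: True
        have "wirtinger k (\<lambda>w. \<omega> c w (I - {k}) {}) z = partial_deriv k (\<lambda>w. \<omega> c w (I - {k}) {}) z" if "k \<in> I" for k
          using wirtinger_hol_fun(1)[of n "chart_image c" "\<lambda>w. \<omega> c w (I - {k}) {}" z k] H True that by blast
        then have "(\<Sum>k\<in>I. index_sign I k * wirtinger k (\<lambda>w. \<omega> c w (I - {k}) J) z) = ext_deriv (\<lambda>y I. \<omega> c y I {}) z I"
          unfolding ext_deriv_def using I by simp
        then show ?thesis using C True I by simp
      next
        case False
        have "wirtinger k (\<lambda>w. \<omega> c w (I - {k}) J) z = 0" if k: "k \<in> I" for k
        proof -
          \<comment> \<open>Deleting an element lowers the size by one, so in every other bidegree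
            the coefficients that occur are zero by convention.\<close>
          have "\<not> (I - {k} \<in> multi_index n p \<and> J = {})"
            using False True k fin card_Suc_Diff1[of I k] by (auto simp: multi_index_def)
          then have "(\<lambda>w. \<omega> c w (I - {k}) J) = (\<lambda>w. 0)" by (intro ext zero)
          then show ?thesis by (simp add: wirtinger_zero)
        qed
        then show ?thesis by simp
      qed
      then show ?thesis by (simp add: del_def zero_form_def)
    qed (auto simp: del_def zero_form_def n)
  qed
  moreover have "del_bar M \<omega> = zero_form"
  proof (intro ext)
    fix c z I J
    show "del_bar M \<omega> c z I J = zero_form c z I J"
    proof (cases "c \<in> cm_atlas M \<and> z \<in> chart_image c \<and> I \<subseteq> {..<n} \<and> J \<subseteq> {..<n}")
      case True
      have "wirtinger_bar k (\<lambda>w. \<omega> c w I (J - {k})) z = 0" if k: "k \<in> J" for k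
      proof (cases "J - {k} = {}")
        case J: True
        show ?thesis unfolding J
          using wirtinger_hol_fun(2)[of n "chart_image c" "\<lambda>w. \<omega> c w I {}" z k] H True k by blast
      next
        case False
        then have "(\<lambda>w. \<omega> c w I (J - {k})) = (\<lambda>w. 0)" by (intro ext zero) blast
        then show ?thesis by (simp add: wirtinger_zero)
      qed
      then show ?thesis by (simp add: del_bar_def zero_form_def)
    qed (auto simp: del_bar_def zero_form_def n)
  qed
  ultimately show "\<omega> \<in> BC_cocycles M p 0" by (simp add: BC_cocycles_def)
qed

section \<open>Dimension under linear bijections\<close>

lemma span_hom_image:
  assumes V: "vectorspace K V" and W: "vectorspace K W" and T: "T \<in> module_hom K V W"
    and inj: "inj_on T (carrier V)" and surj: "T ` carrier V = carrier W"
    and A: "finite A" "A \<subseteq> carrier V" "LinearCombinations.module.span K V A = carrier V"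
  shows "LinearCombinations.module.span K W (T ` A) = carrier W"
proof -
  interpret V: vectorspace K V by (rule V)
  interpret W: vectorspace K W by (rule W)
  interpret T: mod_hom K V W T using T by unfold_locales
  have TA: "T ` A \<subseteq> carrier W" using A(2) surj by blast
  show ?thesis
  proof
    show "W.span (T ` A) \<subseteq> carrier W" using TA by (rule W.span_is_subset2)
    show "carrier W \<subseteq> W.span (T ` A)"
    proof
      fix w assume "w \<in> carrier W"
      then obtain v where v: "v \<in> carrier V" "w = T v" using surj by blast
      then obtain a B where aB: "v = V.lincomb a B" "finite B" "B \<subseteq> A" "a \<in> B \<rightarrow> carrier K"
        using A(3) unfolding V.span_def by blast
      have BV: "B \<subseteq> carrier V" using aB(3) A(2) by blast
      have injB: "inj_on T B" using inj BV by (rule inj_on_subset)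
      \<comment> \<open>Coefficients are indexed by vectors, so they are transported along the
        inverse of \<open>T\<close>, which injectivity provides.\<close>
      define b where "b = a \<circ> inv_into B T"
      have b: "b (T x) = a x" if "x \<in> B" for x using that injB by (simp add: b_def)
      have "w = T (\<Oplus>\<^bsub>V\<^esub>x\<in>B. a x \<odot>\<^bsub>V\<^esub> x)" using v(2) aB(1) by (simp add: V.lincomb_def)
      also have "\<dots> = (\<Oplus>\<^bsub>W\<^esub>x\<in>B. T (a x \<odot>\<^bsub>V\<^esub> x))"
      proof (rule T.hom_sum)
        show "(\<lambda>x. a x \<odot>\<^bsub>V\<^esub> x) \<in> B \<rightarrow> carrier V" using aB(4) BV by (auto intro!: V.smult_closed)
      qed (use aB BV in auto)
      also have "\<dots> = (\<Oplus>\<^bsub>W\<^esub>x\<in>B. b (T x) \<odot>\<^bsub>W\<^esub> T x)"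
      proof (rule W.finsum_cong')
        show "(\<lambda>x. b (T x) \<odot>\<^bsub>W\<^esub> T x) \<in> B \<rightarrow> carrier W"
          using b aB(4) BV surj by (auto intro!: W.smult_closed)
        show "T (a x \<odot>\<^bsub>V\<^esub> x) = b (T x) \<odot>\<^bsub>W\<^esub> T x" if "x \<in> B" for x
          using module_hom_smult[OF T, of "a x" x] Pi_mem[OF aB(4) that] subsetD[OF BV that] b[OF that] by simp
      qed simp
      also have "\<dots> = W.lincomb b (T ` B)"
        unfolding W.lincomb_def
      proof (rule W.finsum_reindex[symmetric, OF _ injB])
        show "(\<lambda>v. b v \<odot>\<^bsub>W\<^esub> v) \<in> T ` B \<rightarrow> carrier W"
          using b aB(4) BV surj by (auto intro!: W.smult_closed)
      qed
      finally have "w = W.lincomb b (T ` B)" .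
      moreover have "b \<in> T ` B \<rightarrow> carrier K" using b aB(4) by auto
      ultimately show "w \<in> W.span (T ` A)"
        unfolding W.span_def using aB(2,3) by blast
    qed
  qed
qed

text \<open>The dimension is the least size of a finite spanning set. Such sets are carried over by
  \<open>T\<close> and back by its inverse, so the same sizes occur on both sides.\<close>

lemma dim_bij_hom:
  assumes V: "vectorspace K V" and W: "vectorspace K W" and T: "T \<in> module_hom K V W"
    and bij: "bij_betw T (carrier V) (carrier W)"
  shows "vectorspace.dim K V = vectorspace.dim K W"
proof -
  interpret V: vectorspace K V by (rule V)
  interpret W: vectorspace K W by (rule W)
  let ?S = "inv_into (carrier V) T"
  have bijS: "bij_betw ?S (carrier W) (carrier V)" using bij by (rule bij_betw_inv_into)
  have ST: "?S (T v) = v" if "v \<in> carrier V" for v using bij that by (simp add: bij_betw_inv_into_left)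
  have TS: "T (?S w) = w" if "w \<in> carrier W" for w using bij that by (simp add: bij_betw_inv_into_right)
  have Sc: "?S w \<in> carrier V" if "w \<in> carrier W" for w using bijS that by (auto simp: bij_betw_def)
  have S: "?S \<in> module_hom K W V"
    unfolding module_hom_def
  proof (intro CollectI conjI allI impI)
    show "?S \<in> carrier W \<rightarrow> carrier V" using Sc by blast
    show "?S (x \<oplus>\<^bsub>W\<^esub> y) = ?S x \<oplus>\<^bsub>V\<^esub> ?S y" if "x \<in> carrier W \<and> y \<in> carrier W" for x y
    proof -
      have "T (?S x \<oplus>\<^bsub>V\<^esub> ?S y) = x \<oplus>\<^bsub>W\<^esub> y" using T Sc that TS by (simp add: module_hom_def)
      then show ?thesis using ST[of "?S x \<oplus>\<^bsub>V\<^esub> ?S y"] Sc that by simp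
    qed
    show "?S (r \<odot>\<^bsub>W\<^esub> x) = r \<odot>\<^bsub>V\<^esub> ?S x" if "r \<in> carrier K \<and> x \<in> carrier W" for r x
    proof -
      have "T (r \<odot>\<^bsub>V\<^esub> ?S x) = r \<odot>\<^bsub>W\<^esub> x" using T Sc that TS by (simp add: module_hom_def)
      then show ?thesis using ST[of "r \<odot>\<^bsub>V\<^esub> ?S x"] Sc that by simp
    qed
  qed
  have inj: "inj_on T (carrier V)" "T ` carrier V = carrier W" "inj_on ?S (carrier W)" "?S ` carrier W = carrier V"
    using bij bijS by (auto simp: bij_betw_def)
  have "(\<exists>A. finite A \<and> card A = m \<and> A \<subseteq> carrier V \<and> V.span A = carrier V) \<longleftrightarrow>
        (\<exists>A. finite A \<and> card A = m \<and> A \<subseteq> carrier W \<and> W.span A = carrier W)" for m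
  proof
    assume "\<exists>A. finite A \<and> card A = m \<and> A \<subseteq> carrier V \<and> V.span A = carrier V"
    then obtain A where A: "finite A" "card A = m" "A \<subseteq> carrier V" "V.span A = carrier V" by blast
    have "card (T ` A) = m" using A inj(1) by (metis card_image inj_on_subset)
    then show "\<exists>A. finite A \<and> card A = m \<and> A \<subseteq> carrier W \<and> W.span A = carrier W"
      using span_hom_image[OF V W T inj(1,2) A(1,3,4)] A inj(2) image_mono[OF A(3), of T] by (intro exI[of _ "T ` A"]) simp
  next
    assume "\<exists>A. finite A \<and> card A = m \<and> A \<subseteq> carrier W \<and> W.span A = carrier W"
    then obtain A where A: "finite A" "card A = m" "A \<subseteq> carrier W" "W.span A = carrier W" by blast
    have "card (?S ` A) = m" using A inj(3) by (metis card_image inj_on_subset)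
    then show "\<exists>A. finite A \<and> card A = m \<and> A \<subseteq> carrier V \<and> V.span A = carrier V"
      using span_hom_image[OF W V S inj(3,4) A(1,3,4)] A inj(4) image_mono[OF A(3), of ?S] by (intro exI[of _ "?S ` A"]) simp
  qed
  then show ?thesis unfolding V.dim_def W.dim_def by simp
qed

section \<open>Quotients by the zero form\<close>

definition form_add :: "'a cform \<Rightarrow> 'a cform \<Rightarrow> 'a cform" where
  "form_add \<omega> \<eta> = (\<lambda>c z I J. \<omega> c z I J + \<eta> c z I J)"

definition form_smult :: "complex \<Rightarrow> 'a cform \<Rightarrow> 'a cform" where
  "form_smult a \<omega> = (\<lambda>c z I J. a * \<omega> c z I J)"

definition lin_closed :: "'a cform set \<Rightarrow> bool" where
  "lin_closed Z \<longleftrightarrow> zero_form \<in> Z \<and> (\<forall>\<omega>\<in>Z. \<forall>\<eta>\<in>Z. form_add \<omega> \<eta> \<in> Z) \<and> (\<forall>a. \<forall>\<omega>\<in>Z. form_smult a \<omega> \<in> Z)"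

text \<open>In bidegree \<open>(p,0)\<close> the only coboundary is the zero form. The cosets are
  then singletons and the quotient is a copy of the space of cocycles.\<close>

abbreviation triv_quot :: "'a cform set \<Rightarrow> (complex, 'a cform set) module" where
  "triv_quot Z \<equiv> quotient_module (form_space Z) {zero_form}"

lemma form_simps:
  "form_add zero_form \<omega> = \<omega>" "form_add \<omega> zero_form = \<omega>" "form_add \<omega> \<eta> = form_add \<eta> \<omega>"
  "form_add (form_add \<omega> \<eta>) \<theta> = form_add \<omega> (form_add \<eta> \<theta>)"
  "form_smult (a + b) \<omega> = form_add (form_smult a \<omega>) (form_smult b \<omega>)"
  "form_smult a (form_add \<omega> \<eta>) = form_add (form_smult a \<omega>) (form_smult a \<eta>)"
  "form_smult (a * b) \<omega> = form_smult a (form_smult b \<omega>)" "form_smult 1 \<omega> = \<omega>"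
  "form_add (form_smult (-1) \<omega>) \<omega> = zero_form" "form_add \<omega> (form_smult (-1) \<omega>) = zero_form"
  by (simp_all add: form_add_def form_smult_def zero_form_def fun_eq_iff algebra_simps)

lemma triv_quot_simps:
  "carrier (triv_quot Z) = (\<lambda>\<omega>. {\<omega>}) ` Z"
  "zero (triv_quot Z) = {zero_form}"
  "{\<omega>} \<oplus>\<^bsub>triv_quot Z\<^esub> {\<eta>} = {form_add \<omega> \<eta>}"
  "a \<odot>\<^bsub>triv_quot Z\<^esub> {\<omega>} = {form_smult a \<omega>}"
proof -
  have add: "\<omega> \<oplus>\<^bsub>form_space Z\<^esub> \<eta> = form_add \<omega> \<eta>" "a \<odot>\<^bsub>form_space Z\<^esub> \<omega> = form_smult a \<omega>" for \<omega> \<eta> a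
    by (simp_all add: form_space_def form_add_def form_smult_def)
  show "carrier (triv_quot Z) = (\<lambda>\<omega>. {\<omega>}) ` Z"
    by (auto simp: quotient_module_def A_RCOSETS_def' a_r_coset_def' add form_simps) (auto simp: form_space_def)
  show "zero (triv_quot Z) = {zero_form}" by (simp add: quotient_module_def)
  show "{\<omega>} \<oplus>\<^bsub>triv_quot Z\<^esub> {\<eta>} = {form_add \<omega> \<eta>}" by (simp add: quotient_module_def set_add_def' add)
  show "a \<odot>\<^bsub>triv_quot Z\<^esub> {\<omega>} = {form_smult a \<omega>}"
    by (simp add: quotient_module_def set_add_def' add form_simps)
qed

lemma vectorspace_triv_quot:
  assumes Z: "lin_closed Z"
  shows "vectorspace class_ring (triv_quot Z)"
proof -
  have ag: "abelian_group (triv_quot Z)"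
  proof (rule abelian_groupI)
    fix x y z assume "x \<in> carrier (triv_quot Z)" "y \<in> carrier (triv_quot Z)"
    then show "x \<oplus>\<^bsub>triv_quot Z\<^esub> y \<in> carrier (triv_quot Z)" "x \<oplus>\<^bsub>triv_quot Z\<^esub> y = y \<oplus>\<^bsub>triv_quot Z\<^esub> x"
      using Z by (auto simp: triv_quot_simps lin_closed_def form_simps(3))
    assume "z \<in> carrier (triv_quot Z)"
    then show "x \<oplus>\<^bsub>triv_quot Z\<^esub> y \<oplus>\<^bsub>triv_quot Z\<^esub> z = x \<oplus>\<^bsub>triv_quot Z\<^esub> (y \<oplus>\<^bsub>triv_quot Z\<^esub> z)"
      using \<open>x \<in> _\<close> \<open>y \<in> _\<close> by (auto simp: triv_quot_simps form_simps(4))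
  next
    show "zero (triv_quot Z) \<in> carrier (triv_quot Z)" using Z by (auto simp: triv_quot_simps lin_closed_def)
    fix x assume "x \<in> carrier (triv_quot Z)"
    then obtain \<omega> where \<omega>: "x = {\<omega>}" "\<omega> \<in> Z" by (auto simp: triv_quot_simps)
    show "zero (triv_quot Z) \<oplus>\<^bsub>triv_quot Z\<^esub> x = x" using \<omega> by (simp add: triv_quot_simps form_simps)
    show "\<exists>y\<in>carrier (triv_quot Z). y \<oplus>\<^bsub>triv_quot Z\<^esub> x = zero (triv_quot Z)"
      using \<omega> Z by (intro bexI[of _ "{form_smult (-1) \<omega>}"]) (auto simp: triv_quot_simps form_simps lin_closed_def)
  qed
  have "module class_ring (triv_quot Z)"
  proof (rule Module.moduleI)
    show "cring (class_ring :: complex ring)" by unfold_locales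
  qed (use Z ag in \<open>auto simp: triv_quot_simps lin_closed_def form_simps\<close>)
  moreover have "field (class_ring :: complex ring)" by unfold_locales
  ultimately show ?thesis by (simp add: vectorspace_def)
qed

lemma dim_triv_quot_eq:
  assumes Z: "lin_closed Z" and Z': "lin_closed Z'" and L: "bij_betw L Z Z'"
    and add: "\<And>\<omega> \<eta>. \<omega> \<in> Z \<Longrightarrow> \<eta> \<in> Z \<Longrightarrow> L (form_add \<omega> \<eta>) = form_add (L \<omega>) (L \<eta>)"
    and smult: "\<And>a \<omega>. \<omega> \<in> Z \<Longrightarrow> L (form_smult a \<omega>) = form_smult a (L \<omega>)"
  shows "vectorspace.dim class_ring (triv_quot Z) = vectorspace.dim class_ring (triv_quot Z')"
proof (rule dim_bij_hom[OF vectorspace_triv_quot[OF Z] vectorspace_triv_quot[OF Z'], where T="\<lambda>C. L ` C"])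
  show "(`) L \<in> module_hom class_ring (triv_quot Z) (triv_quot Z')"
    using L by (auto simp: module_hom_def triv_quot_simps add smult bij_betw_def)
  show "bij_betw ((`) L) (carrier (triv_quot Z)) (carrier (triv_quot Z'))"
    unfolding bij_betw_def triv_quot_simps
  proof
    show "inj_on ((`) L) ((\<lambda>\<omega>. {\<omega>}) ` Z)" using L by (auto simp: inj_on_def bij_betw_def)
    show "(`) L ` (\<lambda>\<omega>. {\<omega>}) ` Z = (\<lambda>\<omega>. {\<omega>}) ` Z'" using L by (auto simp: bij_betw_def image_image)
  qed
qed

section \<open>Charts and analytic subsets\<close>

lemma chart_inj: "is_chart n T c \<Longrightarrow> inj_on (snd c) (fst c)"
  unfolding is_chart_def
  by (metis homeomorphic_imp_injective_map inf.absorb_iff2 openin_subset topspace_subtopology)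

lemma chart_inv_left: "is_chart n T c \<Longrightarrow> x \<in> fst c \<Longrightarrow> chart_inv c (snd c x) = x"
  by (rule inv_into_f_f[OF chart_inj])

lemma chart_open_image:
  assumes c: "is_chart n T c" and A: "openin T A"
  shows "open_cspace n (snd c ` (fst c \<inter> A))"
proof -
  have "open_map (subtopology T (fst c)) (top_of_set (chart_image c)) (snd c)"
    using c homeomorphic_imp_open_map unfolding is_chart_def by blast
  moreover have "openin (subtopology T (fst c)) (fst c \<inter> A)"
    using A by (auto simp: openin_subtopology)
  ultimately have "openin (top_of_set (chart_image c)) (snd c ` (fst c \<inter> A))"
    by (simp add: open_map_def)
  then show ?thesis using c openin_trans unfolding is_chart_def by blast
qed

lemma chart_open_vimage:
  assumes c: "is_chart n T c" and B: "open_cspace n B"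
  shows "openin T {x\<in>fst c. snd c x \<in> B}"
proof -
  have o: "openin T (fst c)" using c by (simp add: is_chart_def)
  have cont: "continuous_map (subtopology T (fst c)) (top_of_set (chart_image c)) (snd c)"
    using c homeomorphic_imp_continuous_map unfolding is_chart_def by blast
  obtain S where S: "open S" "B = cspace n \<inter> S" using B by (auto simp: openin_open)
  have "openin (top_of_set (chart_image c)) (chart_image c \<inter> S)" using S(1) by (auto simp: openin_open)
  then have "openin (subtopology T (fst c)) {x \<in> topspace (subtopology T (fst c)). snd c x \<in> chart_image c \<inter> S}"
    by (rule openin_continuous_map_preimage[OF cont])
  moreover have "{x \<in> topspace (subtopology T (fst c)). snd c x \<in> chart_image c \<inter> S} = {x\<in>fst c. snd c x \<in> B}"
    using openin_subset[OF o] c S(2) open_cspace_subset[of n "chart_image c"] by (auto simp: is_chart_def)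
  ultimately show ?thesis using openin_open_subtopology[OF o] by simp
qed

lemma manifold_chart: "complex_manifold M \<Longrightarrow> c \<in> cm_atlas M \<Longrightarrow> is_chart (cm_dim M) (cm_top M) c"
  by (simp add: complex_manifold_def)

lemma biholo_continuous:
  assumes "biholo n U V \<Psi> \<Phi>"
  shows "continuous_on U \<Psi>" "continuous_on V \<Phi>"
proof -
  have "U \<subseteq> cspace n" "V \<subseteq> cspace n" using assms open_cspace_subset unfolding biholo_def by blast+
  then show "continuous_on U \<Psi>" "continuous_on V \<Phi>"
    using assms unfolding biholo_def by (auto intro!: continuous_on_cvecI[of n] simp: hol_fun_def subset_iff)
qed

lemma is_chart_biholo:
  assumes c: "is_chart n T c" and b: "biholo n U V \<Psi> \<Phi>" and U: "U \<subseteq> chart_image c"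
  shows "is_chart n T ({x\<in>fst c. snd c x \<in> U}, \<lambda>x. \<Psi> (snd c x))"
proof -
  let ?D = "{x\<in>fst c. snd c x \<in> U}"
  have Uo: "open_cspace n U" and Vo: "open_cspace n V" using b by (auto simp: biholo_def)
  have D: "openin T ?D" by (rule chart_open_vimage[OF c Uo])
  have Dtop: "fst c \<subseteq> topspace T" using c openin_subset by (auto simp: is_chart_def)
  have imD: "snd c ` ?D = U" using U by auto
  have im: "(\<lambda>x. \<Psi> (snd c x)) ` ?D = V"
  proof -
    have "\<Psi> ` U = V" using b unfolding biholo_def by (auto intro!: image_eqI[of _ \<Psi> "\<Phi> _"])
    then show ?thesis using imD by (metis image_image)
  qed
  have "homeomorphic_map (subtopology (subtopology T (fst c)) ?D) (subtopology (top_of_set (chart_image c)) U) (snd c)"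
  proof (rule homeomorphic_map_subtopologies)
    show "homeomorphic_map (subtopology T (fst c)) (top_of_set (chart_image c)) (snd c)" using c by (simp add: is_chart_def)
    show "snd c ` (topspace (subtopology T (fst c)) \<inter> ?D) = topspace (top_of_set (chart_image c)) \<inter> U"
      using imD Dtop U by auto
  qed
  moreover have "subtopology (subtopology T (fst c)) ?D = subtopology T ?D"
    by (simp add: subtopology_subtopology Int_absorb1 subset_eq)
  moreover have "subtopology (top_of_set (chart_image c)) U = top_of_set U"
    using U by (simp add: subtopology_subtopology Int_absorb1)
  ultimately have h1: "homeomorphic_map (subtopology T ?D) (top_of_set U) (snd c)" by simp
  have "homeomorphic_maps (top_of_set U) (top_of_set V) \<Psi> \<Phi>"
    using b biholo_continuous[OF b] unfolding homeomorphic_maps_def biholo_def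
    by (auto simp: continuous_map_in_subtopology)
  then have h2: "homeomorphic_map (top_of_set U) (top_of_set V) \<Psi>" using homeomorphic_maps_map by blast
  have "homeomorphic_map (subtopology T ?D) (top_of_set V) (\<Psi> \<circ> snd c)"
    by (rule homeomorphic_map_compose[OF h1 h2])
  then show ?thesis using D Vo im by (simp add: is_chart_def o_def)
qed

text \<open>Both transition maps factor through the given chart \<open>c\<close>, with \<Phi> or
  \<Psi> as the other factor. This is how coordinates found in \<open>cspace n\<close> become charts
  admissible in \<open>regular_point\<close>.\<close>

lemma hol_transition_biholo:
  assumes M: "complex_manifold M" and n: "cm_dim M = n" and c: "c \<in> cm_atlas M"
    and b: "biholo n U V \<Psi> \<Phi>" and U: "U \<subseteq> chart_image c"
  shows "holomorphic_chart M ({x\<in>fst c. snd c x \<in> U}, \<lambda>x. \<Psi> (snd c x))" (is "holomorphic_chart M ?c'")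
  unfolding holomorphic_chart_def n
proof (intro conjI ballI)
  have ch: "is_chart n (cm_top M) d" if "d \<in> cm_atlas M" for d using manifold_chart[OF M that] n by simp
  show ch': "is_chart n (cm_top M) ?c'" by (rule is_chart_biholo[OF ch[OF c] b U])
  have Uo: "open_cspace n U" using b by (simp add: biholo_def)
  fix d assume d: "d \<in> cm_atlas M"
  have ht: "hol_transition n c d" "hol_transition n d c" using M c d n by (auto simp: complex_manifold_def)
  have od: "openin (cm_top M) (fst e)" if "e \<in> cm_atlas M" for e using ch[OF that] by (simp add: is_chart_def)
  have o1: "open_cspace n (snd c ` (fst c \<inter> fst d))" by (rule chart_open_image[OF ch[OF c] od[OF d]])
  have oc': "openin (cm_top M) (fst ?c')" using ch' by (simp add: is_chart_def)
  show "hol_transition n ?c' d"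
    unfolding hol_transition_def
  proof (intro allI impI)
    fix i assume i: "i < n"
    let ?A = "snd ?c' ` (fst ?c' \<inter> fst d)"
    have A: "open_cspace n ?A" by (rule chart_open_image[OF ch' od[OF d]])
    have inv: "chart_inv ?c' z = chart_inv c (\<Phi> z)" "\<Phi> z \<in> snd c ` (fst c \<inter> fst d)" "z \<in> V" if z: "z \<in> ?A" for z
    proof -
      obtain x where x: "x \<in> fst c" "snd c x \<in> U" "x \<in> fst d" "z = \<Psi> (snd c x)" using z by auto
      have "chart_inv ?c' z = x" using chart_inv_left[OF ch', of x] x by simp
      moreover have Pz: "\<Phi> z = snd c x" using b x by (auto simp: biholo_def)
      ultimately show "chart_inv ?c' z = chart_inv c (\<Phi> z)" using chart_inv_left[OF ch[OF c] x(1)] by simp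
      show "\<Phi> z \<in> snd c ` (fst c \<inter> fst d)" using Pz x by blast
      show "z \<in> V" using b x by (auto simp: biholo_def)
    qed
    have "hol_fun n ?A (\<lambda>z. transition c d (\<Phi> z) i)"
    proof (rule hol_fun_compose[where F=\<Phi> and f="\<lambda>y. transition c d y i", OF _ o1 A])
      show "hol_fun n (snd c ` (fst c \<inter> fst d)) (\<lambda>y. transition c d y i)" using ht(1) i by (simp add: hol_transition_def)
      show "hol_fun n ?A (\<lambda>z. \<Phi> z k)" if "k < n" for k
        by (rule hol_fun_subset[of n V]) (use b that inv in \<open>auto simp: biholo_def\<close>)
    qed (use inv in blast)
    then show "hol_fun n ?A (\<lambda>z. transition ?c' d z i)"
      by (rule hol_fun_cong[OF A, rotated]) (simp only: transition_def inv(1))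
  qed
  show "hol_transition n d ?c'"
    unfolding hol_transition_def
  proof (intro allI impI)
    fix i assume i: "i < n"
    let ?A = "snd d ` (fst d \<inter> fst ?c')"
    have A: "open_cspace n ?A" by (rule chart_open_image[OF ch[OF d] oc'])
    have inU: "transition d c z \<in> U" if z: "z \<in> ?A" for z
      using z chart_inv_left[OF ch[OF d]] by (auto simp: transition_def)
    have "hol_fun n ?A (\<lambda>z. \<Psi> (transition d c z) i)"
    proof (rule hol_fun_compose[where F="transition d c" and f="\<lambda>y. \<Psi> y i", OF _ Uo A])
      show "hol_fun n U (\<lambda>y. \<Psi> y i)" using b i by (simp add: biholo_def)
      show "hol_fun n ?A (\<lambda>z. transition d c z k)" if "k < n" for k
        by (rule hol_fun_subset[of n "snd d ` (fst d \<inter> fst c)"]) (use ht(2) that in \<open>auto simp: hol_transition_def\<close>)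
    qed (rule inU)
    then show "hol_fun n ?A (\<lambda>z. transition d ?c' z i)"
      by (simp add: transition_def[abs_def])
  qed
qed

text \<open>In \<open>regular_point\<close> the vanishing coordinates are the last ones; exchanging
  two coordinates brings an equation in the \<open>j\<close>-th coordinate to that form.\<close>

lemma biholo_swap:
  assumes b: "biholo n U V \<Psi> \<Phi>" and j: "j < n" "k < n"
  shows "biholo n U {y\<in>cspace n. y \<circ> Transposition.transpose j k \<in> V}
    (\<lambda>z. \<Psi> z \<circ> Transposition.transpose j k) (\<lambda>y. \<Phi> (y \<circ> Transposition.transpose j k))"
proof -
  let ?t = "Transposition.transpose j k"
  let ?V = "{y\<in>cspace n. y \<circ> ?t \<in> V}"
  have tt: "y \<circ> ?t \<circ> ?t = y" for y :: cvec by (simp add: o_assoc[symmetric])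
  have tc: "y \<circ> ?t \<in> cspace n" if "y \<in> cspace n" for y :: cvec
    using that j by (auto simp: cspace_def Transposition.transpose_def)
  have tn: "?t i < n" if "i < n" for i using that j by (auto simp: Transposition.transpose_def)
  have "open_cspace n (cspace n)" using openin_topspace[of "top_of_set (cspace n)"] by simp
  then have Vo: "open_cspace n ?V"
  proof (rule open_cspace_vimage'[of n V "cspace n" "\<lambda>y. y \<circ> ?t", rotated 2])
    show "open_cspace n V" using b by (simp add: biholo_def)
    show "continuous_on (cspace n) (\<lambda>y. y \<circ> ?t)"
      unfolding o_def
      by (rule continuous_on_coordinatewise_then_product) (rule continuous_on_coord[OF continuous_on_id])
  qed (use tc in auto)
  have "hol_fun n ?V (\<lambda>y. \<Phi> (y \<circ> ?t) i)" if "i < n" for i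
  proof (rule hol_fun_compose[where F="\<lambda>y. y \<circ> ?t" and f="\<lambda>y. \<Phi> y i", OF _ _ Vo])
    show "hol_fun n ?V (\<lambda>z. (z \<circ> ?t) m)" for m using hol_fun_coord[of n ?V "?t m"] by simp
  qed (use b that in \<open>auto simp: biholo_def\<close>)
  moreover have "\<Psi> z \<circ> ?t \<in> ?V" if "z \<in> U" for z
    using b that tc open_cspace_subset[of n V] tt by (auto simp: biholo_def)
  ultimately show ?thesis using b Vo tn tt by (auto simp: biholo_def)
qed

context
  fixes M :: "'a cmanifold" and n :: nat and S :: "'a set"
  assumes M: "complex_manifold M" and n: "cm_dim M = n"
    and S: "analytic_subset M S" and codim: "codim_at_least M S 2"
begin

lemma chart_n: "c \<in> cm_atlas M \<Longrightarrow> is_chart n (cm_top M) c"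
  using manifold_chart[OF M] n by simp

lemma image_Diff:
  assumes "c \<in> cm_atlas M"
  shows "chart_image c - snd c ` (fst c \<inter> S) = snd c ` (fst c - S)"
  using chart_inj[OF chart_n[OF assms]] by (auto simp: inj_on_def)

text \<open>An interior point of \<open>S\<close> is regular of dimension \<open>n\<close>, as no
  coordinate is then required to vanish; codimension at least 2 excludes this.\<close>

lemma thin_in_chart:
  assumes c: "c \<in> cm_atlas M" and A: "open_cspace n A" "A \<subseteq> snd c ` (fst c \<inter> S)"
  shows "A = {}"
proof (rule ccontr)
  assume "A \<noteq> {}"
  then obtain x where x: "x \<in> fst c" "x \<in> S" "snd c x \<in> A" using A(2) by blast
  have "biholo n A A (\<lambda>z. z) (\<lambda>z. z)" using A(1) by (simp add: biholo_def hol_fun_coord)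
  from hol_transition_biholo[OF M n c this]
  have hc: "holomorphic_chart M ({x\<in>fst c. snd c x \<in> A}, \<lambda>x. snd c x)" using A(2) by blast
  have sub: "{x\<in>fst c. snd c x \<in> A} \<subseteq> S"
    using A(2) chart_inj[OF chart_n[OF c]] by (auto simp: inj_on_def)
  have "regular_point M S n x"
    unfolding regular_point_def
  proof (intro conjI exI)
    show "holomorphic_chart M ({x\<in>fst c. snd c x \<in> A}, \<lambda>x. snd c x)" by (rule hc)
  qed (use x sub n in auto)
  then show False using codim n unfolding codim_at_least_def by force
qed

lemma loc_analytic_in_chart:
  assumes c: "c \<in> cm_atlas M"
  shows "loc_analytic n (chart_image c) (snd c ` (fst c \<inter> S))" (is "loc_analytic n ?W ?S")
proof -
  have ctop: "fst c \<subseteq> points M" using chart_n[OF c] openin_subset by (auto simp: is_chart_def)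
  have inv: "chart_inv c (snd c x) = x" if "x \<in> fst c" for x using chart_inv_left[OF chart_n[OF c] that] .
  show ?thesis
    unfolding loc_analytic_def
  proof
    fix z assume "z \<in> ?W"
    then obtain x where x: "x \<in> fst c" "z = snd c x" by blast
    then have "x \<in> points M" using ctop by blast
    then obtain U F where U: "openin (cm_top M) U" "x \<in> U" "finite F" "\<forall>f\<in>F. holomorphic_fun_on M U f"
      "S \<inter> U = {y\<in>U. \<forall>f\<in>F. f y = 0}"
      using S unfolding analytic_subset_def by meson
    let ?V = "snd c ` (fst c \<inter> U)" and ?F = "(\<lambda>f z. f (chart_inv c z)) ` F"
    show "\<exists>V F. open_cspace n V \<and> z \<in> V \<and> V \<subseteq> ?W \<and> finite F \<and> (\<forall>f\<in>F. hol_fun n V f) \<and> ?S \<inter> V = {y\<in>V. \<forall>f\<in>F. f y = 0}"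
    proof (intro exI conjI)
      show "open_cspace n ?V" by (rule chart_open_image[OF chart_n[OF c] U(1)])
      show "\<forall>f\<in>?F. hol_fun n ?V f" using U(4) c n by (auto simp: holomorphic_fun_on_def)
      have "?S \<inter> ?V = snd c ` (fst c \<inter> (S \<inter> U))"
        using chart_inj[OF chart_n[OF c]] by (auto simp: inj_on_def)
      also have "\<dots> = {y\<in>?V. \<forall>f\<in>?F. f y = 0}" unfolding U(5) using inv by auto
      finally show "?S \<inter> ?V = {y\<in>?V. \<forall>f\<in>?F. f y = 0}" .
    qed (use x U(2,3) in auto)
  qed
qed

lemma openin_complement: "openin (cm_top M) (points M - S)"
proof -
  have "points M - S = (\<Union>c\<in>cm_atlas M. {x\<in>fst c. snd c x \<in> snd c ` (fst c - S)})"
  proof -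
    have "{x\<in>fst c. snd c x \<in> snd c ` (fst c - S)} = fst c - S" if "c \<in> cm_atlas M" for c
      using chart_inj[OF chart_n[OF that]] by (auto simp: inj_on_def)
    moreover have "points M = \<Union> (fst ` cm_atlas M)" using M by (simp add: complex_manifold_def)
    ultimately show ?thesis by auto
  qed
  moreover have "openin (cm_top M) {x\<in>fst c. snd c x \<in> snd c ` (fst c - S)}" if c: "c \<in> cm_atlas M" for c
  proof (rule chart_open_vimage[OF chart_n[OF c]])
    have "open_cspace n (chart_image c)" using chart_n[OF c] by (simp add: is_chart_def)
    from loc_analytic_open[OF loc_analytic_in_chart[OF c] this]
    show "open_cspace n (snd c ` (fst c - S))" by (simp add: image_Diff[OF c])
  qed
  ultimately show ?thesis by (simp only: openin_Union) (auto intro!: openin_Union)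
qed

lemma thin_open:
  assumes A: "openin (cm_top M) A" "A \<noteq> {}"
  shows "A - S \<noteq> {}"
proof
  assume "A - S = {}"
  then have AS: "A \<subseteq> S" by blast
  obtain x where x: "x \<in> A" using A(2) by blast
  then have "x \<in> points M" using openin_subset[OF A(1)] by blast
  then obtain c where c: "c \<in> cm_atlas M" "x \<in> fst c" using M by (auto simp: complex_manifold_def)
  have "snd c ` (fst c \<inter> A) = {}"
    by (rule thin_in_chart[OF c(1) chart_open_image[OF chart_n[OF c(1)] A(1)]]) (use AS in blast)
  then show False using x c by blast
qed

text \<open>A description of \<open>S\<close> as a coordinate hyperplane would make some point
  regular of dimension \<open>n - 1\<close>, against codimension at least 2. Together with
  \<open>thin_in_chart\<close> this meets the conditions of \<open>hol_extension\<close>.\<close>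

lemma extension_in_chart:
  assumes c: "c \<in> cm_atlas M" and f: "hol_fun n (snd c ` (fst c - S)) f"
  obtains u where "hol_fun n (chart_image c) u" "\<And>z. z \<in> snd c ` (fst c - S) \<Longrightarrow> u z = f z"
proof -
  let ?W = "chart_image c" and ?S = "snd c ` (fst c \<inter> S)"
  have W: "open_cspace n ?W" using chart_n[OF c] by (simp add: is_chart_def)
  have an: "loc_analytic n ?W ?S" by (rule loc_analytic_in_chart[OF c])
  have nostr: False
    if j: "j < n" and b: "biholo n U V \<Psi> \<Phi>" and U: "U \<subseteq> ?W" "U \<inter> ?S \<noteq> {}" "?S \<inter> U = {z\<in>U. \<Psi> z j = 0}" for j U V \<Psi> \<Phi>
  proof -
    \<comment> \<open>\<open>j < n\<close> makes the dimension positive, so there is a last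
      coordinate \<open>n - 1\<close> to exchange with.\<close>
    let ?t = "Transposition.transpose j (n - 1)"
    let ?c = "({x\<in>fst c. snd c x \<in> U}, \<lambda>x. \<Psi> (snd c x) \<circ> ?t)"
    have n1: "n - 1 < n" using j by simp
    have hc: "holomorphic_chart M ?c" by (rule hol_transition_biholo[OF M n c biholo_swap[OF b j n1] U(1)])
    obtain x where x: "x \<in> fst c" "x \<in> S" "snd c x \<in> U" using U(2) by blast
    have "x \<in> S \<longleftrightarrow> \<Psi> (snd c x) j = 0" if "x \<in> fst c" "snd c x \<in> U" for x
    proof -
      have "x \<in> S \<longleftrightarrow> snd c x \<in> ?S" using that(1) chart_inj[OF chart_n[OF c]] by (auto simp: inj_on_def)
      also have "\<dots> \<longleftrightarrow> \<Psi> (snd c x) j = 0" using U(3) that(2) by blast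
      finally show ?thesis .
    qed
    moreover have "(n - 1 \<le> i \<and> i < n) \<longleftrightarrow> i = n - 1" for i using j by auto
    ultimately have "regular_point M S (n - 1) x"
      unfolding regular_point_def n
      by (intro conjI exI[of _ ?c]) (use x hc in auto)
    then show False using codim n j unfolding codim_at_least_def by force
  qed
  have f': "hol_fun n (?W - ?S) f" using f image_Diff[OF c] by simp
  show ?thesis
  proof (rule hol_extension[OF W an _ _ f'])
    show "A = {}" if "open_cspace n A" "A \<subseteq> ?S" for A using that by (rule thin_in_chart[OF c])
    show False if "j < n" "biholo n U V \<Psi> \<Phi>" "U \<subseteq> ?W" "U \<inter> ?S \<noteq> {}" "?S \<inter> U = {z\<in>U. \<Psi> z j = 0}" for j U V \<Psi> \<Phi>
      using that by (rule nostr)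
    show thesis if "hol_fun n ?W u" "\<And>z. z \<in> ?W - ?S \<Longrightarrow> u z = f z" for u
      by (rule \<open>\<And>u. hol_fun n ?W u \<Longrightarrow> (\<And>z. z \<in> snd c ` (fst c - S) \<Longrightarrow> u z = f z) \<Longrightarrow> thesis\<close>[OF that(1)])
        (use that(2) image_Diff[OF c] in simp)
  qed
qed

end

section \<open>Pullback along a bimeromorphic map\<close>

definition coord :: "('a \<Rightarrow> 'b) \<Rightarrow> 'a chart \<Rightarrow> 'b chart \<Rightarrow> cvec \<Rightarrow> cvec" where
  "coord \<phi> c d z = snd d (\<phi> (chart_inv c z))"

definition coord_dom :: "'a set \<Rightarrow> ('a \<Rightarrow> 'b) \<Rightarrow> 'a chart \<Rightarrow> 'b chart \<Rightarrow> cvec set" where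
  "coord_dom U \<phi> c d = snd c ` (fst c \<inter> {x\<in>U. \<phi> x \<in> fst d})"

text \<open>Holomorphy on an open set, expressed in pairs of charts. Openness of
  \<open>coord_dom\<close> encodes continuity, and a common dimension lets both sides share their
  multi-indices.\<close>

definition holo_between :: "nat \<Rightarrow> 'a cmanifold \<Rightarrow> 'a set \<Rightarrow> 'b cmanifold \<Rightarrow> ('a \<Rightarrow> 'b) \<Rightarrow> bool" where
  "holo_between n M U N \<phi> \<longleftrightarrow> complex_manifold M \<and> complex_manifold N \<and> cm_dim M = n \<and> cm_dim N = n \<and>
     openin (cm_top M) U \<and> \<phi> ` U \<subseteq> points N \<and>
     (\<forall>c\<in>cm_atlas M. \<forall>d\<in>cm_atlas N. open_cspace n (coord_dom U \<phi> c d) \<and>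
        (\<forall>i<n. hol_fun n (coord_dom U \<phi> c d) (\<lambda>z. coord \<phi> c d z i)))"

lemma coord_snd:
  "is_chart n T c \<Longrightarrow> x \<in> fst c \<Longrightarrow> coord \<phi> c d (snd c x) = snd d (\<phi> x)"
  by (simp add: coord_def chart_inv_left)

lemma transition_coord: "transition c c' = coord (\<lambda>x. x) c c'"
  by (simp add: transition_def coord_def fun_eq_iff)

lemma holo_between_chart:
  "holo_between n M U N \<phi> \<Longrightarrow> c \<in> cm_atlas M \<Longrightarrow> is_chart n (cm_top M) c"
  "holo_between n M U N \<phi> \<Longrightarrow> d \<in> cm_atlas N \<Longrightarrow> is_chart n (cm_top N) d"
  by (auto simp: holo_between_def dest: manifold_chart)

text \<open>Transition maps are the coordinate form of the identity, so
  \<open>pullback_chain\<close> also covers changes of charts.\<close>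

lemma holo_between_id:
  assumes M: "complex_manifold M" "cm_dim M = n"
  shows "holo_between n M (points M) M (\<lambda>x. x)"
proof -
  have eq: "coord_dom (points M) (\<lambda>x. x) c d = snd c ` (fst c \<inter> fst d)" if "c \<in> cm_atlas M" for c d
  proof -
    have "fst c \<subseteq> points M" using manifold_chart[OF M(1) that] openin_subset by (auto simp: is_chart_def)
    then show ?thesis by (auto simp: coord_dom_def)
  qed
  have "open_cspace n (snd c ` (fst c \<inter> fst d))" if "c \<in> cm_atlas M" "d \<in> cm_atlas M" for c d
  proof (rule chart_open_image)
    show "is_chart n (cm_top M) c" using manifold_chart[OF M(1) that(1)] M(2) by simp
    show "openin (cm_top M) (fst d)" using manifold_chart[OF M(1) that(2)] by (simp add: is_chart_def)
  qed
  moreover have "hol_fun n (snd c ` (fst c \<inter> fst d)) (\<lambda>z. coord (\<lambda>x. x) c d z i)"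
    if "c \<in> cm_atlas M" "d \<in> cm_atlas M" "i < n" for c d i
    using M that unfolding transition_coord[symmetric] complex_manifold_def hol_transition_def by blast
  ultimately show ?thesis
    unfolding holo_between_def using M eq by simp
qed

lemma holo_between_coord:
  assumes "holo_between n M U N \<phi>" "c \<in> cm_atlas M" "d \<in> cm_atlas N"
  shows "hol_map n (coord_dom U \<phi> c d) (chart_image d) (coord \<phi> c d)"
  unfolding hol_map_def
proof (intro conjI ballI)
  show "open_cspace n (chart_image d)" using holo_between_chart(2)[OF assms(1,3)] by (simp add: is_chart_def)
  show "coord \<phi> c d z \<in> chart_image d" if z: "z \<in> coord_dom U \<phi> c d" for z
  proof -
    obtain x where "x \<in> fst c" "\<phi> x \<in> fst d" "z = snd c x" using z by (auto simp: coord_dom_def)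
    then show ?thesis using coord_snd[OF holo_between_chart(1)[OF assms(1,2)], of x \<phi> d] by simp
  qed
qed (use assms in \<open>auto simp: holo_between_def\<close>)

text \<open>The domain is first shrunk to \<open>?V'\<close>, where the intermediate point lies in
  the domain of the second map; the rest is functoriality of the pullback.\<close>

lemma pullback_chain:
  assumes \<phi>: "holo_between n M1 U1 M2 \<phi>" and \<psi>: "holo_between n M2 U2 M3 \<psi>"
    and c: "c1 \<in> cm_atlas M1" "c2 \<in> cm_atlas M2" "c3 \<in> cm_atlas M3"
    and x: "x \<in> U1" "x \<in> fst c1" "\<phi> x \<in> U2" "\<phi> x \<in> fst c2" "\<psi> (\<phi> x) \<in> fst c3"
    and I: "I \<in> multi_index n p"
  shows "pullback n p (coord \<phi> c1 c2) (pullback n p (coord \<psi> c2 c3) w) (snd c1 x) I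
     = pullback n p (coord (\<lambda>x. \<psi> (\<phi> x)) c1 c3) w (snd c1 x) I"
proof -
  let ?V = "coord_dom U1 \<phi> c1 c2" and ?W = "coord_dom U2 \<psi> c2 c3"
  let ?F = "coord \<phi> c1 c2" and ?G = "coord \<psi> c2 c3"
  note ch1 = holo_between_chart(1)[OF \<phi> c(1)] and ch2 = holo_between_chart(2)[OF \<phi> c(2)]
  have F: "hol_map n ?V (chart_image c2) ?F" by (rule holo_between_coord[OF \<phi> c(1,2)])
  have G: "hol_map n ?W (chart_image c3) ?G" by (rule holo_between_coord[OF \<psi> c(2,3)])
  let ?V' = "{z\<in>?V. ?F z \<in> ?W}"
  have Fcs: "?F z \<in> cspace n" if "z \<in> ?V" for z
    using F that open_cspace_subset[of n "chart_image c2"] by (auto simp: hol_map_def)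
  have V': "open_cspace n ?V'"
  proof (rule open_cspace_vimage')
    show "open_cspace n ?W" using G by (simp add: hol_map_def)
    show "open_cspace n ?V" using F by (simp add: hol_map_def)
    show "continuous_on ?V ?F"
      by (rule continuous_on_cvecI[OF _ Fcs]) (use F in \<open>auto simp: hol_map_def hol_fun_def\<close>)
  qed (use Fcs in blast)
  have F': "hol_map n ?V' ?W ?F"
    using F G V' unfolding hol_map_def by (auto intro: hol_fun_subset[of n ?V])
  have xV: "snd c1 x \<in> ?V'"
    using x coord_snd[OF ch1 x(2), of \<phi> c2] unfolding coord_dom_def by auto
  have "pullback n p ?F (pullback n p ?G w) (snd c1 x) I = pullback n p (\<lambda>z. ?G (?F z)) w (snd c1 x) I"
    by (rule pullback_compose[OF F' _ xV I]) (use G in \<open>auto simp: hol_map_def\<close>)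
  also have "\<dots> = pullback n p (coord (\<lambda>x. \<psi> (\<phi> x)) c1 c3) w (snd c1 x) I"
  proof (rule pullback_cong[OF V' xV _ _ I])
    show eq: "?G (?F y) = coord (\<lambda>x. \<psi> (\<phi> x)) c1 c3 y" if "y \<in> ?V'" for y
    proof -
      obtain x' where "x' \<in> fst c1" "\<phi> x' \<in> fst c2" "y = snd c1 x'" using \<open>y \<in> ?V'\<close> by (auto simp: coord_dom_def)
      then show ?thesis by (simp add: coord_snd[OF ch1] coord_snd[OF ch2])
    qed
  qed simp
  finally show ?thesis .
qed

text \<open>Continuity is recovered from the charts: near each of its points the set contains the
  preimage of an open set under a continuous coordinate expression.\<close>

lemma holo_between_open_vimage:
  assumes \<phi>: "holo_between n M U N \<phi>" and B: "openin (cm_top N) B"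
  shows "openin (cm_top M) {x\<in>U. \<phi> x \<in> B}"
proof (subst openin_subopen, rule ballI)
  fix x assume x: "x \<in> {x\<in>U. \<phi> x \<in> B}"
  have "x \<in> points M" "\<phi> x \<in> points N"
    using x \<phi> openin_subset[of "cm_top M" U] by (auto simp: holo_between_def)
  then obtain c d where c: "c \<in> cm_atlas M" "x \<in> fst c" and d: "d \<in> cm_atlas N" "\<phi> x \<in> fst d"
    using \<phi> unfolding holo_between_def complex_manifold_def by auto
  note chc = holo_between_chart(1)[OF \<phi> c(1)] and chd = holo_between_chart(2)[OF \<phi> d(1)]
  have F: "hol_map n (coord_dom U \<phi> c d) (chart_image d) (coord \<phi> c d)" by (rule holo_between_coord[OF \<phi> c(1) d(1)])
  have Fcs: "coord \<phi> c d z \<in> cspace n" if "z \<in> coord_dom U \<phi> c d" for z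
    using F that open_cspace_subset[of n "chart_image d"] by (auto simp: hol_map_def)
  let ?A = "{z\<in>coord_dom U \<phi> c d. coord \<phi> c d z \<in> snd d ` (fst d \<inter> B)}"
  have "open_cspace n ?A"
  proof (rule open_cspace_vimage')
    show "open_cspace n (snd d ` (fst d \<inter> B))" by (rule chart_open_image[OF chd B])
    show "open_cspace n (coord_dom U \<phi> c d)" using F by (simp add: hol_map_def)
    show "continuous_on (coord_dom U \<phi> c d) (coord \<phi> c d)"
      by (rule continuous_on_cvecI[OF _ Fcs]) (use F in \<open>auto simp: hol_map_def hol_fun_def\<close>)
  qed (use Fcs in blast)
  then have "openin (cm_top M) {x\<in>fst c. snd c x \<in> ?A}" by (rule chart_open_vimage[OF chc])
  moreover have "x \<in> {x\<in>fst c. snd c x \<in> ?A}"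
    using x c d coord_snd[OF chc c(2), of \<phi> d] by (auto simp: coord_dom_def)
  moreover have "{x\<in>fst c. snd c x \<in> ?A} \<subseteq> {x\<in>U. \<phi> x \<in> B}"
  proof
    fix x' assume x': "x' \<in> {x\<in>fst c. snd c x \<in> ?A}"
    then obtain x'' where x'': "x'' \<in> fst c" "x'' \<in> U" "\<phi> x'' \<in> fst d" "snd c x' = snd c x''" by (auto simp: coord_dom_def)
    then have eq: "x' = x''" using chart_inj[OF chc] x' by (auto simp: inj_on_def)
    have "snd d (\<phi> x') \<in> snd d ` (fst d \<inter> B)" using x' coord_snd[OF chc, of x' \<phi> d] by auto
    then show "x' \<in> {x\<in>U. \<phi> x \<in> B}" using chart_inj[OF chd] x'' eq by (auto simp: inj_on_def)
  qed
  ultimately show "\<exists>A. openin (cm_top M) A \<and> x \<in> A \<and> A \<subseteq> {x\<in>U. \<phi> x \<in> B}" by blast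
qed

lemma continuous_eq_dense:
  fixes u v :: "cvec \<Rightarrow> complex"
  assumes V: "open_cspace n V" and uv: "continuous_on V u" "continuous_on V v"
    and dense: "\<And>A. open_cspace n A \<Longrightarrow> A \<noteq> {} \<Longrightarrow> A \<subseteq> V \<Longrightarrow> \<exists>z\<in>A. u z = v z" and z: "z \<in> V"
  shows "u z = v z"
proof (rule ccontr)
  assume ne: "u z \<noteq> v z"
  let ?A = "{y\<in>V. u y - v y \<in> - {0}}"
  have "open_cspace n ?A" using uv by (intro open_cspace_Collect[OF V] continuous_on_diff) auto
  moreover have "?A \<noteq> {}" using ne z by auto
  ultimately have "\<exists>z\<in>?A. u z = v z" by (rule dense) auto
  then show False by simp
qed

text \<open>The assumptions are symmetric in the two sides, so each result also holds with \<phi>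
  and \<psi> interchanged. The maps are inverse only at points that avoid both exceptional sets;
  density makes these points decide equalities of continuous functions.\<close>

locale bimero =
  fixes n :: nat and X :: "'a cmanifold" and S :: "'a set" and \<phi> :: "'a \<Rightarrow> 'b"
    and Y :: "'b cmanifold" and T :: "'b set" and \<psi> :: "'b \<Rightarrow> 'a"
  assumes S: "analytic_subset X S" "codim_at_least X S 2"
    and T: "analytic_subset Y T" "codim_at_least Y T 2"
    and \<phi>: "holo_between n X (points X - S) Y \<phi>" and \<psi>: "holo_between n Y (points Y - T) X \<psi>"
    and \<psi>\<phi>: "\<And>x. x \<in> points X \<Longrightarrow> x \<notin> S \<Longrightarrow> \<phi> x \<notin> T \<Longrightarrow> \<psi> (\<phi> x) = x"
    and \<phi>\<psi>: "\<And>y. y \<in> points Y \<Longrightarrow> y \<notin> T \<Longrightarrow> \<psi> y \<notin> S \<Longrightarrow> \<phi> (\<psi> y) = y"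
    and denseX: "\<And>A. openin (cm_top X) A \<Longrightarrow> A \<noteq> {} \<Longrightarrow> \<exists>x\<in>A. x \<notin> S \<and> \<phi> x \<notin> T"
    and denseY: "\<And>A. openin (cm_top Y) A \<Longrightarrow> A \<noteq> {} \<Longrightarrow> \<exists>y\<in>A. y \<notin> T \<and> \<psi> y \<notin> S"
begin

lemma swap: "bimero n Y T \<psi> X S \<phi>"
proof (rule bimero.intro)
  show "\<phi> (\<psi> y) = y" if "y \<in> points Y" "y \<notin> T" "\<psi> y \<notin> S" for y using that by (rule \<phi>\<psi>)
  show "\<psi> (\<phi> x) = x" if "x \<in> points X" "x \<notin> S" "\<phi> x \<notin> T" for x using that by (rule \<psi>\<phi>)
  show "\<exists>y\<in>A. y \<notin> T \<and> \<psi> y \<notin> S" if "openin (cm_top Y) A" "A \<noteq> {}" for A using that by (rule denseY)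
  show "\<exists>x\<in>A. x \<notin> S \<and> \<phi> x \<notin> T" if "openin (cm_top X) A" "A \<noteq> {}" for A using that by (rule denseX)
qed (rule S T \<phi> \<psi>)+

lemma X: "complex_manifold X" "cm_dim X = n" and Y: "complex_manifold Y" "cm_dim Y = n"
  using \<phi> by (auto simp: holo_between_def)

lemma chartX: "c \<in> cm_atlas X \<Longrightarrow> is_chart n (cm_top X) c" and chartY: "d \<in> cm_atlas Y \<Longrightarrow> is_chart n (cm_top Y) d"
  by (rule holo_between_chart(1)[OF \<phi>], assumption) (rule holo_between_chart(2)[OF \<phi>])

lemma chart_points: "c \<in> cm_atlas X \<Longrightarrow> x \<in> fst c \<Longrightarrow> x \<in> points X"
proof -
  assume c: "c \<in> cm_atlas X" and x: "x \<in> fst c"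
  have "openin (cm_top X) (fst c)" using chartX[OF c] by (simp add: is_chart_def)
  from subsetD[OF openin_subset[OF this] x] show ?thesis .
qed

lemma imageX_open_cspace: "c \<in> cm_atlas X \<Longrightarrow> open_cspace n (chart_image c)"
  by (drule chartX) (simp add: is_chart_def)

text \<open>A relation instead of an operation: off \<open>S\<close> the coefficients of \<eta> are
  prescribed, but across \<open>S\<close> there is no formula for them. It ranges over all pairs of
  charts, so no choice of a chart enters.\<close>

definition pull :: "'b cform \<Rightarrow> 'a cform \<Rightarrow> nat \<Rightarrow> bool" where
  "pull \<omega> \<eta> p \<longleftrightarrow> (\<forall>c\<in>cm_atlas X. \<forall>d\<in>cm_atlas Y. \<forall>x\<in>fst c. x \<notin> S \<longrightarrow> \<phi> x \<in> fst d \<longrightarrow>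
     (\<forall>I\<in>multi_index n p. \<eta> c (snd c x) I {} = pullback n p (coord \<phi> c d) (\<lambda>y K. \<omega> d y K {}) (snd c x) I))"

lemma \<phi>_in_chart:
  assumes "x \<in> points X" "x \<notin> S"
  obtains d where "d \<in> cm_atlas Y" "\<phi> x \<in> fst d"
proof -
  have "\<phi> x \<in> points Y" using assms \<phi> by (auto simp: holo_between_def)
  then show ?thesis using Y(1) that by (auto simp: complex_manifold_def)
qed

lemma openin_good: "openin (cm_top X) {x\<in>points X. x \<notin> S \<and> \<phi> x \<notin> T}"
proof -
  have "openin (cm_top X) {x\<in>points X - S. \<phi> x \<in> points Y - T}"
    by (rule holo_between_open_vimage[OF \<phi> openin_complement[OF Y T]])
  moreover have "{x\<in>points X - S. \<phi> x \<in> points Y - T} = {x\<in>points X. x \<notin> S \<and> \<phi> x \<notin> T}"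
    using \<phi> by (auto simp: holo_between_def)
  ultimately show ?thesis by simp
qed

lemma dense_in_chart:
  assumes c: "c \<in> cm_atlas X" and A: "open_cspace n A" "A \<noteq> {}" "A \<subseteq> chart_image c"
  obtains x where "x \<in> fst c" "snd c x \<in> A" "x \<notin> S" "\<phi> x \<notin> T"
proof -
  have "openin (cm_top X) {x\<in>fst c. snd c x \<in> A}" by (rule chart_open_vimage[OF chartX[OF c] A(1)])
  moreover have "{x\<in>fst c. snd c x \<in> A} \<noteq> {}" using A(2,3) by blast
  ultimately obtain x where "x \<in> {x\<in>fst c. snd c x \<in> A}" "x \<notin> S" "\<phi> x \<notin> T" using denseX by blast
  then show ?thesis using that by blast
qed

text \<open>The chart form of density: identities between coefficients are checked only where both
  exceptional sets are avoided.\<close>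

lemma eq_on_chart:
  assumes c: "c \<in> cm_atlas X" and V: "open_cspace n V" "V \<subseteq> chart_image c"
    and uv: "continuous_on V u" "continuous_on V v"
    and eq: "\<And>x. x \<in> fst c \<Longrightarrow> snd c x \<in> V \<Longrightarrow> x \<notin> S \<Longrightarrow> \<phi> x \<notin> T \<Longrightarrow> u (snd c x) = (v (snd c x) :: complex)"
    and z: "z \<in> V"
  shows "u z = v z"
proof (rule continuous_eq_dense[OF V(1) uv _ z])
  fix A assume A: "open_cspace n A" "A \<noteq> {}" "A \<subseteq> V"
  obtain x where "x \<in> fst c" "snd c x \<in> A" "x \<notin> S" "\<phi> x \<notin> T"
    using dense_in_chart[OF c A(1,2)] A(3) V(2) by blast
  then show "\<exists>z\<in>A. u z = v z" using eq A(3) by blast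
qed

lemma cocycle:
  assumes "\<omega> \<in> BC_cocycles X p 0"
  shows "\<And>c z I J. \<not> (c \<in> cm_atlas X \<and> z \<in> chart_image c \<and> I \<in> multi_index n p \<and> J = {}) \<Longrightarrow> \<omega> c z I J = 0"
    "\<And>c I. c \<in> cm_atlas X \<Longrightarrow> hol_fun n (chart_image c) (\<lambda>z. \<omega> c z I {})"
    "\<And>c c' x I. c \<in> cm_atlas X \<Longrightarrow> c' \<in> cm_atlas X \<Longrightarrow> x \<in> fst c \<Longrightarrow> x \<in> fst c' \<Longrightarrow> I \<in> multi_index n p \<Longrightarrow>
        \<omega> c (snd c x) I {} = pullback n p (transition c c') (\<lambda>y K. \<omega> c' y K {}) (snd c x) I"
    "\<And>c z I. c \<in> cm_atlas X \<Longrightarrow> z \<in> chart_image c \<Longrightarrow> I \<in> multi_index n (Suc p) \<Longrightarrow> ext_deriv (\<lambda>y I. \<omega> c y I {}) z I = 0"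
proof -
  note iff = assms[unfolded BC_cocycles_iff[OF X]]
  show "\<omega> c z I J = 0" if "\<not> (c \<in> cm_atlas X \<and> z \<in> chart_image c \<and> I \<in> multi_index n p \<and> J = {})" for c z I J
    by (rule iff[THEN conjunct1, rule_format, OF that])
  show "hol_fun n (chart_image c) (\<lambda>z. \<omega> c z I {})" if "c \<in> cm_atlas X" for c I
    by (rule iff[THEN conjunct2, THEN conjunct1, rule_format, OF that])
  show "\<omega> c (snd c x) I {} = pullback n p (transition c c') (\<lambda>y K. \<omega> c' y K {}) (snd c x) I"
    if "c \<in> cm_atlas X" "c' \<in> cm_atlas X" "x \<in> fst c" "x \<in> fst c'" "I \<in> multi_index n p" for c c' x I
    by (rule iff[THEN conjunct2, THEN conjunct2, THEN conjunct1, rule_format]) (use that in auto)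
  show "ext_deriv (\<lambda>y I. \<omega> c y I {}) z I = 0" if "c \<in> cm_atlas X" "z \<in> chart_image c" "I \<in> multi_index n (Suc p)" for c z I
    by (rule iff[THEN conjunct2, THEN conjunct2, THEN conjunct2, rule_format, OF that])
qed

lemma pull_unique:
  assumes \<eta>: "\<eta> \<in> BC_cocycles X p 0" "\<eta>' \<in> BC_cocycles X p 0" and p: "pull \<omega> \<eta> p" "pull \<omega> \<eta>' p"
  shows "\<eta> = \<eta>'"
proof (intro ext)
  fix c z I J
  show "\<eta> c z I J = \<eta>' c z I J"
  proof (cases "c \<in> cm_atlas X \<and> z \<in> chart_image c \<and> I \<in> multi_index n p \<and> J = {}")
    case True
    then have c: "c \<in> cm_atlas X" and z: "z \<in> chart_image c" and I: "I \<in> multi_index n p" by auto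
    have "\<eta> c z I {} = \<eta>' c z I {}"
    proof (rule eq_on_chart[OF c imageX_open_cspace[OF c] order_refl _ _ _ z, where u="\<lambda>z. \<eta> c z I {}" and v="\<lambda>z. \<eta>' c z I {}"])
      show "continuous_on (chart_image c) (\<lambda>z. \<eta> c z I {})" "continuous_on (chart_image c) (\<lambda>z. \<eta>' c z I {})"
        using cocycle(2)[OF \<eta>(1) c] cocycle(2)[OF \<eta>(2) c] by (auto simp: hol_fun_def)
      fix x assume x: "x \<in> fst c" "x \<notin> S"
      obtain d where "d \<in> cm_atlas Y" "\<phi> x \<in> fst d" using \<phi>_in_chart chart_points[OF c x(1)] x(2) by blast
      then show "\<eta> c (snd c x) I {} = \<eta>' c (snd c x) I {}" using p c x I unfolding pull_def by simp
    qed
    then show ?thesis using True by simp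
  next
    case False
    then show ?thesis using cocycle(1)[OF \<eta>(1)] cocycle(1)[OF \<eta>(2)] by simp
  qed
qed

end

text \<open>Where both exceptional sets are avoided, pulling \<eta> back along \<psi> amounts to
  pulling \<omega> back along \<open>\<phi> \<circ> \<psi>\<close>, the identity; continuity extends
  the equality to the domain of \<psi>.\<close>

lemma (in bimero) pull_inverse:
  assumes \<omega>: "\<omega> \<in> BC_cocycles Y p 0" and \<eta>: "\<eta> \<in> BC_cocycles X p 0" and p: "pull \<omega> \<eta> p"
  shows "bimero.pull n Y T \<psi> X \<eta> \<omega> p"
proof -
  interpret Y: bimero n Y T \<psi> X S \<phi> by (rule swap)
  show ?thesis
    unfolding Y.pull_def
  proof (intro ballI impI)
    fix d c y I
    assume d: "d \<in> cm_atlas Y" and c: "c \<in> cm_atlas X" and y: "y \<in> fst d" "y \<notin> T" "\<psi> y \<in> fst c" and I: "I \<in> multi_index n p"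
    let ?V = "coord_dom (points Y - T) \<psi> d c" and ?F = "coord \<psi> d c"
    have F: "hol_map n ?V (chart_image c) ?F" by (rule holo_between_coord[OF \<psi> d c])
    have V: "open_cspace n ?V" using F by (simp add: hol_map_def)
    have yp: "y \<in> points Y" by (rule Y.chart_points[OF d y(1)])
    have Vsub: "?V \<subseteq> chart_image d" by (auto simp: coord_dom_def)
    show "\<omega> d (snd d y) I {} = pullback n p ?F (\<lambda>z K. \<eta> c z K {}) (snd d y) I"
    proof (rule Y.eq_on_chart[OF d V Vsub, where u="\<lambda>z. \<omega> d z I {}" and v="\<lambda>z. pullback n p ?F (\<lambda>z K. \<eta> c z K {}) z I"])
      show "continuous_on ?V (\<lambda>z. \<omega> d z I {})"
        using hol_fun_subset[OF Y.cocycle(2)[OF \<omega> d] Vsub] by (auto simp: hol_fun_def)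
      show "continuous_on ?V (\<lambda>z. pullback n p ?F (\<lambda>z K. \<eta> c z K {}) z I)"
        using hol_fun_pullback[OF F cocycle(2)[OF \<eta> c] I] by (auto simp: hol_fun_def)
      show "snd d y \<in> ?V" using y yp by (auto simp: coord_dom_def)
    next
      fix y' assume y': "y' \<in> fst d" "snd d y' \<in> ?V" "y' \<notin> T" "\<psi> y' \<notin> S"
      have yp': "y' \<in> points Y" by (rule Y.chart_points[OF d y'(1)])
      have \<psi>c: "\<psi> y' \<in> fst c"
        using y'(1,2) chart_inj[OF chartY[OF d]] by (auto simp: coord_dom_def inj_on_def)
      have inv: "\<phi> (\<psi> y') = y'" by (rule \<phi>\<psi>[OF yp' y'(3,4)])
      have \<psi>p: "\<psi> y' \<in> points X" by (rule chart_points[OF c \<psi>c])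
      have zV: "snd d y' \<in> ?V" by (rule y'(2))
      have Fz: "?F (snd d y') = snd c (\<psi> y')" by (rule coord_snd[OF chartY[OF d] y'(1)])
      have "pullback n p ?F (\<lambda>z K. \<eta> c z K {}) (snd d y') I =
          pullback n p ?F (pullback n p (coord \<phi> c d) (\<lambda>y K. \<omega> d y K {})) (snd d y') I"
      proof (rule pullback_cong[OF V zV refl _ I])
        fix K assume "K \<in> multi_index n p"
        then show "\<eta> c (?F (snd d y')) K {} = pullback n p (coord \<phi> c d) (\<lambda>y K. \<omega> d y K {}) (?F (snd d y')) K"
          using p c d \<psi>c y' inv unfolding Fz pull_def by simp
      qed
      also have "\<dots> = pullback n p (coord (\<lambda>y. \<phi> (\<psi> y)) d d) (\<lambda>y K. \<omega> d y K {}) (snd d y') I"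
        by (rule pullback_chain[OF \<psi> \<phi> d c d _ y'(1) _ \<psi>c _ I]) (use yp' y' \<psi>p inv in auto)
      \<comment> \<open>Derivatives enter the pullback, so the composite must be the identity near
        the point; the good points form an open set.\<close>
      also have "\<dots> = pullback n p (\<lambda>z. z) (\<lambda>y K. \<omega> d y K {}) (snd d y') I"
      proof (rule pullback_cong[OF _ _ _ _ I])
        let ?A = "snd d ` (fst d \<inter> {y\<in>points Y. y \<notin> T \<and> \<psi> y \<notin> S})"
        have "openin (cm_top Y) {y\<in>points Y. y \<notin> T \<and> \<psi> y \<notin> S}"
          by (rule Y.openin_good)
        then show "open_cspace n ?A" by (rule chart_open_image[OF chartY[OF d]])
        show "snd d y' \<in> ?A" using yp' y' by blast
        show "coord (\<lambda>y. \<phi> (\<psi> y)) d d z = z" if "z \<in> ?A" for z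
          using that \<phi>\<psi> coord_snd[OF chartY[OF d], of _ "\<lambda>y. \<phi> (\<psi> y)" d] by auto
      qed simp
      also have "\<dots> = \<omega> d (snd d y') I {}" by (rule pullback_id[OF I])
      finally show "\<omega> d (snd d y') I {} = pullback n p ?F (\<lambda>z K. \<eta> c z K {}) (snd d y') I" by simp
    qed
  qed
qed

lemma ext_deriv_cong:
  assumes V: "open_cspace n V" and z: "z \<in> V" and I: "I \<in> multi_index n (Suc p)"
    and eq: "\<And>y K. y \<in> V \<Longrightarrow> K \<in> multi_index n p \<Longrightarrow> w y K = w' y K"
  shows "ext_deriv w z I = ext_deriv w' z I"
  unfolding ext_deriv_def
proof (rule sum.cong[OF refl])
  fix k assume k: "k \<in> I"
  have kn: "k < n" using k I by (auto simp: multi_index_def)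
  have "I - {k} \<in> multi_index n p" using k I multi_index_finite[OF I] by (auto simp: multi_index_def)
  then have "partial_deriv k (\<lambda>y. w y (I - {k})) z = partial_deriv k (\<lambda>y. w' y (I - {k})) z"
    using eq by (intro partial_deriv_cong[OF V z kn]) auto
  then show "index_sign I k * partial_deriv k (\<lambda>y. w y (I - {k})) z = index_sign I k * partial_deriv k (\<lambda>y. w' y (I - {k})) z" by simp
qed

context bimero
begin

text \<open>Off \<open>S\<close> the coefficients are forced and holomorphic, and they extend. The
  transformation law and closedness pass to the extension because both are equalities of continuous
  functions that hold on a dense set.\<close>

lemma pull_exists:
  assumes \<omega>: "\<omega> \<in> BC_cocycles Y p 0"
  shows "\<exists>\<eta>\<in>BC_cocycles X p 0. pull \<omega> \<eta> p"
proof -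
  interpret Y: bimero n Y T \<psi> X S \<phi> by (rule swap)
  let ?A = "points X - S"
  define w where "w d = (\<lambda>y K. \<omega> d y K {})" for d
  \<comment> \<open>Two target charts give the same value by the transformation law of \<omega> and
    functoriality of the pullback.\<close>
  have indep: "pullback n p (coord \<phi> c d) (w d) (snd c x) I = pullback n p (coord \<phi> c d') (w d') (snd c x) I"
    if c: "c \<in> cm_atlas X" and d: "d \<in> cm_atlas Y" "d' \<in> cm_atlas Y" and x: "x \<in> fst c" "x \<notin> S" "\<phi> x \<in> fst d" "\<phi> x \<in> fst d'"
      and I: "I \<in> multi_index n p" for c d d' x I
  proof -
    have xp: "x \<in> points X" by (rule chart_points[OF c x(1)])
    have xV: "snd c x \<in> coord_dom ?A \<phi> c d" using x xp by (auto simp: coord_dom_def)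
    have V: "open_cspace n (coord_dom ?A \<phi> c d)" using holo_between_coord[OF \<phi> c d(1)] by (simp add: hol_map_def)
    have "pullback n p (coord \<phi> c d) (w d) (snd c x) I = pullback n p (coord \<phi> c d) (pullback n p (coord (\<lambda>y. y) d d') (w d')) (snd c x) I"
    proof (rule pullback_cong[OF V xV refl _ I])
      fix K assume K: "K \<in> multi_index n p"
      show "w d (coord \<phi> c d (snd c x)) K = pullback n p (coord (\<lambda>y. y) d d') (w d') (coord \<phi> c d (snd c x)) K"
        unfolding w_def coord_snd[OF chartX[OF c] x(1)] transition_coord[symmetric]
        by (rule Y.cocycle(3)[OF \<omega> d x(3,4) K])
    qed
    also have "\<dots> = pullback n p (coord (\<lambda>x. \<phi> x) c d') (w d') (snd c x) I"
      by (rule pullback_chain[OF \<phi> holo_between_id[OF Y] c d _ x(1) _ x(3) x(4) I])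
        (use xp x Y.chart_points[OF d(1) x(3)] in auto)
    finally show ?thesis .
  qed
  \<comment> \<open>The chosen target chart may jump from point to point; by \<open>indep\<close>,
    near a given point \<open>g\<close> still has a formula with one fixed chart.\<close>
  define dd where "dd c z = (SOME d. d \<in> cm_atlas Y \<and> \<phi> (chart_inv c z) \<in> fst d)" for c :: "'a chart" and z
  define g where "g c I z = pullback n p (coord \<phi> c (dd c z)) (w (dd c z)) z I" for c I z
  have g: "g c I (snd c x) = pullback n p (coord \<phi> c d) (w d) (snd c x) I"
    if c: "c \<in> cm_atlas X" and d: "d \<in> cm_atlas Y" and x: "x \<in> fst c" "x \<notin> S" "\<phi> x \<in> fst d" and I: "I \<in> multi_index n p" for c d x I
  proof -
    have "dd c (snd c x) \<in> cm_atlas Y \<and> \<phi> (chart_inv c (snd c x)) \<in> fst (dd c (snd c x))"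
      unfolding dd_def by (rule someI[of _ d]) (use d x chart_inv_left[OF chartX[OF c] x(1)] in simp)
    then have "dd c (snd c x) \<in> cm_atlas Y" "\<phi> x \<in> fst (dd c (snd c x))"
      using chart_inv_left[OF chartX[OF c] x(1)] by auto
    then show ?thesis unfolding g_def using indep[OF c _ d x(1,2) _ x(3) I] by blast
  qed
  have ghol: "hol_fun n (snd c ` (fst c - S)) (g c I)" if c: "c \<in> cm_atlas X" and I: "I \<in> multi_index n p" for c I
  proof (rule hol_fun_local)
    have "open_cspace n (snd c ` (fst c \<inter> ?A))" by (rule chart_open_image[OF chartX[OF c] openin_complement[OF X S]])
    moreover have "fst c \<inter> ?A = fst c - S" using chart_points[OF c] by blast
    ultimately show "open_cspace n (snd c ` (fst c - S))" by simp
    fix z assume "z \<in> snd c ` (fst c - S)"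
    then obtain x where x: "x \<in> fst c" "x \<notin> S" "z = snd c x" by blast
    have xp: "x \<in> points X" by (rule chart_points[OF c x(1)])
    obtain d where d: "d \<in> cm_atlas Y" "\<phi> x \<in> fst d" using \<phi>_in_chart[OF xp x(2)] .
    let ?V = "coord_dom ?A \<phi> c d"
    have F: "hol_map n ?V (chart_image d) (coord \<phi> c d)" by (rule holo_between_coord[OF \<phi> c d(1)])
    have V: "open_cspace n ?V" using F by (simp add: hol_map_def)
    have "hol_fun n ?V (\<lambda>z. pullback n p (coord \<phi> c d) (w d) z I)"
      by (rule hol_fun_pullback[OF F _ I]) (use Y.cocycle(2)[OF \<omega> d(1)] in \<open>simp add: w_def\<close>)
    then have "hol_fun n ?V (g c I)"
      by (rule hol_fun_cong[OF V, rotated]) (use g[OF c d(1) _ _ _ I] in \<open>auto simp: coord_dom_def\<close>)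
    moreover have "z \<in> ?V" using x d xp by (auto simp: coord_dom_def)
    ultimately show "\<exists>V. open_cspace n V \<and> z \<in> V \<and> hol_fun n V (g c I)" using V by blast
  qed
  define u where "u c I = (SOME u. hol_fun n (chart_image c) u \<and> (\<forall>z\<in>snd c ` (fst c - S). u z = g c I z))" for c I
  have u: "hol_fun n (chart_image c) (u c I) \<and> (\<forall>z\<in>snd c ` (fst c - S). u c I z = g c I z)"
    if c: "c \<in> cm_atlas X" and I: "I \<in> multi_index n p" for c I
  proof -
    obtain v where "hol_fun n (chart_image c) v" "\<And>z. z \<in> snd c ` (fst c - S) \<Longrightarrow> v z = g c I z"
      by (rule extension_in_chart[OF X S c ghol[OF c I]]) (rule that)
    then have "\<exists>v. hol_fun n (chart_image c) v \<and> (\<forall>z\<in>snd c ` (fst c - S). v z = g c I z)"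
      by (intro exI[of _ v] conjI ballI)
    then show ?thesis unfolding u_def by (rule someI_ex)
  qed
  define \<eta> :: "'a cform" where
    "\<eta> = (\<lambda>c z I J. if c \<in> cm_atlas X \<and> z \<in> chart_image c \<and> I \<in> multi_index n p \<and> J = {} then u c I z else 0)"
  have \<eta>u: "\<eta> c z I {} = u c I z" if "c \<in> cm_atlas X" "z \<in> chart_image c" "I \<in> multi_index n p" for c z I
    using that by (simp add: \<eta>_def)
  have pull: "\<eta> c (snd c x) I {} = pullback n p (coord \<phi> c d) (w d) (snd c x) I"
    if "c \<in> cm_atlas X" "d \<in> cm_atlas Y" "x \<in> fst c" "x \<notin> S" "\<phi> x \<in> fst d" "I \<in> multi_index n p" for c d x I
    using that \<eta>u[of c "snd c x" I] u[of c I] g[of c d x I] by simp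
  have hol: "hol_fun n (chart_image c) (\<lambda>z. \<eta> c z I {})" if c: "c \<in> cm_atlas X" for c I
  proof (cases "I \<in> multi_index n p")
    case True
    show ?thesis
      by (rule hol_fun_cong[OF imageX_open_cspace[OF c] _ conjunct1[OF u[OF c True]]]) (simp add: \<eta>u[OF c _ True])
  next
    case False
    then show ?thesis by (simp add: \<eta>_def hol_fun_const)
  qed
  have "\<eta> \<in> BC_cocycles X p 0"
    unfolding BC_cocycles_iff[OF X]
  proof (intro conjI allI ballI impI)
    show "\<eta> c z I J = 0" if "\<not> (c \<in> cm_atlas X \<and> z \<in> chart_image c \<and> I \<in> multi_index n p \<and> J = {})" for c z I J
      using that by (simp only: \<eta>_def if_False)
    show "hol_fun n (chart_image c) (\<lambda>z. \<eta> c z I {})" if "c \<in> cm_atlas X" for c I by (rule hol[OF that])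
  next
    fix c c' z I
    assume c: "c \<in> cm_atlas X" "c' \<in> cm_atlas X" and z: "z \<in> snd c ` (fst c \<inter> fst c')" and I: "I \<in> multi_index n p"
    have cd: "coord_dom (points X) (\<lambda>x. x) c c' = snd c ` (fst c \<inter> fst c')" using chart_points[OF c(1)] by (auto simp: coord_dom_def)
    have F: "hol_map n (snd c ` (fst c \<inter> fst c')) (chart_image c') (transition c c')"
      using holo_between_coord[OF holo_between_id[OF X] c] unfolding cd transition_coord .
    have V: "open_cspace n (snd c ` (fst c \<inter> fst c'))" using F by (simp add: hol_map_def)
    have Vsub: "snd c ` (fst c \<inter> fst c') \<subseteq> chart_image c" by blast
    show "\<eta> c z I {} = pullback n p (transition c c') (\<lambda>y K. \<eta> c' y K {}) z I"
    proof (rule eq_on_chart[OF c(1) V Vsub _ _ _ z, where u="\<lambda>z. \<eta> c z I {}" and v="\<lambda>z. pullback n p (transition c c') (\<lambda>y K. \<eta> c' y K {}) z I"])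
      show "continuous_on (snd c ` (fst c \<inter> fst c')) (\<lambda>z. \<eta> c z I {})"
        using hol_fun_subset[OF hol[OF c(1)] Vsub] by (simp add: hol_fun_def)
      show "continuous_on (snd c ` (fst c \<inter> fst c')) (\<lambda>z. pullback n p (transition c c') (\<lambda>y K. \<eta> c' y K {}) z I)"
        using hol_fun_pullback[OF F hol[OF c(2)] I] by (simp add: hol_fun_def)
      fix x assume x: "x \<in> fst c" "snd c x \<in> snd c ` (fst c \<inter> fst c')" "x \<notin> S"
      have xc': "x \<in> fst c'" using x(1,2) chart_inj[OF chartX[OF c(1)]] by (auto simp: inj_on_def)
      have xp: "x \<in> points X" by (rule chart_points[OF c(1) x(1)])
      obtain d where d: "d \<in> cm_atlas Y" "\<phi> x \<in> fst d" using \<phi>_in_chart[OF xp x(3)] .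
      \<comment> \<open>Off \<open>S\<close> both sides are the pullback of \<omega> to
        \<open>c\<close>, once directly and once through \<open>c'\<close>.\<close>
      have "pullback n p (transition c c') (\<lambda>y K. \<eta> c' y K {}) (snd c x) I
          = pullback n p (transition c c') (pullback n p (coord \<phi> c' d) (w d)) (snd c x) I"
      proof (rule pullback_cong[OF V x(2) refl _ I])
        fix K assume K: "K \<in> multi_index n p"
        show "\<eta> c' (transition c c' (snd c x)) K {} = pullback n p (coord \<phi> c' d) (w d) (transition c c' (snd c x)) K"
          unfolding transition_coord coord_snd[OF chartX[OF c(1)] x(1)]
          by (rule pull[OF c(2) d(1) xc' x(3) d(2) K])
      qed
      also have "\<dots> = pullback n p (coord (\<lambda>x. \<phi> x) c d) (w d) (snd c x) I"
        unfolding transition_coord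
        by (rule pullback_chain[OF holo_between_id[OF X] \<phi> c d(1) _ x(1) _ xc' d(2) I]) (use xp x(3) in auto)
      also have "\<dots> = \<eta> c (snd c x) I {}" using pull[OF c(1) d(1) x(1,3) d(2) I] by simp
      finally show "\<eta> c (snd c x) I {} = pullback n p (transition c c') (\<lambda>y K. \<eta> c' y K {}) (snd c x) I" by simp
    qed
  next
    fix c z I assume c: "c \<in> cm_atlas X" and z: "z \<in> chart_image c" and I: "I \<in> multi_index n (Suc p)"
    show "ext_deriv (\<lambda>y I. \<eta> c y I {}) z I = 0"
    proof (rule eq_on_chart[OF c imageX_open_cspace[OF c] order_refl _ _ _ z, where v="\<lambda>_. 0" and u="\<lambda>z. ext_deriv (\<lambda>y I. \<eta> c y I {}) z I"])
      show "continuous_on (chart_image c) (\<lambda>z. ext_deriv (\<lambda>y I. \<eta> c y I {}) z I)"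
        unfolding ext_deriv_def
      proof (intro continuous_on_sum continuous_on_mult continuous_on_const)
        fix k assume "k \<in> I"
        then have "k < n" using I by (auto simp: multi_index_def)
        then show "continuous_on (chart_image c) (partial_deriv k (\<lambda>y. \<eta> c y (I - {k}) {}))"
          by (rule partial_deriv_continuous[OF hol[OF c] imageX_open_cspace[OF c]])
      qed
      show "continuous_on (chart_image c) (\<lambda>_. 0::complex)" by (rule continuous_on_const)
      fix x assume x: "x \<in> fst c" "x \<notin> S"
      have xp: "x \<in> points X" by (rule chart_points[OF c x(1)])
      obtain d where d: "d \<in> cm_atlas Y" "\<phi> x \<in> fst d" using \<phi>_in_chart[OF xp x(2)] .
      let ?V = "coord_dom ?A \<phi> c d"
      have F: "hol_map n ?V (chart_image d) (coord \<phi> c d)" by (rule holo_between_coord[OF \<phi> c d(1)])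
      have V: "open_cspace n ?V" using F by (simp add: hol_map_def)
      have xV: "snd c x \<in> ?V" using x d xp by (auto simp: coord_dom_def)
      have "ext_deriv (\<lambda>y I. \<eta> c y I {}) (snd c x) I = ext_deriv (pullback n p (coord \<phi> c d) (w d)) (snd c x) I"
        by (rule ext_deriv_cong[OF V xV I]) (use pull[OF c d(1)] in \<open>auto simp: coord_dom_def\<close>)
      also have "\<dots> = 0"
        by (rule ext_deriv_pullback_eq_0[OF F _ _ xV I]) (use Y.cocycle(2,4)[OF \<omega> d(1)] in \<open>simp_all add: w_def\<close>)
      finally show "ext_deriv (\<lambda>y I. \<eta> c y I {}) (snd c x) I = 0" .
    qed
  qed
  moreover have "pull \<omega> \<eta> p" unfolding pull_def using pull by (simp add: w_def)
  ultimately show ?thesis by blast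
qed

end

section \<open>Linearity and comparison of dimensions\<close>

lemma pullback_add: "pullback n p F (\<lambda>y K. w y K + w' y K) z I = pullback n p F w z I + pullback n p F w' z I"
  by (simp add: pullback_def algebra_simps sum.distrib)

lemma pullback_smult: "pullback n p F (\<lambda>y K. a * w y K) z I = a * pullback n p F w z I"
  by (simp add: pullback_def sum_distrib_left mult_ac)

lemma ext_deriv_add:
  assumes "\<And>K. hol_fun n V (\<lambda>y. w y K)" "\<And>K. hol_fun n V (\<lambda>y. w' y K)" "z \<in> V" "I \<in> multi_index n q"
  shows "ext_deriv (\<lambda>y K. w y K + w' y K) z I = ext_deriv w z I + ext_deriv w' z I"
  unfolding ext_deriv_def sum.distrib[symmetric] distrib_left[symmetric]
proof (rule sum.cong[OF refl])
  fix k assume "k \<in> I"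
  then have "k < n" using assms(4) by (auto simp: multi_index_def)
  from partial_deriv_add[OF assms(1,2,3) this]
  show "index_sign I k * partial_deriv k (\<lambda>y. w y (I - {k}) + w' y (I - {k})) z =
      index_sign I k * (partial_deriv k (\<lambda>y. w y (I - {k})) z + partial_deriv k (\<lambda>y. w' y (I - {k})) z)" by simp
qed

lemma ext_deriv_smult:
  assumes "\<And>K. hol_fun n V (\<lambda>y. w y K)" "z \<in> V" "I \<in> multi_index n q"
  shows "ext_deriv (\<lambda>y K. a * w y K) z I = a * ext_deriv w z I"
  unfolding ext_deriv_def sum_distrib_left
proof (rule sum.cong[OF refl])
  fix k assume "k \<in> I"
  then have k: "k < n" using assms(3) by (auto simp: multi_index_def)
  have "partial_deriv k (\<lambda>y. a * w y (I - {k})) z = a * partial_deriv k (\<lambda>y. w y (I - {k})) z"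
    using DERIV_imp_deriv[OF DERIV_cmult[OF hol_fun_has_partial_deriv[OF assms(1,2) k], of a]]
    by (simp add: partial_deriv_def[of _ "\<lambda>y. a * w y (I - {k})"])
  then show "index_sign I k * partial_deriv k (\<lambda>y. a * w y (I - {k})) z = a * (index_sign I k * partial_deriv k (\<lambda>y. w y (I - {k})) z)"
    by simp
qed

lemma lin_closed_BC_cocycles:
  assumes M: "complex_manifold M" and n: "cm_dim M = n"
  shows "lin_closed (BC_cocycles M p 0)"
  unfolding lin_closed_def
proof (intro conjI ballI allI)
  note iff = BC_cocycles_iff[OF M n]
  have pd0: "partial_deriv k (\<lambda>y. 0) z = 0" for k z by (simp add: partial_deriv_def)
  show "zero_form \<in> BC_cocycles M p 0"
    unfolding iff zero_form_def by (simp add: hol_fun_const pullback_def ext_deriv_def pd0)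
  fix \<omega> assume \<omega>: "\<omega> \<in> BC_cocycles M p 0"
  note w = \<omega>[unfolded iff]
  note w1 = w[THEN conjunct1, rule_format] and w2 = w[THEN conjunct2, THEN conjunct1, rule_format]
    and w3 = w[THEN conjunct2, THEN conjunct2, THEN conjunct1, rule_format]
    and w4 = w[THEN conjunct2, THEN conjunct2, THEN conjunct2, rule_format]
  show "form_smult a \<omega> \<in> BC_cocycles M p 0" for a
    unfolding iff form_smult_def
  proof (intro conjI allI ballI impI)
    fix c z I and J :: "nat set" assume "\<not> (c \<in> cm_atlas M \<and> z \<in> chart_image c \<and> I \<in> multi_index n p \<and> J = {})"
    from w1[OF this] show "a * \<omega> c z I J = 0" by simp
  next
    fix c I assume c: "c \<in> cm_atlas M"
    show "hol_fun n (chart_image c) (\<lambda>z. a * \<omega> c z I {})" by (intro hol_fun_mult hol_fun_const w2 c)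
  next
    fix c c' z I assume "c \<in> cm_atlas M" "c' \<in> cm_atlas M" "z \<in> snd c ` (fst c \<inter> fst c')" "I \<in> multi_index n p"
    from w3[OF this] show "a * \<omega> c z I {} = pullback n p (transition c c') (\<lambda>y K. a * \<omega> c' y K {}) z I"
      by (simp add: pullback_smult)
  next
    fix c z I assume c: "c \<in> cm_atlas M" "z \<in> chart_image c" "I \<in> multi_index n (Suc p)"
    from w4[OF c] show "ext_deriv (\<lambda>y I. a * \<omega> c y I {}) z I = 0"
      by (simp add: ext_deriv_smult[OF w2[OF c(1)] c(2,3)])
  qed
  fix \<eta> assume \<eta>: "\<eta> \<in> BC_cocycles M p 0"
  note v = \<eta>[unfolded iff]
  note v1 = v[THEN conjunct1, rule_format] and v2 = v[THEN conjunct2, THEN conjunct1, rule_format]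
    and v3 = v[THEN conjunct2, THEN conjunct2, THEN conjunct1, rule_format]
    and v4 = v[THEN conjunct2, THEN conjunct2, THEN conjunct2, rule_format]
  show "form_add \<omega> \<eta> \<in> BC_cocycles M p 0"
    unfolding iff form_add_def
  proof (intro conjI allI ballI impI)
    fix c z I and J :: "nat set" assume "\<not> (c \<in> cm_atlas M \<and> z \<in> chart_image c \<and> I \<in> multi_index n p \<and> J = {})"
    from w1[OF this] v1[OF this] show "\<omega> c z I J + \<eta> c z I J = 0" by simp
  next
    fix c I assume c: "c \<in> cm_atlas M"
    show "hol_fun n (chart_image c) (\<lambda>z. \<omega> c z I {} + \<eta> c z I {})" by (intro hol_fun_add w2 v2 c)
  next
    fix c c' z I assume "c \<in> cm_atlas M" "c' \<in> cm_atlas M" "z \<in> snd c ` (fst c \<inter> fst c')" "I \<in> multi_index n p"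
    from w3[OF this] v3[OF this]
    show "\<omega> c z I {} + \<eta> c z I {} = pullback n p (transition c c') (\<lambda>y K. \<omega> c' y K {} + \<eta> c' y K {}) z I"
      by (simp add: pullback_add)
  next
    fix c z I assume c: "c \<in> cm_atlas M" "z \<in> chart_image c" "I \<in> multi_index n (Suc p)"
    from w4[OF c] v4[OF c] show "ext_deriv (\<lambda>y I. \<omega> c y I {} + \<eta> c y I {}) z I = 0"
      by (simp add: ext_deriv_add[OF w2[OF c(1)] v2[OF c(1)] c(2,3)])
  qed
qed

lemma h_BC_p0: "h_BC M p 0 = vectorspace.dim class_ring (triv_quot (BC_cocycles M p 0))"
  by (simp add: h_BC_def H_BC_def BC_coboundaries_def)

text \<open>Uniqueness on the \<open>Y\<close> side gives injectivity and existence there gives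
  surjectivity, both through \<open>pull_inverse\<close>. Linearity holds because sums and multiples
  again satisfy \<open>pull\<close>.\<close>

theorem (in bimero) h_BC_eq: "h_BC X p 0 = h_BC Y p 0"
proof -
  interpret Y: bimero n Y T \<psi> X S \<phi> by (rule swap)
  let ?ZX = "BC_cocycles X p 0" and ?ZY = "BC_cocycles Y p 0"
  \<comment> \<open>\<open>pull_exists\<close> and \<open>pull_unique\<close> turn the relation into
    a map on cocycles.\<close>
  define L where "L \<omega> = (THE \<eta>. \<eta> \<in> ?ZX \<and> pull \<omega> \<eta> p)" for \<omega>
  have L: "L \<omega> = \<eta>" if "\<eta> \<in> ?ZX" "pull \<omega> \<eta> p" for \<omega> \<eta>
    unfolding L_def by (rule the_equality) (use that pull_unique in blast)+
  have LZ: "L \<omega> \<in> ?ZX \<and> pull \<omega> (L \<omega>) p" if "\<omega> \<in> ?ZY" for \<omega>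
    using pull_exists[OF that] L by metis
  have linX: "lin_closed ?ZX" and linY: "lin_closed ?ZY"
    using lin_closed_BC_cocycles X Y by blast+
  have "vectorspace.dim class_ring (triv_quot ?ZY) = vectorspace.dim class_ring (triv_quot ?ZX)"
  proof (rule dim_triv_quot_eq[OF linY linX, of L])
    show "bij_betw L ?ZY ?ZX"
      unfolding bij_betw_def
    proof
      show "inj_on L ?ZY"
      proof (rule inj_onI)
        fix \<omega> \<omega>' assume \<omega>: "\<omega> \<in> ?ZY" "\<omega>' \<in> ?ZY" and eq: "L \<omega> = L \<omega>'"
        have "Y.pull (L \<omega>) \<omega> p" "Y.pull (L \<omega>) \<omega>' p"
          using pull_inverse[OF \<omega>(1)] pull_inverse[OF \<omega>(2)] LZ[OF \<omega>(1)] LZ[OF \<omega>(2)] eq by auto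
        then show "\<omega> = \<omega>'" by (rule Y.pull_unique[OF \<omega>])
      qed
      show "L ` ?ZY = ?ZX"
      proof (intro equalityI subsetI)
        fix \<eta> assume \<eta>: "\<eta> \<in> ?ZX"
        then obtain \<omega> where \<omega>: "\<omega> \<in> ?ZY" "Y.pull \<eta> \<omega> p" using Y.pull_exists by blast
        have "L \<omega> = \<eta>" by (rule L[OF \<eta> Y.pull_inverse[OF \<eta> \<omega>]])
        then show "\<eta> \<in> L ` ?ZY" using \<omega>(1) by blast
      qed (use LZ in blast)
    qed
    show "L (form_add \<omega> \<omega>') = form_add (L \<omega>) (L \<omega>')" if "\<omega> \<in> ?ZY" "\<omega>' \<in> ?ZY" for \<omega> \<omega>'
    proof (rule L)
      show "form_add (L \<omega>) (L \<omega>') \<in> ?ZX" using linX LZ that unfolding lin_closed_def by blast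
      show "pull (form_add \<omega> \<omega>') (form_add (L \<omega>) (L \<omega>')) p"
        using LZ[OF that(1)] LZ[OF that(2)] unfolding pull_def by (simp add: form_add_def pullback_add)
    qed
    show "L (form_smult a \<omega>) = form_smult a (L \<omega>)" if "\<omega> \<in> ?ZY" for a \<omega>
    proof (rule L)
      show "form_smult a (L \<omega>) \<in> ?ZX" using linX LZ that unfolding lin_closed_def by blast
      show "pull (form_smult a \<omega>) (form_smult a (L \<omega>)) p"
        using LZ[OF that(1)] unfolding pull_def by (simp add: form_smult_def pullback_smult)
    qed
  qed
  then show ?thesis by (simp add: h_BC_p0)
qed

section \<open>From the graph to a pair of holomorphic maps\<close>

lemma hmapI:
  assumes M: "complex_manifold M" "cm_dim M = n" and N: "complex_manifold N" "cm_dim N = n"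
    and A: "openin (cm_top M) A" and im: "\<And>x. x \<in> A \<Longrightarrow> \<phi> x \<in> points N"
    and loc: "\<And>x d. x \<in> A \<Longrightarrow> d \<in> cm_atlas N \<Longrightarrow> \<phi> x \<in> fst d \<Longrightarrow>
      \<exists>U F. openin (cm_top M) U \<and> x \<in> U \<and> (\<forall>y\<in>A \<inter> U. \<phi> y \<in> fst d) \<and>
        (\<forall>k<n. holomorphic_fun_on M U (F k) \<and> (\<forall>y\<in>A \<inter> U. snd d (\<phi> y) k = F k y))"
  shows "holo_between n M A N \<phi>"
proof -
  have ch: "is_chart n (cm_top M) c" if "c \<in> cm_atlas M" for c using manifold_chart[OF M(1) that] M(2) by simp
  have op: "open_cspace n (coord_dom A \<phi> c d)" if c: "c \<in> cm_atlas M" and d: "d \<in> cm_atlas N" for c d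
    unfolding coord_dom_def
  proof (rule chart_open_image[OF ch[OF c]], subst openin_subopen, rule ballI)
    fix x assume x: "x \<in> {x\<in>A. \<phi> x \<in> fst d}"
    then obtain U where U: "openin (cm_top M) U" "x \<in> U" "\<forall>y\<in>A \<inter> U. \<phi> y \<in> fst d" using loc[of x d] d by blast
    show "\<exists>T. openin (cm_top M) T \<and> x \<in> T \<and> T \<subseteq> {x\<in>A. \<phi> x \<in> fst d}"
      by (rule exI[of _ "A \<inter> U"]) (use U x A in \<open>auto intro: openin_Int\<close>)
  qed
  have hol: "hol_fun n (coord_dom A \<phi> c d) (\<lambda>z. coord \<phi> c d z k)"
    if c: "c \<in> cm_atlas M" and d: "d \<in> cm_atlas N" and k: "k < n" for c d k
  proof (rule hol_fun_local[OF _ op[OF c d]])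
    fix z assume "z \<in> coord_dom A \<phi> c d"
    then obtain x where x: "x \<in> fst c" "x \<in> A" "\<phi> x \<in> fst d" "z = snd c x" by (auto simp: coord_dom_def)
    obtain U F where U: "openin (cm_top M) U" "x \<in> U" 
      "\<forall>k<n. holomorphic_fun_on M U (F k) \<and> (\<forall>y\<in>A \<inter> U. snd d (\<phi> y) k = F k y)" using loc[OF x(2) d x(3)] by blast
    let ?V = "snd c ` (fst c \<inter> (A \<inter> U))"
    have V: "open_cspace n ?V" by (rule chart_open_image[OF ch[OF c] openin_Int[OF A U(1)]])
    have "holomorphic_fun_on M U (F k)" using U(3) k by blast
    then have "hol_fun n (snd c ` (fst c \<inter> U)) (\<lambda>z. F k (chart_inv c z))"
      using c M(2) unfolding holomorphic_fun_on_def by blast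
    then have "hol_fun n ?V (\<lambda>z. F k (chart_inv c z))" by (rule hol_fun_subset) blast
    then have "hol_fun n ?V (\<lambda>z. coord \<phi> c d z k)"
    proof (rule hol_fun_cong[OF V, rotated])
      fix z' assume "z' \<in> ?V"
      then obtain y where y: "y \<in> fst c" "y \<in> A \<inter> U" "z' = snd c y" by blast
      then show "F k (chart_inv c z') = coord \<phi> c d z' k"
        using U(3) k coord_snd[OF ch[OF c] y(1), of \<phi> d] chart_inv_left[OF ch[OF c] y(1)] by simp
    qed
    moreover have "z \<in> ?V" using x U(2) by blast
    ultimately show "\<exists>V. open_cspace n V \<and> z \<in> V \<and> hol_fun n V (\<lambda>z. coord \<phi> c d z k)" using V by (intro exI[of _ ?V] conjI)
  qed
  show ?thesis
    unfolding holo_between_def using M N A im op hol by (intro conjI ballI allI impI image_subsetI)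
qed

lemma points_prod: "points (prod_cmanifold X Y) = points X \<times> points Y"
  by (simp add: prod_cmanifold_def)

text \<open>A product chart lists the coordinates of \<open>X\<close> before those of
  \<open>Y\<close>, so the components are read off at the indices \<open>k\<close> and
  \<open>n + k\<close>. Testing one component also requires picking a chart around the
  other.\<close>

lemma holo_between_components:
  assumes M: "complex_manifold M" "cm_dim M = n" and X: "complex_manifold X" "cm_dim X = n"
    and Y: "complex_manifold Y" "cm_dim Y = n" and A: "openin (cm_top M) A"
    and h: "holomorphic_map M A (prod_cmanifold X Y) B h"
  shows "holo_between n M A X (\<lambda>x. fst (h x))" "holo_between n M A Y (\<lambda>x. snd (h x))"
proof -
  have pts: "fst (h x) \<in> points X" "snd (h x) \<in> points Y" if "x \<in> A" for x
  proof -
    have "h x \<in> points (prod_cmanifold X Y)" using h that unfolding holomorphic_map_def by blast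
    then show "fst (h x) \<in> points X" "snd (h x) \<in> points Y" by (auto simp: points_prod)
  qed
  have loc: "\<exists>U F. openin (cm_top M) U \<and> x \<in> U \<and> (\<forall>y\<in>A \<inter> U. fst (h y) \<in> fst c \<and> snd (h y) \<in> fst d) \<and>
      (\<forall>i<n + n. holomorphic_fun_on M U (F i) \<and> (\<forall>y\<in>A \<inter> U. snd (prod_chart n c d) (h y) i = F i y))"
    if x: "x \<in> A" and c: "c \<in> cm_atlas X" "fst (h x) \<in> fst c" and d: "d \<in> cm_atlas Y" "snd (h x) \<in> fst d" for x c d
  proof -
    let ?e = "prod_chart n c d"
    have e1: "?e \<in> cm_atlas (prod_cmanifold X Y)"
      unfolding prod_cmanifold_def cmanifold.simps X(2)
      by (intro CollectI exI[of _ c] exI[of _ d] conjI refl c(1) d(1))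
    have e2: "h x \<in> fst ?e" using c(2) d(2) by (simp add: prod_chart_def mem_Times_iff)
    have "\<forall>a\<in>A. \<forall>c\<in>cm_atlas (prod_cmanifold X Y). h a \<in> fst c \<longrightarrow>
        (\<exists>U F. openin (cm_top M) U \<and> a \<in> U \<and> h ` (A \<inter> U) \<subseteq> fst c \<and>
          (\<forall>i<cm_dim (prod_cmanifold X Y). holomorphic_fun_on M U (F i) \<and> (\<forall>y\<in>A \<inter> U. snd c (h y) i = F i y)))"
      using h unfolding holomorphic_map_def by (elim conjE)
    from this[rule_format, OF x e1 e2] obtain U F where U: "openin (cm_top M) U" "x \<in> U" "h ` (A \<inter> U) \<subseteq> fst ?e"
      "\<forall>i<cm_dim (prod_cmanifold X Y). holomorphic_fun_on M U (F i) \<and> (\<forall>y\<in>A \<inter> U. snd ?e (h y) i = F i y)"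
      by (elim exE conjE)
    have "fst (h y) \<in> fst c \<and> snd (h y) \<in> fst d" if "y \<in> A \<inter> U" for y
    proof -
      have "h y \<in> fst ?e" using U(3) that by blast
      then show ?thesis by (simp add: prod_chart_def mem_Times_iff)
    qed
    then show ?thesis using U X(2) Y(2) by (intro exI[of _ U] exI[of _ F]) (auto simp: prod_cmanifold_def)
  qed
  show "holo_between n M A X (\<lambda>x. fst (h x))"
  proof (rule hmapI[OF M X A pts(1)])
    fix x c assume x: "x \<in> A" and c: "c \<in> cm_atlas X" "fst (h x) \<in> fst c"
    obtain d where d: "d \<in> cm_atlas Y" "snd (h x) \<in> fst d" using pts(2)[OF x] Y(1) by (auto simp: complex_manifold_def)
    obtain U F where U: "openin (cm_top M) U" "x \<in> U" "\<forall>y\<in>A \<inter> U. fst (h y) \<in> fst c \<and> snd (h y) \<in> fst d"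
      "\<forall>i<n + n. holomorphic_fun_on M U (F i) \<and> (\<forall>y\<in>A \<inter> U. snd (prod_chart n c d) (h y) i = F i y)"
      using loc[OF x c d] by blast
    have "holomorphic_fun_on M U (F k) \<and> (\<forall>y\<in>A \<inter> U. snd c (fst (h y)) k = F k y)" if k: "k < n" for k
    proof -
      have "holomorphic_fun_on M U (F k) \<and> (\<forall>y\<in>A \<inter> U. snd (prod_chart n c d) (h y) k = F k y)" using U(4) k by simp
      then show ?thesis using k by (simp add: prod_chart_def case_prod_unfold)
    qed
    then show "\<exists>U F. openin (cm_top M) U \<and> x \<in> U \<and> (\<forall>y\<in>A \<inter> U. fst (h y) \<in> fst c) \<and>
        (\<forall>k<n. holomorphic_fun_on M U (F k) \<and> (\<forall>y\<in>A \<inter> U. snd c (fst (h y)) k = F k y))"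
      using U(1-3) by (intro exI[of _ U] exI[of _ F]) simp
  qed
  show "holo_between n M A Y (\<lambda>x. snd (h x))"
  proof (rule hmapI[OF M Y A pts(2)])
    fix x d assume x: "x \<in> A" and d: "d \<in> cm_atlas Y" "snd (h x) \<in> fst d"
    obtain c where c: "c \<in> cm_atlas X" "fst (h x) \<in> fst c" using pts(1)[OF x] X(1) by (auto simp: complex_manifold_def)
    obtain U F where U: "openin (cm_top M) U" "x \<in> U" "\<forall>y\<in>A \<inter> U. fst (h y) \<in> fst c \<and> snd (h y) \<in> fst d"
      "\<forall>i<n + n. holomorphic_fun_on M U (F i) \<and> (\<forall>y\<in>A \<inter> U. snd (prod_chart n c d) (h y) i = F i y)"
      using loc[OF x c d] by blast
    have "holomorphic_fun_on M U (F (n + k)) \<and> (\<forall>y\<in>A \<inter> U. snd d (snd (h y)) k = F (n + k) y)" if k: "k < n" for k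
    proof -
      have "holomorphic_fun_on M U (F (n + k)) \<and> (\<forall>y\<in>A \<inter> U. snd (prod_chart n c d) (h y) (n + k) = F (n + k) y)"
        using U(4) k by simp
      then show ?thesis by (simp add: prod_chart_def case_prod_unfold)
    qed
    then show "\<exists>U F. openin (cm_top M) U \<and> x \<in> U \<and> (\<forall>y\<in>A \<inter> U. snd (h y) \<in> fst d) \<and>
        (\<forall>k<n. holomorphic_fun_on M U (F k) \<and> (\<forall>y\<in>A \<inter> U. snd d (snd (h y)) k = F k y))"
      using U(1-3) by (intro exI[of _ U] exI[of _ "\<lambda>k. F (n + k)"]) simp
  qed
qed

text \<open>Each projection of the graph has a holomorphic inverse off its exceptional set, and
  composing it with the opposite projection gives the two maps. They invert each other because both
  pass through the same point of the graph.\<close>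

lemma bimeromorphic_map_bimero:
  assumes X: "complex_manifold X" "cm_dim X = n" and Y: "complex_manifold Y" "cm_dim Y = n"
    and f: "bimeromorphic_map X Y f"
  obtains S \<phi> T \<psi> where "bimero n X S \<phi> Y T \<psi>"
proof -
  let ?P = "prod_cmanifold X Y" and ?G = "mero_graph X Y f"
  have mod: "modification ?P ?G X fst" "modification ?P ?G Y snd"
    using f by (auto simp: bimeromorphic_map_def meromorphic_map_def)
  have Gsub: "?G \<subseteq> points X \<times> points Y" by (auto simp: mero_graph_def)
  obtain S where S: "analytic_subset X S" "codim_at_least X S 2"
    and clS: "?G \<subseteq> (cm_top ?P) closure_of (?G - fst -` S)"
    and bS: "biholomorphism ?P (?G - fst -` S) X (points X - S) fst"
    using mod(1) unfolding modification_def by blast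
  obtain T where T: "analytic_subset Y T" "codim_at_least Y T 2"
    and clT: "?G \<subseteq> (cm_top ?P) closure_of (?G - snd -` T)"
    and bT: "biholomorphism ?P (?G - snd -` T) Y (points Y - T) snd"
    using mod(2) unfolding modification_def by blast
  obtain h where h: "holomorphic_map X (points X - S) ?P (?G - fst -` S) h"
    "\<And>q. q \<in> ?G - fst -` S \<Longrightarrow> h (fst q) = q" "\<And>x. x \<in> points X - S \<Longrightarrow> fst (h x) = x"
    using bS unfolding biholomorphism_def by blast
  obtain k where k: "holomorphic_map Y (points Y - T) ?P (?G - snd -` T) k"
    "\<And>q. q \<in> ?G - snd -` T \<Longrightarrow> k (snd q) = q" "\<And>y. y \<in> points Y - T \<Longrightarrow> snd (k y) = y"
    using bT unfolding biholomorphism_def by blast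
  have hG: "h x \<in> ?G" if "x \<in> points X - S" for x using h(1) that unfolding holomorphic_map_def by blast
  have kG: "k y \<in> ?G" if "y \<in> points Y - T" for y using k(1) that unfolding holomorphic_map_def by blast
  have oS: "openin (cm_top X) (points X - S)" by (rule openin_complement[OF X S])
  have oT: "openin (cm_top Y) (points Y - T)" by (rule openin_complement[OF Y T])
  have "bimero n X S (\<lambda>x. snd (h x)) Y T (\<lambda>y. fst (k y))"
  proof (rule bimero.intro)
    show "holo_between n X (points X - S) Y (\<lambda>x. snd (h x))" by (rule holo_between_components(2)[OF X X Y oS h(1)])
    show "holo_between n Y (points Y - T) X (\<lambda>y. fst (k y))" by (rule holo_between_components(1)[OF Y X Y oT k(1)])
    show "fst (k (snd (h x))) = x" if x: "x \<in> points X" "x \<notin> S" "snd (h x) \<notin> T" for x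
    proof -
      have "h x \<in> ?G - snd -` T" using hG[of x] x by simp
      then show ?thesis using k(2)[of "h x"] h(3)[of x] x by simp
    qed
    show "snd (h (fst (k y))) = y" if y: "y \<in> points Y" "y \<notin> T" "fst (k y) \<notin> S" for y
    proof -
      have "k y \<in> ?G - fst -` S" using kG[of y] y by simp
      then show ?thesis using h(2)[of "k y"] k(3)[of y] y by simp
    qed
    show "\<exists>x\<in>A. x \<notin> S \<and> snd (h x) \<notin> T" if A: "openin (cm_top X) A" "A \<noteq> {}" for A
    proof -
      obtain x0 where x0: "x0 \<in> A - S" using thin_open[OF X S A] by blast
      have AX: "A \<subseteq> points X" by (rule openin_subset[OF A(1)])
      \<comment> \<open>Graph points off \<open>T\<close> are dense in the graph, so this
        neighbourhood of \<open>h x0\<close> contains one. It is the value of \<open>h\<close> at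
        its first component, which lies in \<open>A\<close> and avoids both exceptional
        sets.\<close>
      let ?N = "(A \<inter> (points X - S)) \<times> points Y"
      have hx0: "h x0 \<in> ?G" using hG x0 AX by blast
      have N1: "openin (cm_top ?P) ?N"
        using A(1) oS by (simp add: prod_cmanifold_def openin_prod_Times_iff openin_Int)
      have N2: "h x0 \<in> ?N"
        using hx0 Gsub h(3)[of x0] x0 AX by (auto simp: mem_Times_iff)
      obtain q where q: "q \<in> ?G - snd -` T" "q \<in> ?N"
        using subsetD[OF clT hx0, unfolded in_closure_of, THEN conjunct2, rule_format, OF conjI[OF N2 N1]] by (elim exE conjE)
      have "h (fst q) = q" using h(2)[of q] q by auto
      then show ?thesis using q by (intro bexI[of _ "fst q"]) auto
    qed
    show "\<exists>y\<in>A. y \<notin> T \<and> fst (k y) \<notin> S" if A: "openin (cm_top Y) A" "A \<noteq> {}" for A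
    proof -
      obtain y0 where y0: "y0 \<in> A - T" using thin_open[OF Y T A] by blast
      have AY: "A \<subseteq> points Y" by (rule openin_subset[OF A(1)])
      let ?N = "points X \<times> (A \<inter> (points Y - T))"
      have ky0: "k y0 \<in> ?G" using kG y0 AY by blast
      have N1: "openin (cm_top ?P) ?N"
        using A(1) oT by (simp add: prod_cmanifold_def openin_prod_Times_iff openin_Int)
      have N2: "k y0 \<in> ?N"
        using ky0 Gsub k(3)[of y0] y0 AY by (auto simp: mem_Times_iff)
      obtain q where q: "q \<in> ?G - fst -` S" "q \<in> ?N"
        using subsetD[OF clS ky0, unfolded in_closure_of, THEN conjunct2, rule_format, OF conjI[OF N2 N1]] by (elim exE conjE)
      have "k (snd q) = q" using k(2)[of q] q by auto
      then show ?thesis using q by (intro bexI[of _ "snd q"]) auto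
    qed
  qed (rule S T)+
  then show ?thesis by (rule that)
qed

theorem corollary3p6:
  fixes X :: "'a cmanifold" and Y :: "'b cmanifold" and n p :: nat
  assumes "compact_complex_manifold X" and "cm_dim X = n"
    and "compact_complex_manifold Y" and "cm_dim Y = n"
    and "bimeromorphically_equivalent X Y"
    and "0 \<le> p" and "p \<le> n"
  shows "h_BC X p 0 = h_BC Y p 0"
proof -
  have M: "complex_manifold X" "complex_manifold Y"
    using assms(1,3) by (simp_all add: compact_complex_manifold_def)
  obtain f where "bimeromorphic_map X Y f"
    using assms(5) by (auto simp: bimeromorphically_equivalent_def)
  then obtain S \<phi> T \<psi> where "bimero n X S \<phi> Y T \<psi>"
    by (rule bimeromorphic_map_bimero[OF M(1) assms(2) M(2) assms(4)])
  then show ?thesis by (rule bimero.h_BC_eq)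
qed

end
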